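(* Let $\Gamma$ be a compact metric graph (connected, finitely many edges, each of finite length) with first Betti number $\beta$ and set of boundary (degree-one) vertices $V_b$. Let $W:\Gamma\to\mathbb{R}$ be $C^1$ and assume $\Gamma$ is $W$-generic. Let $f_1,f_2,\dots$ be the eigenfunctions of $H_W=-\frac{\partial^2}{\partial x^2}+W$ with Dirichlet boundary conditions and Neumann–Kirchhoff vertex conditions, let $k_1<k_2<\dots<k_M$ be a strictly increasing sequence of positive integers, and let $F(x)=\sum_{i=1}^{M}a_i f_{k_i}(x)$ where every $a_i\neq 0$. Then $$k_1-1-(M-1)\left(|V_b|+2\beta-2\right)\leq N(F)\leq k_M-1+\beta+(M-1)\left(|V_b|+2\beta-2\right).$$
   Context: A metric graph $\Gamma=(V,E)$: each edge $e$ is identified with an interval $[0,l_e]$; the degree $\deg(v)$ of a vertex counts incident edges with loops counted twice. Boundary vertices $V_b$ are those of degree one; inner vertices $V_i$ those of degree at least two. The first Betti number is $\beta=|E|-|V|+1$. The operator $H_W=-\frac{d^2}{dx^2}+W$ acts edgewise on functions in $\bigoplus_e H^2(e)$ satisfying: $f(v)=0$ at boundary vertices (Dirichlet); at each inner vertex $v$, $f$ is continuous and $\sum_{e\ni v}\partial_e f(v)=0$, where $\partial_e f(v)$ is the derivative at $v$ along $e$ pointing into $e$ (Neumann–Kirchhoff). This operator is self-adjoint with eigenvalues $\lambda_1\le\lambda_2\le\dots$ (with multiplicity) and $L^2$-orthogonal eigenfunctions $f_1,f_2,\dots$, $f_k$ belonging to $\lambda_k$. $\Gamma$ is called $W$-generic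 if no eigenfunction of $H_W$ vanishes at any inner vertex (in particular all eigenvalues are simple). For a function $f$ on $\Gamma$, $N(f)$ denotes the number of zeroes of $f$ on $\Gamma$ other than the boundary vertices. *)

theory Defs
  imports Complex_Main
begin

text \<open>A compact metric graph is given by a finite vertex set V, a finite edge set E,
  endpoint maps src, tgt (loops src e = tgt e and multiple edges allowed) and edge lengths
  l e > 0.  Edge e is identified with [0, l e], the point 0 corresponding to src e and
  l e to tgt e.  Functions on the graph are edgewise functions f :: 'e => real => real
  (only the values on [0, l e] matter).\<close>

definition metric_graph :: "'v set \<Rightarrow> 'e set \<Rightarrow> ('e \<Rightarrow> 'v) \<Rightarrow> ('e \<Rightarrow> 'v) \<Rightarrow> ('e \<Rightarrow> real) \<Rightarrow> bool" where
  "metric_graph V E src tgt l \<longleftrightarrow>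
     finite V \<and> finite E \<and> E \<noteq> {} \<and>
     (\<forall>e\<in>E. src e \<in> V \<and> tgt e \<in> V \<and> l e > 0) \<and>
     (\<forall>u\<in>V. \<forall>w\<in>V. (\<lambda>x y. \<exists>e\<in>E. (src e = x \<and> tgt e = y) \<or> (src e = y \<and> tgt e = x))\<^sup>*\<^sup>* u w)"

definition deg :: "'e set \<Rightarrow> ('e \<Rightarrow> 'v) \<Rightarrow> ('e \<Rightarrow> 'v) \<Rightarrow> 'v \<Rightarrow> nat" where
  "deg E src tgt v = card {e\<in>E. src e = v} + card {e\<in>E. tgt e = v}"

definition boundary_vertices :: "'v set \<Rightarrow> 'e set \<Rightarrow> ('e \<Rightarrow> 'v) \<Rightarrow> ('e \<Rightarrow> 'v) \<Rightarrow> 'v set" where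
  "boundary_vertices V E src tgt = {v\<in>V. deg E src tgt v = 1}"

definition inner_vertices :: "'v set \<Rightarrow> 'e set \<Rightarrow> ('e \<Rightarrow> 'v) \<Rightarrow> ('e \<Rightarrow> 'v) \<Rightarrow> 'v set" where
  "inner_vertices V E src tgt = {v\<in>V. deg E src tgt v \<ge> 2}"

definition betti :: "'v set \<Rightarrow> 'e set \<Rightarrow> int" where
  "betti V E = int (card E) - int (card V) + 1"

definition vertex_vals :: "'e set \<Rightarrow> ('e \<Rightarrow> 'v) \<Rightarrow> ('e \<Rightarrow> 'v) \<Rightarrow> ('e \<Rightarrow> real) \<Rightarrow> ('e \<Rightarrow> real \<Rightarrow> real) \<Rightarrow> 'v \<Rightarrow> real set" where
  "vertex_vals E src tgt l f v = {f e 0 | e. e \<in> E \<and> src e = v} \<union> {f e (l e) | e. e \<in> E \<and> tgt e = v}"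

definition continuous_at_vertices :: "'v set \<Rightarrow> 'e set \<Rightarrow> ('e \<Rightarrow> 'v) \<Rightarrow> ('e \<Rightarrow> 'v) \<Rightarrow> ('e \<Rightarrow> real) \<Rightarrow> ('e \<Rightarrow> real \<Rightarrow> real) \<Rightarrow> bool" where
  "continuous_at_vertices V E src tgt l f \<longleftrightarrow> (\<forall>v\<in>V. \<exists>c. vertex_vals E src tgt l f v \<subseteq> {c})"

definition C1_potential :: "'v set \<Rightarrow> 'e set \<Rightarrow> ('e \<Rightarrow> 'v) \<Rightarrow> ('e \<Rightarrow> 'v) \<Rightarrow> ('e \<Rightarrow> real) \<Rightarrow> ('e \<Rightarrow> real \<Rightarrow> real) \<Rightarrow> bool" where
  "C1_potential V E src tgt l W \<longleftrightarrow>
     continuous_at_vertices V E src tgt l W \<and>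
     (\<forall>e\<in>E. \<exists>W'. continuous_on {0..l e} W' \<and>
        (\<forall>t\<in>{0..l e}. (W e has_real_derivative W' t) (at t within {0..l e})))"

text \<open>f is an eigenfunction of H_W = -d^2/dx^2 + W with eigenvalue lam, Dirichlet conditions at
  boundary vertices, continuity and Kirchhoff conditions at inner vertices.  D, D2 are the
  first and second (one-sided at the ends) derivatives on each closed edge.  The derivative at
  v pointing into e is D e 0 if v = src e and - D e (l e) if v = tgt e.\<close>
definition eigenfunction :: "'v set \<Rightarrow> 'e set \<Rightarrow> ('e \<Rightarrow> 'v) \<Rightarrow> ('e \<Rightarrow> 'v) \<Rightarrow> ('e \<Rightarrow> real) \<Rightarrow> ('e \<Rightarrow> real \<Rightarrow> real) \<Rightarrow> real \<Rightarrow> ('e \<Rightarrow> real \<Rightarrow> real) \<Rightarrow> bool" where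
  "eigenfunction V E src tgt l W lam f \<longleftrightarrow>
     (\<exists>D D2 :: 'e \<Rightarrow> real \<Rightarrow> real.
        (\<forall>e\<in>E. continuous_on {0..l e} (D2 e) \<and>
           (\<forall>t\<in>{0..l e}. (f e has_real_derivative D e t) (at t within {0..l e}) \<and>
                          (D e has_real_derivative D2 e t) (at t within {0..l e}) \<and>
                          - D2 e t + W e t * f e t = lam * f e t)) \<and>
        (\<forall>v\<in>boundary_vertices V E src tgt. vertex_vals E src tgt l f v \<subseteq> {0}) \<and>
        (\<forall>v\<in>inner_vertices V E src tgt.
            (\<exists>c. vertex_vals E src tgt l f v \<subseteq> {c}) \<and>
            (\<Sum>e\<in>{e\<in>E. src e = v}. D e 0) - (\<Sum>e\<in>{e\<in>E. tgt e = v}. D e (l e)) = 0)) \<and>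
     (\<exists>e\<in>E. \<exists>t\<in>{0..l e}. f e t \<noteq> 0)"

definition eigenvalue :: "'v set \<Rightarrow> 'e set \<Rightarrow> ('e \<Rightarrow> 'v) \<Rightarrow> ('e \<Rightarrow> 'v) \<Rightarrow> ('e \<Rightarrow> real) \<Rightarrow> ('e \<Rightarrow> real \<Rightarrow> real) \<Rightarrow> real \<Rightarrow> bool" where
  "eigenvalue V E src tgt l W lam \<longleftrightarrow> (\<exists>f. eigenfunction V E src tgt l W lam f)"

definition lin_indep_on_graph :: "'e set \<Rightarrow> ('e \<Rightarrow> real) \<Rightarrow> nat \<Rightarrow> (nat \<Rightarrow> 'e \<Rightarrow> real \<Rightarrow> real) \<Rightarrow> bool" where
  "lin_indep_on_graph E l n fs \<longleftrightarrow>
     (\<forall>c :: nat \<Rightarrow> real. (\<forall>e\<in>E. \<forall>t\<in>{0..l e}. (\<Sum>i<n. c i * fs i e t) = 0) \<longrightarrow> (\<forall>i<n. c i = 0))"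

definition multiplicity :: "'v set \<Rightarrow> 'e set \<Rightarrow> ('e \<Rightarrow> 'v) \<Rightarrow> ('e \<Rightarrow> 'v) \<Rightarrow> ('e \<Rightarrow> real) \<Rightarrow> ('e \<Rightarrow> real \<Rightarrow> real) \<Rightarrow> real \<Rightarrow> nat" where
  "multiplicity V E src tgt l W lam =
     Sup {n. \<exists>fs. (\<forall>i<n. eigenfunction V E src tgt l W lam (fs i)) \<and> lin_indep_on_graph E l n fs}"

text \<open>f is a k-th eigenfunction: an eigenfunction for lambda_k, where eigenvalues
  lambda_1 <= lambda_2 <= ... are counted with multiplicity.\<close>
definition kth_eigenfunction :: "'v set \<Rightarrow> 'e set \<Rightarrow> ('e \<Rightarrow> 'v) \<Rightarrow> ('e \<Rightarrow> 'v) \<Rightarrow> ('e \<Rightarrow> real) \<Rightarrow> ('e \<Rightarrow> real \<Rightarrow> real) \<Rightarrow> nat \<Rightarrow> ('e \<Rightarrow> real \<Rightarrow> real) \<Rightarrow> bool" where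
  "kth_eigenfunction V E src tgt l W k f \<longleftrightarrow>
     (\<exists>lam. eigenfunction V E src tgt l W lam f \<and>
        (let below = (\<Sum>mu\<in>{mu. eigenvalue V E src tgt l W mu \<and> mu < lam}. multiplicity V E src tgt l W mu)
         in below < k \<and> k \<le> below + multiplicity V E src tgt l W lam))"

definition W_generic :: "'v set \<Rightarrow> 'e set \<Rightarrow> ('e \<Rightarrow> 'v) \<Rightarrow> ('e \<Rightarrow> 'v) \<Rightarrow> ('e \<Rightarrow> real) \<Rightarrow> ('e \<Rightarrow> real \<Rightarrow> real) \<Rightarrow> bool" where
  "W_generic V E src tgt l W \<longleftrightarrow>
     (\<forall>lam f. eigenfunction V E src tgt l W lam f \<longrightarrow>
        (\<forall>v\<in>inner_vertices V E src tgt. 0 \<notin> vertex_vals E src tgt l f v))"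

definition zero_vertices :: "'v set \<Rightarrow> 'e set \<Rightarrow> ('e \<Rightarrow> 'v) \<Rightarrow> ('e \<Rightarrow> 'v) \<Rightarrow> ('e \<Rightarrow> real) \<Rightarrow> ('e \<Rightarrow> real \<Rightarrow> real) \<Rightarrow> 'v set" where
  "zero_vertices V E src tgt l F = {v\<in>inner_vertices V E src tgt. 0 \<in> vertex_vals E src tgt l F v}"

definition zero_edge_points :: "'e set \<Rightarrow> ('e \<Rightarrow> real) \<Rightarrow> ('e \<Rightarrow> real \<Rightarrow> real) \<Rightarrow> ('e \<times> real) set" where
  "zero_edge_points E l F = {(e, t). e \<in> E \<and> 0 < t \<and> t < l e \<and> F e t = 0}"

end

theory Submission
  imports Defs "HOL-Complex_Analysis.Great_Picard"
begin

text \<open>Let \<open>c\<close> be so large that \<open>H + c\<close> is positive, and let the combination flow in discrete time: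
  \<open>u\<^sub>s = \<Sum> a\<^sub>i (\<lambda>\<^sub>i + c)\<^sup>-\<^sup>s f\<^sub>i\<close>, so that \<open>(H + c) u\<^sub>s\<^sub>+\<^sub>1 = u\<^sub>s\<close>.  By the maximum principle on the edges
  and Kirchhoff's condition, one step creates at most deg v - 2 zeros at each inner vertex v, and only
  at those v at which \<open>u\<^sub>\<tau> v\<close> vanishes for some \<open>s \<le> \<tau> < s + 1\<close>.  As a function of \<open>\<tau>\<close> this value is an
  exponential sum with M terms, so v is responsible for at most M - 1 such steps, and the
  sum of deg v - 2 over the inner vertices is |V_b| + 2 \<beta> - 2.  Since \<open>u\<^sub>s\<close> looks like the highest
  eigenfunction for s near minus infinity and like the lowest one for s near plus infinity, this
  reduces the theorem to the bounds k - 1 and k - 1 + \<beta> for a single eigenfunction f of index k.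

  If f had fewer than k - 1 zeros, some combination of lower eigenfunctions would vanish at all of them,
  contradicting Picone's identity.  If f had more than k - 1 + \<beta> zeros, a dimension count
  would give a nontrivial multiple of f by a locally constant factor that is orthogonal to the lower
  eigenfunctions and vanishes on some piece of an edge; it would minimise the quadratic form on the
  orthogonal complement and hence be an eigenfunction.\<close>

subsection \<open>Maximum principle on an edge\<close>

text \<open>One step of the flow solves \<open>G'' = q * G - K\<close> with \<open>q > 0\<close>, so
  the question becomes how the zeros of a solution \<open>G\<close> are controlled by those of its
  source \<open>K\<close>. The link between them is a sample, a point where \<open>G\<close> and
  \<open>K\<close> have the same strict sign: two zeros of \<open>G\<close> enclose a sample, and
  two samples with a zero of \<open>G\<close> between them enclose a zero of \<open>K\<close>. Each
  of the two passages loses one point, so an edge loses two. This loss is split between its two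
  halves and repaid by scores that depend only on the data at the vertex. Kirchhoff's condition
  supplies a half-edge whose outgoing derivative has a prescribed weak sign; its extra score
  improves the loss at a vertex v from deg v to deg v - 2. For single eigenfunctions the obstacle is
  that multiples broken at the zeros are not differentiable there. The form domain therefore admits
  finitely many corners and carries the derivative as separate data; minimisers are recognised as
  classical solutions only after passing to the limit in the weak equation.\<close>

lemma card_le_Suc_between:
  fixes A B :: "real set"
  assumes "finite A" "finite B" "\<And>x y. x \<in> A \<Longrightarrow> y \<in> A \<Longrightarrow> x < y \<Longrightarrow> \<exists>z\<in>B. x < z \<and> z < y"
  shows "card A \<le> card B + 1"
  using assms
proof (induction "card A" arbitrary: A B)
  case 0
  then show ?case by simp
next
  case (Suc n)
  define m where "m = Max A"
  have ne: "A \<noteq> {}" using Suc by auto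
  have mA: "m \<in> A" using Suc ne m_def by auto
  define A' where "A' = A - {m}"
  have cA': "card A' = n" using Suc mA A'_def by auto
  show ?case
  proof (cases "A' = {}")
    case True
    then show ?thesis using cA' Suc by auto
  next
    case False
    define m' where "m' = Max A'"
    have fA': "finite A'" using Suc A'_def by auto
    have m'A: "m' \<in> A'" using False fA' m'_def by auto
    have "m' \<le> m" unfolding m_def using m'A A'_def Suc by (auto)
    moreover have "m' \<noteq> m" using m'A A'_def by auto
    ultimately have lt: "m' < m" by auto
    obtain z where z: "z \<in> B" "m' < z" "z < m" using Suc(5)[of m' m] m'A mA lt A'_def by auto
    have "card A' \<le> card (B - {z}) + 1"
    proof (rule Suc(1))
      show "n = card A'" using cA' by simp
      show "finite A'" by fact
      show "finite (B - {z})" using Suc by simp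
      fix x y assume xy: "x \<in> A'" "y \<in> A'" "x < y"
      obtain w where w: "w \<in> B" "x < w" "w < y" using Suc(5)[of x y] xy A'_def by auto
      have "y \<le> m'" using xy fA' m'_def by auto
      then have "w \<noteq> z" using w z by auto
      then show "\<exists>z'\<in>B - {z}. x < z' \<and> z' < y" using w by auto
    qed
    moreover have "card B = card (B - {z}) + 1" using z Suc(4) by (metis Suc_eq_plus1 card.remove)
    ultimately show ?thesis using Suc(2) cA' by simp
  qed
qed

text \<open>One point is picked in each gap between neighbours of \<open>A\<close>, by removing the
  maximum again and again. Exactly one element is lost and the new points are in turn separated by
  \<open>A\<close>, so the passage from zeros to samples can be followed by one from samples to
  zeros of the source.\<close>

lemma exists_separated_between:
  fixes A :: "real set"
  assumes "finite A" "A \<noteq> {}"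
    and "\<And>x y. x \<in> A \<Longrightarrow> y \<in> A \<Longrightarrow> x < y \<Longrightarrow> \<exists>p. x < p \<and> p < y \<and> P p"
  shows "\<exists>B. finite B \<and> card B + 1 = card A \<and> (\<forall>p\<in>B. P p \<and> Min A < p \<and> p < Max A) \<and>
            (\<forall>x\<in>B. \<forall>y\<in>B. x < y \<longrightarrow> (\<exists>z\<in>A. x < z \<and> z < y))"
  using assms
proof (induction "card A" arbitrary: A)
  case 0
  then show ?case by simp
next
  case (Suc n)
  define m where "m = Max A"
  have mA: "m \<in> A" using Suc m_def by auto
  define A' where "A' = A - {m}"
  have cA': "card A' = n" using Suc mA A'_def by auto
  have fA': "finite A'" using Suc A'_def by auto
  show ?case
  proof (cases "A' = {}")
    case True
    then have "card A = 1" using cA' Suc by auto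
    then show ?thesis by (intro exI[of _ "{}"]) auto
  next
    case False
    define m' where "m' = Max A'"
    have m'A: "m' \<in> A'" using False fA' m'_def by auto
    have "m' \<le> m" unfolding m_def using m'A A'_def Suc by (auto)
    moreover have "m' \<noteq> m" using m'A A'_def by auto
    ultimately have lt: "m' < m" by auto
    have "\<exists>B. finite B \<and> card B + 1 = card A' \<and> (\<forall>p\<in>B. P p \<and> Min A' < p \<and> p < Max A') \<and>
            (\<forall>x\<in>B. \<forall>y\<in>B. x < y \<longrightarrow> (\<exists>z\<in>A'. x < z \<and> z < y))"
      using Suc(1)[of A'] cA' fA' False Suc(5) unfolding A'_def by auto
    then obtain B where B: "finite B" "card B + 1 = card A'" "\<And>p. p \<in> B \<Longrightarrow> P p \<and> Min A' < p \<and> p < Max A'"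
      "\<And>x y. x\<in>B \<Longrightarrow> y\<in>B \<Longrightarrow> x < y \<Longrightarrow> (\<exists>z\<in>A'. x < z \<and> z < y)" by blast
    obtain p where p: "m' < p" "p < m" "P p" using Suc(5)[of m' m] m'A mA lt A'_def by auto
    have minle: "Min A \<le> Min A'" using False fA' Suc(3) A'_def by (auto intro!: Min_antimono)
    have pB: "p \<notin> B" using B(3) p m'_def by force
    have mm: "Min A' \<le> m'" using fA' m'A by auto
    show ?thesis
    proof (intro exI[of _ "insert p B"] conjI ballI impI)
      show "finite (insert p B)" using B by simp
      show "card (insert p B) + 1 = card A" using B pB Suc(2) cA' by simp
    next
      fix x assume "x \<in> insert p B"
      then show "P x" using p B by auto
    next
      fix x assume x: "x \<in> insert p B"
      then show "Min A < x" using p B(3) minle mm by (smt (verit) insertE)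
    next
      fix x assume x: "x \<in> insert p B"
      then show "x < Max A" using p B(3) m_def m'_def lt by (smt (verit) insertE)
    next
      fix x y assume xy: "x \<in> insert p B" "y \<in> insert p B" "x < y"
      show "\<exists>z\<in>A. x < z \<and> z < y"
      proof (cases "y = p")
        case True
        then have "x \<in> B" using xy by auto
        then have "x < m'" using B(3) m'_def by auto
        then show ?thesis using True p m'A A'_def by auto
      next
        case False
        then have yB: "y \<in> B" using xy by auto
        then have "y < m'" using B(3) m'_def by auto
        then have "x \<in> B" using xy p by auto
        then show ?thesis using B(4)[of x y] yB xy A'_def by auto
      qed
    qed
  qed
qed

section \<open>The maximum principle and samples on one edge\<close>

lemma second_derivative_nonpos_at_max:
  fixes f :: "real \<Rightarrow> real"
  assumes m: "a < m" "m < b"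
    and d: "\<And>t. a < t \<Longrightarrow> t < b \<Longrightarrow> (f has_real_derivative f1 t) (at t)"
    and d2: "(f1 has_real_derivative c) (at m)"
    and mx: "\<And>t. a < t \<Longrightarrow> t < b \<Longrightarrow> f t \<le> f m"
  shows "c \<le> 0"
proof (rule ccontr)
  assume "\<not> c \<le> 0"
  then have c: "c > 0" by simp
  have f10: "f1 m = 0"
  proof (rule DERIV_local_max[OF d[OF m]])
    show "0 < min (m - a) (b - m)" using m by simp
    show "\<forall>y. \<bar>m - y\<bar> < min (m - a) (b - m) \<longrightarrow> f y \<le> f m" using mx by (auto simp: abs_if split: if_splits)
  qed
  obtain e where e: "e > 0" "\<And>h. 0 < h \<Longrightarrow> h < e \<Longrightarrow> f1 m < f1 (m + h)"
    using DERIV_pos_inc_right[OF d2 c] by auto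
  define h where "h = min e (b - m) / 2"
  have h: "0 < h" "h < e" "m + h < b" using e(1) m by (auto simp: h_def min_def field_simps)
  obtain z where z: "m < z" "z < m + h" "f (m + h) - f m = (m + h - m) * f1 z"
    using MVT2[of m "m + h" f f1] h m d by auto
  have "f1 z > 0" using e(2)[of "z - m"] z h f10 by auto
  then have "f (m + h) > f m" using z(3) mult_pos_pos[OF h(1) \<open>f1 z > 0\<close>] by simp
  then show False using mx[of "m + h"] h m by auto
qed

text \<open>This is \<open>(- d^2/dx^2 + q) G = K\<close> on one edge, with \<open>G1\<close> the
  derivative of \<open>G\<close>. Positivity of \<open>q\<close> is what makes a maximum principle
  available; in the flow \<open>q\<close> is \<open>W + c\<close>.\<close>

definition edge_eq :: "real \<Rightarrow> (real \<Rightarrow> real) \<Rightarrow> (real \<Rightarrow> real) \<Rightarrow> (real \<Rightarrow> real) \<Rightarrow> (real \<Rightarrow> real) \<Rightarrow> bool" where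
  "edge_eq l q G G1 K \<longleftrightarrow> 0 < l \<and> continuous_on {0..l} K \<and>
     (\<forall>t\<in>{0..l}. 0 < q t \<and> (G has_real_derivative G1 t) (at t within {0..l}) \<and>
        (G1 has_real_derivative q t * G t - K t) (at t within {0..l}))"

lemma edge_eq_minus:
  assumes "edge_eq l q G G1 K"
  shows "edge_eq l q (\<lambda>t. - G t) (\<lambda>t. - G1 t) (\<lambda>t. - K t)"
proof -
  have "((\<lambda>t. - G1 t) has_real_derivative q t * - G t - - K t) (at t within {0..l})" if "t \<in> {0..l}" for t
    using DERIV_minus[of G1 "q t * G t - K t" t "{0..l}"] assms that by (simp add: edge_eq_def)
  then show ?thesis using assms by (auto simp: edge_eq_def intro!: continuous_intros DERIV_minus)
qed

lemma has_real_derivative_reflect: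
  assumes "(f has_real_derivative D) (at (l - t) within {0..l})" "t \<in> {0..l}"
  shows "((\<lambda>t. f (l - t)) has_real_derivative - D) (at t within {0..l::real})"
proof -
  have im: "(\<lambda>t. l - t) ` {0..l} = {0..l}"
    by simp
  have "((\<lambda>t. l - t) has_real_derivative - 1) (at t within {0..l})"
    by (auto intro!: derivative_eq_intros)
  then have "((f \<circ> (\<lambda>t. l - t)) has_real_derivative D * (-1)) (at t within {0..l})"
    using assms im by (intro DERIV_image_chain) auto
  then show ?thesis by (simp add: o_def)
qed

lemma edge_eq_reflect:
  assumes "edge_eq l q G G1 K"
  shows "edge_eq l (\<lambda>t. q (l - t)) (\<lambda>t. G (l - t)) (\<lambda>t. - G1 (l - t)) (\<lambda>t. K (l - t))"
proof -
  have l: "0 < l" and K: "continuous_on {0..l} K"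
    and q: "\<And>t. t \<in> {0..l} \<Longrightarrow> 0 < q t"
    and d: "\<And>t. t \<in> {0..l} \<Longrightarrow> (G has_real_derivative G1 t) (at t within {0..l})"
    and d1: "\<And>t. t \<in> {0..l} \<Longrightarrow> (G1 has_real_derivative q t * G t - K t) (at t within {0..l})"
    using assms by (auto simp: edge_eq_def)
  have r: "l - t \<in> {0..l}" if "t \<in> {0..l}" for t using that by auto
  have "continuous_on {0..l} (\<lambda>t. K (l - t))"
    by (rule continuous_on_compose2[OF K]) (auto intro!: continuous_intros)
  moreover have "((\<lambda>t. - G1 (l - t)) has_real_derivative q (l - t) * G (l - t) - K (l - t)) (at t within {0..l})"
    if "t \<in> {0..l}" for t
    using DERIV_minus[OF has_real_derivative_reflect[OF d1[OF r[OF that]] that]] by simp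
  ultimately show ?thesis
    unfolding edge_eq_def using l q r has_real_derivative_reflect d by auto
qed

lemma edge_eqD:
  assumes "edge_eq l q G G1 K"
  shows "0 < l" "continuous_on {0..l} K" "continuous_on {0..l} G" "continuous_on {0..l} G1"
    "\<And>t. t \<in> {0..l} \<Longrightarrow> 0 < q t"
    "\<And>t. 0 < t \<Longrightarrow> t < l \<Longrightarrow> (G has_real_derivative G1 t) (at t)"
    "\<And>t. 0 < t \<Longrightarrow> t < l \<Longrightarrow> (G1 has_real_derivative q t * G t - K t) (at t)"
proof -
  show "continuous_on {0..l} G" "continuous_on {0..l} G1"
    unfolding continuous_on_eq_continuous_within
    using assms by (auto simp: edge_eq_def intro: DERIV_continuous)
  show "(G has_real_derivative G1 t) (at t)" "(G1 has_real_derivative q t * G t - K t) (at t)"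
    if "0 < t" "t < l" for t
    using assms that at_within_Icc_at[of 0 t l] unfolding edge_eq_def
    by (metis atLeastAtMost_iff less_le)+
qed (use assms in \<open>auto simp: edge_eq_def\<close>)

text \<open>At an interior maximum \<open>G''\<close> is at most 0, so
  \<open>K = q * G - G''\<close> is at least \<open>q * G\<close>, which is positive. Points where
  \<open>G\<close> and \<open>K\<close> share a strict sign are the samples of the counting
  argument.\<close>

lemma pos_max_sample:
  assumes e: "edge_eq l q G G1 K" and m: "0 \<le> a" "a < m" "m < b" "b \<le> l"
    and mx: "\<And>t. a < t \<Longrightarrow> t < b \<Longrightarrow> G t \<le> G m" and pos: "G m > 0"
  shows "K m > 0"
proof -
  have "q m * G m - K m \<le> 0"
    by (rule second_derivative_nonpos_at_max[of a m b G G1])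
      (use edge_eqD[OF e] m mx in auto)
  moreover have "q m * G m > 0" using edge_eqD(5)[OF e, of m] m pos by auto
  ultimately show ?thesis by linarith
qed

lemma sample_between_aux:
  assumes e: "edge_eq l q G G1 K" and ab: "0 \<le> a" "a < b" "b \<le> l"
    and z: "G a \<le> 0" "G b \<le> 0" and t: "a < t" "t < b" "G t > 0"
  shows "\<exists>p. a < p \<and> p < b \<and> G p > 0 \<and> K p > 0"
proof -
  have "continuous_on {a..b} G" using edge_eqD(3)[OF e] by (rule continuous_on_subset) (use ab in auto)
  then obtain m where m: "m \<in> {a..b}" "\<And>y. y \<in> {a..b} \<Longrightarrow> G y \<le> G m"
    using continuous_attains_sup[of "{a..b}" G] ab by auto
  have "G m > 0" using m(2)[of t] t by auto
  then have "a < m" "m < b" using m(1) z by (auto simp: order_less_le)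
  then show ?thesis using pos_max_sample[OF e, of a m b] ab m \<open>G m > 0\<close> by auto
qed

text \<open>The extremum of \<open>G\<close> on the side of \<open>G t\<close> is a sample; the
  negative case follows by flipping the signs of \<open>G\<close> and \<open>K\<close>
  together.\<close>

lemma sample_between:
  assumes e: "edge_eq l q G G1 K" and ab: "0 \<le> a" "a < b" "b \<le> l"
    and z: "G a = 0" "G b = 0" and t: "a < t" "t < b" "G t \<noteq> 0"
  shows "\<exists>p. a < p \<and> p < b \<and> G p * K p > 0"
proof (cases "G t > 0")
  case True
  then show ?thesis using sample_between_aux[OF e ab _ _ t(1,2)] z by fastforce
next
  case False
  then show ?thesis using sample_between_aux[OF edge_eq_minus[OF e] ab _ _ t(1,2)] z t
    by simp (metis mult_neg_neg)
qed

lemma no_zero_between_aux: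
  assumes e: "edge_eq l q G G1 K" and ab: "0 \<le> a" "a < b" "b \<le> l"
    and z: "G a > 0" "G b > 0" and K: "\<And>t. a < t \<Longrightarrow> t < b \<Longrightarrow> K t > 0" and t: "a < t" "t < b"
  shows "G t > 0"
proof (rule ccontr)
  assume "\<not> G t > 0"
  then have Gt: "G t \<le> 0" by simp
  have "continuous_on {a..b} G" using edge_eqD(3)[OF e] by (rule continuous_on_subset) (use ab in auto)
  then obtain m where m: "m \<in> {a..b}" "\<And>y. y \<in> {a..b} \<Longrightarrow> G m \<le> G y"
    using continuous_attains_inf[of "{a..b}" G] ab by auto
  have Gm: "G m \<le> 0" using m(2)[of t] t Gt by auto
  then have m': "a < m" "m < b" using m(1) z by (auto simp: order_less_le)
  have "- (q m * G m - K m) \<le> 0"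
    by (rule second_derivative_nonpos_at_max[of a m b "\<lambda>t. - G t" "\<lambda>t. - G1 t"])
      (use edge_eqD[OF e] edge_eqD(7)[OF e, THEN DERIV_minus] m' ab m in \<open>auto intro!: DERIV_minus\<close>)
  moreover have "q m * G m \<le> 0" using edge_eqD(5)[OF e, of m] m' ab Gm
    by (simp add: mult_nonneg_nonpos)
  ultimately show False using K[OF m'] by simp
qed

text \<open>If \<open>K\<close> had no zero between the two samples it would keep one sign,
  \<open>G\<close> would share that sign at both samples, and the minimum principle would exclude
  the zero \<open>z\<close> of \<open>G\<close>.\<close>

lemma source_zero_between:
  assumes e: "edge_eq l q G G1 K" and ab: "0 \<le> a" "a < b" "b \<le> l"
    and s: "G a * K a > 0" "G b * K b > 0" and z: "a < z" "z < b" "G z = 0"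
  shows "\<exists>w. a < w \<and> w < b \<and> K w = 0"
proof (rule ccontr)
  assume "\<not> ?thesis"
  then have nz: "K w \<noteq> 0" if "a \<le> w" "w \<le> b" for w
    using s that by (metis less_le mult_zero_right)
  have cK: "continuous_on {a..b} K" using edge_eqD(2)[OF e] by (rule continuous_on_subset) (use ab in auto)
  have cst: "K x * K y > 0" if xy: "a \<le> x" "x \<le> y" "y \<le> b" for x y
  proof (rule ccontr)
    assume "\<not> K x * K y > 0"
    then have "K x \<le> 0 \<and> 0 \<le> K y \<or> K y \<le> 0 \<and> 0 \<le> K x" by (metis mult_nonneg_nonneg mult_nonpos_nonpos nz less_eq_real_def linorder_not_le mult_pos_pos mult_neg_neg)
    then have "\<exists>w. x \<le> w \<and> w \<le> y \<and> K w = 0"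
      using IVT'[of K x 0 y] IVT2'[of K y 0 x] xy continuous_on_subset[OF cK, of "{x..y}"] by auto
    then show False using nz xy by force
  qed
  show False
  proof (cases "K a > 0")
    case True
    then have "\<And>t. a < t \<Longrightarrow> t < b \<Longrightarrow> K t > 0" using cst[of a] by (simp add: zero_less_mult_iff)
    moreover have "G a > 0" "G b > 0" using True s cst[of a b] ab by (auto simp: zero_less_mult_iff)
    ultimately show False using no_zero_between_aux[OF e ab _ _ _ z(1,2)] z by force
  next
    case False
    then have K: "\<And>t. a < t \<Longrightarrow> t < b \<Longrightarrow> - K t > 0" using cst[of a] by (simp add: zero_less_mult_iff)
    have "- G a > 0" "- G b > 0" using False s cst[of a b] ab by (auto simp: zero_less_mult_iff)
    then show False using no_zero_between_aux[OF edge_eq_minus[OF e] ab _ _ K z(1,2)] z by force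
  qed
qed

subsection \<open>Comparing the zeros of a solution and of its source on an edge\<close>

text \<open>The score of a half-edge carrying, at its vertex, the value g of the solution, the value k of
  the source and the outgoing derivative d.  An edge has at least n - 2 zeros of the source plus the
  scores of its two halves, where n is the number of zeros of the solution.\<close>

definition half_score :: "real \<Rightarrow> real \<Rightarrow> real \<Rightarrow> int \<Rightarrow> bool" where
  "half_score g k d h \<longleftrightarrow> 0 \<le> h \<and> (g = 0 \<or> g * k > 0 \<longrightarrow> 1 \<le> h) \<and>
     (g \<noteq> 0 \<and> g * d \<ge> 0 \<longrightarrow> (g * k < 0 \<longrightarrow> 2 \<le> h) \<and> (k = 0 \<longrightarrow> 1 \<le> h)) \<and>
     (g = 0 \<and> k \<noteq> 0 \<and> d * k \<le> 0 \<longrightarrow> 2 \<le> h)"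

text \<open>Only \<open>x\<close> has to be interior. \<open>y\<close> may be an endpoint, which is
  how the sign at a vertex is compared with the sign inside the edge.\<close>

lemma continuous_nonzero_same_sign:
  fixes f :: "real \<Rightarrow> real"
  assumes c: "continuous_on {a..b} f" and nz: "\<And>t. a < t \<Longrightarrow> t < b \<Longrightarrow> f t \<noteq> 0"
    and x: "a < x" "x < b" and y: "a \<le> y" "y \<le> b" "f y \<noteq> 0"
  shows "f x * f y > 0"
proof (rule ccontr)
  assume neg: "\<not> f x * f y > 0"
  have fx: "f x \<noteq> 0" using nz x by auto
  have "\<exists>w. min x y < w \<and> w < max x y \<and> f w = 0"
  proof -
    have c': "continuous_on {min x y..max x y} f" by (rule continuous_on_subset[OF c]) (use x y in auto)
    have "f (min x y) * f (max x y) < 0"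
      using neg fx y by (auto simp: min_def max_def mult.commute not_less order_less_le)
    then have "\<exists>w. min x y \<le> w \<and> w \<le> max x y \<and> f w = 0"
      using IVT'[of f "min x y" 0 "max x y", OF _ _ _ c'] IVT2'[of f "max x y" 0 "min x y", OF _ _ _ c']
      by (fastforce simp: mult_less_0_iff)
    moreover have "f (min x y) \<noteq> 0" "f (max x y) \<noteq> 0" using fx y by (auto simp: min_def max_def)
    ultimately show ?thesis by (metis less_le)
  qed
  then obtain w where "min x y < w" "w < max x y" "f w = 0" by blast
  then show False using nz[of w] x y by auto
qed

lemma MVT_interior:
  fixes f f' :: "real \<Rightarrow> real"
  assumes "a < b" "continuous_on {a..b} f" and d: "\<And>x. a < x \<Longrightarrow> x < b \<Longrightarrow> (f has_real_derivative f' x) (at x)"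
  shows "\<exists>z. a < z \<and> z < b \<and> f b - f a = (b - a) * f' z"
proof -
  have "\<And>x. a < x \<Longrightarrow> x < b \<Longrightarrow> f differentiable (at x)" using d real_differentiable_def by blast
  then obtain D z where "a < z" "z < b" "DERIV f z :> D" "f b - f a = (b - a) * D"
    using MVT[OF assms(1,2)] by blast
  then show ?thesis using d DERIV_unique by blast
qed

lemma edge_grow_aux:
  assumes e: "edge_eq l q G G1 K" and b: "0 < b" "b \<le> l"
    and K: "\<And>t. 0 < t \<Longrightarrow> t < b \<Longrightarrow> K t \<le> 0" and G: "\<And>t. 0 < t \<Longrightarrow> t < b \<Longrightarrow> G t > 0"
    and d: "0 \<le> G1 0"
  shows "G 0 < G b"
proof -
  have G1: "G1 t > 0" if t: "0 < t" "t < b" for t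
  proof -
    have "continuous_on {0..t} G1" using edge_eqD(4)[OF e] by (rule continuous_on_subset) (use b t in auto)
    then obtain z where z: "0 < z" "z < t" "G1 t - G1 0 = (t - 0) * (q z * G z - K z)"
      using MVT_interior[of 0 t G1 "\<lambda>z. q z * G z - K z"] t edge_eqD(7)[OF e] b by auto
    have "q z * G z > 0" "K z \<le> 0" using G[of z] K[of z] edge_eqD(5)[OF e, of z] z b t by auto
    then have "q z * G z - K z > 0" by simp
    then have "(t - 0) * (q z * G z - K z) > 0" using t by simp
    then show ?thesis using z(3) d by linarith
  qed
  have "continuous_on {0..b} G" using edge_eqD(3)[OF e] by (rule continuous_on_subset) (use b in auto)
  then obtain z where z: "0 < z" "z < b" "G b - G 0 = (b - 0) * G1 z"
    using MVT_interior[of 0 b G G1] edge_eqD(6)[OF e] b by auto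
  have "(b - 0) * G1 z > 0" using G1 z b by simp
  then show ?thesis using z(3) by linarith
qed

text \<open>Without samples \<open>K\<close> never shares the sign of \<open>G\<close>, so
  \<open>G'' = q * G - K\<close> has the strict sign of \<open>G\<close>; if \<open>|G|\<close> does
  not start by decreasing, it grows strictly. Hence an outgoing derivative with
  \<open>G 0 * G1 0 \<ge> 0\<close> can be given a score.\<close>

lemma edge_grow:
  assumes e: "edge_eq l q G G1 K" and b: "0 < b" "b \<le> l"
    and nz: "\<And>t. 0 < t \<Longrightarrow> t < b \<Longrightarrow> G t \<noteq> 0"
    and K: "\<And>t. 0 < t \<Longrightarrow> t < b \<Longrightarrow> G t * K t \<le> 0"
    and g: "G 0 \<noteq> 0" "G 0 * G1 0 \<ge> 0"
  shows "\<bar>G 0\<bar> < \<bar>G b\<bar>"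
proof -
  have "continuous_on {0..b} G" using edge_eqD(3)[OF e] by (rule continuous_on_subset) (use b in auto)
  then have s: "G t * G 0 > 0" if "0 < t" "t < b" for t
    using continuous_nonzero_same_sign[of 0 b G t 0] nz that g b by auto
  show ?thesis
  proof (cases "G 0 > 0")
    case True
    then have p: "G t > 0" "K t \<le> 0" if "0 < t" "t < b" for t
      using s[OF that] K[OF that] by (auto simp: zero_less_mult_iff mult_le_0_iff)
    have "G 0 < G b"
      by (rule edge_grow_aux[OF e b p(2) p(1)]) (use g True in \<open>auto simp: zero_le_mult_iff\<close>)
    then show ?thesis using True by auto
  next
    case False
    then have n: "G 0 < 0" using g by auto
    then have p: "- G t > 0" "- K t \<le> 0" if "0 < t" "t < b" for t
      using s[OF that] K[OF that] by (auto simp: zero_less_mult_iff mult_le_0_iff)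
    have "- G 0 < - G b"
      by (rule edge_grow_aux[OF edge_eq_minus[OF e] b p(2) p(1)]) (use g n in \<open>auto simp: zero_le_mult_iff\<close>)
    then show ?thesis using n by auto
  qed
qed

text \<open>The equation at 0 gives \<open>G'' = - K 0 < 0\<close>, so \<open>G1\<close> drops below
  its nonpositive initial value at once. This settles the borderline case \<open>G1 0 = 0\<close>,
  in which the first derivative decides nothing.\<close>

lemma edge_start_neg:
  assumes e: "edge_eq l q G G1 K" and "G 0 = 0" "K 0 > 0" "G1 0 \<le> 0"
  shows "\<exists>\<epsilon>>0. \<forall>t. 0 < t \<and> t < \<epsilon> \<longrightarrow> G t < 0"
proof -
  have l: "0 < l" using edge_eqD(1)[OF e] .
  have "(G1 has_real_derivative q 0 * G 0 - K 0) (at 0 within {0..l})" using e l by (auto simp: edge_eq_def)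
  then obtain d where d: "d > 0" "\<And>h. h > 0 \<Longrightarrow> 0 + h \<in> {0..l} \<Longrightarrow> h < d \<Longrightarrow> G1 (0 + h) < G1 0"
    using has_real_derivative_neg_dec_right[of G1 "q 0 * G 0 - K 0" 0 "{0..l}"] assms by auto
  have "G t < 0" if t: "0 < t" "t < min d l" for t
  proof -
    have "continuous_on {0..t} G" using edge_eqD(3)[OF e] by (rule continuous_on_subset) (use t in auto)
    then obtain z where z: "0 < z" "z < t" "G t - G 0 = (t - 0) * G1 z"
      using MVT_interior[of 0 t G G1] edge_eqD(6)[OF e] t by auto
    have "G1 z < 0" using d(2)[of z] z t assms by auto
    then have "(t - 0) * G1 z < 0" using t by (simp add: mult_pos_neg)
    then show ?thesis using z(3) assms by linarith
  qed
  then show ?thesis using d l by (intro exI[of _ "min d l"]) auto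
qed

text \<open>A sample before the first zero of \<open>G\<close> is worth 1. If \<open>K 0\<close> is
  opposite in sign to \<open>G p\<close>, then \<open>K\<close> also changes sign before
  \<open>p\<close>, which is worth a second point; every situation in which
  \<open>half_score\<close> demands 2 is shown to force this opposition.\<close>

lemma half_score_sampled:
  assumes e: "edge_eq l q G G1 K" and p: "0 < p" "p < l" "G p * K p > 0"
    and nz: "\<And>t. 0 < t \<Longrightarrow> t \<le> p \<Longrightarrow> G t \<noteq> 0"
  shows "half_score (G 0) (K 0) (G1 0) (if K 0 * G p < 0 then 2 else 1)"
proof -
  have c: "continuous_on {0..p} G" using edge_eqD(3)[OF e] by (rule continuous_on_subset) (use p in auto)
  have s: "G t * G p > 0" if "0 < t" "t < p" for t
    using continuous_nonzero_same_sign[of 0 p G t p] c nz that p by auto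
  have s0: "G 0 * G p > 0" if "G 0 \<noteq> 0"
  proof -
    have "G (p/2) * G 0 > 0"
      using continuous_nonzero_same_sign[of 0 p G "p/2" 0] c nz that p by auto
    then show ?thesis using s[of "p/2"] p by (auto simp: zero_less_mult_iff)
  qed
  \<comment> \<open>By \<open>edge_start_neg\<close>, \<open>G\<close> leaves 0 with the sign
    opposite to \<open>K 0\<close> and keeps this sign up to \<open>p\<close>.\<close>
  have k: "K 0 * G p < 0" if "G 0 = 0" "K 0 \<noteq> 0" "G1 0 * K 0 \<le> 0"
  proof (cases "K 0 > 0")
    case True
    then have "G1 0 \<le> 0" using that by (simp add: mult_le_0_iff)
    then have "\<exists>\<epsilon>>0. \<forall>t. 0 < t \<and> t < \<epsilon> \<longrightarrow> G t < 0"
      using edge_start_neg[OF e that(1) True] by blast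
    then obtain \<epsilon> where \<epsilon>: "\<epsilon> > 0" "\<And>t. 0 < t \<Longrightarrow> t < \<epsilon> \<Longrightarrow> G t < 0" by blast
    have "G (min \<epsilon> p / 2) < 0" using \<epsilon> p by (auto simp: min_def)
    moreover have "G (min \<epsilon> p / 2) * G p > 0" using s[of "min \<epsilon> p / 2"] p \<epsilon>(1) by (auto simp: min_def)
    ultimately have "G p < 0" by (auto simp: zero_less_mult_iff)
    then show ?thesis using True by (simp add: mult_pos_neg)
  next
    case False
    then have n: "K 0 < 0" using that by simp
    then have "- G1 0 \<le> 0" using that by (simp add: mult_le_0_iff)
    then have "\<exists>\<epsilon>>0. \<forall>t. 0 < t \<and> t < \<epsilon> \<longrightarrow> - G t < 0"
      using edge_start_neg[OF edge_eq_minus[OF e]] that n by simp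
    then obtain \<epsilon> where \<epsilon>: "\<epsilon> > 0" "\<And>t. 0 < t \<Longrightarrow> t < \<epsilon> \<Longrightarrow> - G t < 0" by blast
    have "G (min \<epsilon> p / 2) > 0" using \<epsilon>(2)[of "min \<epsilon> p / 2"] \<epsilon>(1) p by (auto simp: min_def)
    moreover have "G (min \<epsilon> p / 2) * G p > 0" using s[of "min \<epsilon> p / 2"] p \<epsilon>(1) by (auto simp: min_def)
    ultimately have "G p > 0" by (auto simp: zero_less_mult_iff)
    then show ?thesis using n by (simp add: mult_neg_pos)
  qed
  have k2: "K 0 * G p < 0" if "G 0 \<noteq> 0" "G 0 * K 0 < 0"
    using s0[OF that(1)] that(2) by (auto simp: zero_less_mult_iff mult_less_0_iff)
  show ?thesis unfolding half_score_def using k k2 by auto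
qed

lemma near_zero_sample:
  assumes e: "edge_eq l q G G1 K" and b: "0 < b" "b \<le> l" and gk: "G 0 * K 0 > 0"
  shows "\<exists>p. 0 < p \<and> p < b \<and> G p * K p > 0"
proof -
  have "continuous_on {0..b} (\<lambda>t. G t * K t)"
    by (rule continuous_on_subset[of "{0..l}"]) (use edge_eqD[OF e] b in \<open>auto intro!: continuous_intros\<close>)
  then have "((\<lambda>t. G t * K t) \<longlongrightarrow> G 0 * K 0) (at 0 within {0..b})"
    using b by (auto simp: continuous_on_def)
  then have "eventually (\<lambda>t. G t * K t > 0) (at 0 within {0..b})" using gk order_tendstoD(1) by blast
  then obtain d where d: "d > 0" "\<And>t. t \<in> {0..b} \<Longrightarrow> t \<noteq> 0 \<Longrightarrow> dist t 0 < d \<Longrightarrow> G t * K t > 0"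
    unfolding eventually_at by auto
  show ?thesis using d(2)[of "min d b / 2"] d(1) b
    by (intro exI[of _ "min d b / 2"]) (auto simp: min_def dist_real_def)
qed

text \<open>If \<open>G\<close> is zero on an interval, so are \<open>G1\<close> and
  \<open>G''\<close>, and with them \<open>K = q * G - G''\<close>. When \<open>K\<close> has
  finitely many zeros, \<open>G\<close> therefore cannot vanish identically between two of its
  zeros.\<close>

lemma source_infinite_if_zero:
  assumes e: "edge_eq l q G G1 K" and ab: "0 \<le> a" "a < b" "b \<le> l"
    and z: "\<And>t. a < t \<Longrightarrow> t < b \<Longrightarrow> G t = 0" and t: "a < t" "t < b"
  shows "K t = 0"
proof -
  have ev: "eventually (\<lambda>x. x \<in> {a<..<b}) (nhds s)" if "s \<in> {a<..<b}" for s :: real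
    using that by (intro eventually_nhds_in_open) auto
  have 1: "G1 s = 0" if "s \<in> {a<..<b}" for s
  proof -
    have "((\<lambda>_. 0::real) has_real_derivative G1 s) (at s)"
    proof (subst DERIV_cong_ev[OF refl _ refl, of _ G])
      show "\<forall>\<^sub>F x in nhds s. 0 = G x" using ev[OF that] by eventually_elim (use z in auto)
      show "(G has_real_derivative G1 s) (at s)" using edge_eqD(6)[OF e, of s] that ab by auto
    qed
    then show ?thesis using DERIV_const DERIV_unique by blast
  qed
  have tt: "t \<in> {a<..<b}" using t by auto
  have "((\<lambda>_. 0::real) has_real_derivative q t * G t - K t) (at t)"
  proof (subst DERIV_cong_ev[OF refl _ refl, of _ G1])
    show "\<forall>\<^sub>F x in nhds t. 0 = G1 x" using ev[OF tt] by eventually_elim (use 1 in auto)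
    show "(G1 has_real_derivative q t * G t - K t) (at t)" using edge_eqD(7)[OF e, of t] t ab by auto
  qed
  then have "q t * G t - K t = 0" using DERIV_const DERIV_unique by blast
  then show ?thesis using z t by auto
qed

lemma sample_between_zeros:
  assumes e: "edge_eq l q G G1 K" and fK: "finite {t. 0 < t \<and> t < l \<and> K t = 0}"
    and ab: "0 \<le> a" "a < b" "b \<le> l" and z: "G a = 0" "G b = 0"
  shows "\<exists>p. a < p \<and> p < b \<and> G p * K p > 0"
proof -
  have "\<exists>t. a < t \<and> t < b \<and> G t \<noteq> 0"
  proof (rule ccontr)
    assume "\<not> ?thesis"
    then have "{a<..<b} \<subseteq> {t. 0 < t \<and> t < l \<and> K t = 0}"
      using source_infinite_if_zero[OF e ab] ab by auto
    then show False using fK ab finite_subset infinite_Ioo by blast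
  qed
  then show ?thesis using sample_between[OF e ab z] by auto
qed

lemma card_sample_set_le:
  assumes e: "edge_eq l q G G1 K" and fK: "finite {t. 0 < t \<and> t < l \<and> K t = 0}"
    and A: "finite A" "A \<subseteq> {0..l}"
    and sep: "\<And>x y. x \<in> A \<Longrightarrow> y \<in> A \<Longrightarrow> x < y \<Longrightarrow> \<exists>w. x < w \<and> w < y \<and> K w = 0"
  shows "card A \<le> card {t. 0 < t \<and> t < l \<and> K t = 0} + 1"
proof (rule card_le_Suc_between[OF A(1) fK])
  fix x y assume "x \<in> A" "y \<in> A" "x < y"
  moreover from this obtain w where "x < w" "w < y" "K w = 0" using sep by blast
  ultimately show "\<exists>z\<in>{t. 0 < t \<and> t < l \<and> K t = 0}. x < z \<and> z < y"
    using subsetD[OF A(2), of x] subsetD[OF A(2), of y] by (intro bexI[of _ w]) auto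
qed

text \<open>With \<open>N\<close> zeros of \<open>K\<close>, a set of \<open>N + 3\<close> zeros of
  \<open>G\<close> would give \<open>N + 2\<close> samples separated by zeros of \<open>G\<close>,
  hence at least \<open>N + 1\<close> zeros of \<open>K\<close>.\<close>

lemma finite_zeros_of_source:
  assumes e: "edge_eq l q G G1 K" and fK: "finite {t. 0 < t \<and> t < l \<and> K t = 0}"
  shows "finite {t. 0 < t \<and> t < l \<and> G t = 0}"
proof (rule ccontr)
  assume inf: "infinite {t. 0 < t \<and> t < l \<and> G t = 0}"
  define N where "N = card {t. 0 < t \<and> t < l \<and> K t = 0}"
  obtain A where A: "finite A" "card A = N + 3" "A \<subseteq> {t. 0 < t \<and> t < l \<and> G t = 0}"
    using infinite_arbitrarily_large[OF inf] by blast
  have "A \<noteq> {}" using A by auto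
  then obtain B where B: "finite B" "card B + 1 = card A" "\<And>p. p \<in> B \<Longrightarrow> G p * K p > 0 \<and> Min A < p \<and> p < Max A"
      "\<And>x y. x\<in>B \<Longrightarrow> y\<in>B \<Longrightarrow> x < y \<Longrightarrow> (\<exists>z\<in>A. x < z \<and> z < y)"
  proof -
    have "\<exists>p. x < p \<and> p < y \<and> G p * K p > 0" if "x \<in> A" "y \<in> A" "x < y" for x y
      using sample_between_zeros[OF e fK, of x y] that subsetD[OF A(3), of x] subsetD[OF A(3), of y] by auto
    then show thesis using that exists_separated_between[of A "\<lambda>p. G p * K p > 0"] A(1) \<open>A \<noteq> {}\<close> by metis
  qed
  have Bs: "0 < p \<and> p < l" if "p \<in> B" for p
    using B(3)[OF that] A(3) Min_in[OF A(1) \<open>A \<noteq> {}\<close>] Max_in[OF A(1) \<open>A \<noteq> {}\<close>] by auto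
  have "card B \<le> N + 1" unfolding N_def
  proof (rule card_sample_set_le[OF e fK B(1)])
    show "B \<subseteq> {0..l}" using Bs by force
    fix x y assume xy: "x \<in> B" "y \<in> B" "x < y"
    then obtain z where "z \<in> A" "x < z" "z < y" using B(4) by blast
    then show "\<exists>w. x < w \<and> w < y \<and> K w = 0"
      using source_zero_between[OF e, of x y z] Bs[OF xy(1)] Bs[OF xy(2)] B(3)[OF xy(1)] B(3)[OF xy(2)] xy subsetD[OF A(3)] by auto
  qed
  then show False using A B by auto
qed

lemma source_zero_before_sample:
  assumes e: "edge_eq l q G G1 K" and p: "0 < p" "p < l" "G p * K p > 0" and n: "K 0 * G p < 0"
  shows "\<exists>w. 0 < w \<and> w < p \<and> K w = 0"
proof -
  have c: "continuous_on {0..p} K" using edge_eqD(2)[OF e] by (rule continuous_on_subset) (use p in auto)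
  have "K 0 * K p < 0" using p n by (auto simp: zero_less_mult_iff mult_less_0_iff)
  show ?thesis
  proof (rule ccontr)
    assume "\<not> ?thesis"
    moreover have "K 0 \<noteq> 0" "K p \<noteq> 0" using p n by auto
    ultimately have "K (p/2) * K 0 > 0" "K (p/2) * K p > 0"
      using continuous_nonzero_same_sign[of 0 p K "p/2" 0] continuous_nonzero_same_sign[of 0 p K "p/2" p] c p n by auto
    then show False using \<open>K 0 * K p < 0\<close> by (auto simp: zero_less_mult_iff mult_less_0_iff)
  qed
qed

text \<open>The score is realised by actual points before the first zero \<open>z\<close>: none, one
  sample \<open>p\<close>, or \<open>{0, p}\<close> if \<open>K\<close> changes sign before
  \<open>p\<close>. The last clause puts a sample at or to the right of each of them, so that
  \<open>source_zero_between\<close> can still be applied across \<open>z\<close>.\<close>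

lemma half_score_with_zero:
  assumes e: "edge_eq l q G G1 K" and fK: "finite {t. 0 < t \<and> t < l \<and> K t = 0}"
    and z: "0 < z" "z < l" "G z = 0" "\<And>t. 0 < t \<Longrightarrow> t < z \<Longrightarrow> G t \<noteq> 0"
  shows "\<exists>L. half_score (G 0) (K 0) (G1 0) (int (card L)) \<and> finite L \<and> L \<subseteq> {0..<z} \<and>
     (\<forall>x\<in>L. \<forall>y\<in>L. x < y \<longrightarrow> (\<exists>w. x < w \<and> w < y \<and> K w = 0)) \<and>
     (\<forall>x\<in>L. \<exists>p\<in>L. x \<le> p \<and> G p * K p > 0)"
proof (cases "\<exists>p. 0 < p \<and> p < z \<and> G p * K p > 0")
  case True
  then obtain p where p: "0 < p" "p < z" "G p * K p > 0" by auto
  have hs: "half_score (G 0) (K 0) (G1 0) (if K 0 * G p < 0 then 2 else 1)"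
    by (rule half_score_sampled[OF e]) (use p z in auto)
  show ?thesis
  proof (cases "K 0 * G p < 0")
    case True
    then obtain w where "0 < w" "w < p" "K w = 0" using source_zero_before_sample[OF e] p z by force
    then show ?thesis using hs p True by (intro exI[of _ "{0,p}"]) auto
  next
    case False
    then show ?thesis using hs p by (intro exI[of _ "{p}"]) auto
  qed
next
  case False
  \<comment> \<open>Nothing is owed without samples: \<open>G 0 = 0\<close> or
    \<open>G 0 * K 0 > 0\<close> would create one, and growth of \<open>|G|\<close> is impossible
    because \<open>G z = 0\<close>.\<close>
  have "half_score (G 0) (K 0) (G1 0) 0"
    unfolding half_score_def
  proof (intro conjI impI; (elim conjE)?)
    assume "G 0 = 0 \<or> G 0 * K 0 > 0"
    then show "(1::int) \<le> 0"
      using False sample_between_zeros[OF e fK, of 0 z] near_zero_sample[OF e, of z] z by auto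
  next
    assume "G 0 \<noteq> 0" "0 \<le> G 0 * G1 0"
    then have "\<bar>G 0\<bar> < \<bar>G z\<bar>" using edge_grow[OF e, of z] False z by force
    then have False using z by simp
    then show "(2::int) \<le> 0" "(1::int) \<le> 0" by auto
  next
    assume "G 0 = 0" then show "(2::int) \<le> 0"
      using False sample_between_zeros[OF e fK, of 0 z] z by auto
  qed simp
  then show ?thesis by (intro exI[of _ "{}"]) auto
qed

text \<open>With neither zero nor sample on the edge, its two points are shared out by comparing
  \<open>|G|\<close> at the two ends: by \<open>edge_grow\<close>, a half-edge along which
  \<open>|G|\<close> grows starts at the strictly smaller end. The scores of the two halves always
  add up to 2.\<close>

lemma half_score_unsampled:
  assumes e: "edge_eq l q G G1 K" and fK: "finite {t. 0 < t \<and> t < l \<and> K t = 0}"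
    and z: "\<And>t. 0 < t \<Longrightarrow> t < l \<Longrightarrow> G t \<noteq> 0" and u: "\<And>t. 0 < t \<Longrightarrow> t < l \<Longrightarrow> G t * K t \<le> 0"
  shows "half_score (G 0) (K 0) (G1 0) (if \<bar>G 0\<bar> < \<bar>G l\<bar> then 2 else if \<bar>G 0\<bar> = \<bar>G l\<bar> then 1 else 0)"
proof -
  have l: "0 < l" using edge_eqD(1)[OF e] .
  have 1: "\<bar>G 0\<bar> < \<bar>G l\<bar>" if "G 0 = 0"
    using sample_between_zeros[OF e fK, of 0 l] l u that by force
  have 2: "\<not> G 0 * K 0 > 0" using near_zero_sample[OF e, of l] l u by force
  have 3: "\<bar>G 0\<bar> < \<bar>G l\<bar>" if "G 0 \<noteq> 0" "0 \<le> G 0 * G1 0"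
    using edge_grow[OF e, of l] l z u that by auto
  show ?thesis unfolding half_score_def using 1 2 3 by auto
qed

text \<open>The points realising the left score, the \<open>n - 1\<close> samples between the zeros
  of \<open>G\<close> and the points realising the right score form one set whose members are
  separated by zeros of \<open>K\<close>. Their number exceeds that of the zeros of \<open>K\<close>
  by at most 1, and together with \<open>n - 1\<close> this gives the 2 that is lost.\<close>

lemma edge_scores:
  assumes e: "edge_eq l q G G1 K" and fK: "finite {t. 0 < t \<and> t < l \<and> K t = 0}"
  shows "\<exists>hl hr. half_score (G 0) (K 0) (G1 0) hl \<and> half_score (G l) (K l) (- G1 l) hr \<and>
     int (card {t. 0 < t \<and> t < l \<and> G t = 0}) - 2 + hl + hr \<le> int (card {t. 0 < t \<and> t < l \<and> K t = 0})"
proof -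
  define Z where "Z = {t. 0 < t \<and> t < l \<and> G t = 0}"
  define ZK where "ZK = {t. 0 < t \<and> t < l \<and> K t = 0}"
  have fZ: "finite Z" unfolding Z_def by (rule finite_zeros_of_source[OF e fK])
  have l: "0 < l" using edge_eqD(1)[OF e] .
  note r = edge_eq_reflect[OF e]
  have ref: "{t. 0 < t \<and> t < l \<and> K (l - t) = 0} = (\<lambda>t. l - t) ` ZK"
  proof (intro set_eqI iffI)
    fix x assume "x \<in> {t. 0 < t \<and> t < l \<and> K (l - t) = 0}"
    then show "x \<in> (\<lambda>t. l - t) ` ZK" unfolding ZK_def by (intro image_eqI[of _ _ "l - x"]) auto
  qed (auto simp: ZK_def)
  have fKr: "finite {t. 0 < t \<and> t < l \<and> K (l - t) = 0}"
    unfolding ref using fK ZK_def by auto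
  have csl: "card A \<le> card ZK + 1" if "finite A" "A \<subseteq> {0..l}"
    "\<And>x y. x \<in> A \<Longrightarrow> y \<in> A \<Longrightarrow> x < y \<Longrightarrow> \<exists>w. x < w \<and> w < y \<and> K w = 0" for A
    using card_sample_set_le[OF e fK that] unfolding ZK_def by blast
  show ?thesis
  proof (cases "Z = {}")
    case False
    define z1 where "z1 = Min Z"
    define z2 where "z2 = Max Z"
    have z1: "0 < z1" "z1 < l" "G z1 = 0" "\<And>t. 0 < t \<Longrightarrow> t < z1 \<Longrightarrow> G t \<noteq> 0"
    proof -
      have "z1 \<in> Z" using fZ False z1_def by auto
      then show a: "0 < z1" "z1 < l" "G z1 = 0" unfolding Z_def by auto
      fix t assume "0 < t" "t < z1"
      then show "G t \<noteq> 0" using Min_le[OF fZ, of t] a unfolding z1_def by (auto simp: Z_def)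
    qed
    have z2: "0 < z2" "z2 < l" "G z2 = 0" "\<And>t. z2 < t \<Longrightarrow> t < l \<Longrightarrow> G t \<noteq> 0"
    proof -
      have "z2 \<in> Z" using fZ False z2_def by auto
      then show a: "0 < z2" "z2 < l" "G z2 = 0" unfolding Z_def by auto
      fix t assume "z2 < t" "t < l"
      then show "G t \<noteq> 0" using Max_ge[OF fZ, of t] a unfolding z2_def by (auto simp: Z_def)
    qed
    have z12: "z1 \<le> z2" unfolding z1_def z2_def using fZ False by auto
    obtain L where L: "half_score (G 0) (K 0) (G1 0) (int (card L))" "finite L" "L \<subseteq> {0..<z1}"
     "\<And>x y. x\<in>L \<Longrightarrow> y\<in>L \<Longrightarrow> x < y \<Longrightarrow> (\<exists>w. x < w \<and> w < y \<and> K w = 0)"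
     "\<And>x. x\<in>L \<Longrightarrow> \<exists>p\<in>L. x \<le> p \<and> G p * K p > 0"
      using half_score_with_zero[OF e fK z1] by blast
    have "\<exists>L. half_score (G (l - 0)) (K (l - 0)) (- G1 (l - 0)) (int (card L)) \<and> finite L \<and> L \<subseteq> {0..<l - z2} \<and>
     (\<forall>x\<in>L. \<forall>y\<in>L. x < y \<longrightarrow> (\<exists>w. x < w \<and> w < y \<and> K (l - w) = 0)) \<and>
     (\<forall>x\<in>L. \<exists>p\<in>L. x \<le> p \<and> G (l - p) * K (l - p) > 0)"
      by (rule half_score_with_zero[OF r fKr, of "l - z2"]) (use z2 in auto)
    then obtain R' where R': "half_score (G l) (K l) (- G1 l) (int (card R'))" "finite R'" "R' \<subseteq> {0..<l - z2}"
     "\<And>x y. x\<in>R' \<Longrightarrow> y\<in>R' \<Longrightarrow> x < y \<Longrightarrow> (\<exists>w. x < w \<and> w < y \<and> K (l - w) = 0)"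
     "\<And>x. x\<in>R' \<Longrightarrow> \<exists>p\<in>R'. x \<le> p \<and> G (l - p) * K (l - p) > 0" by auto
    define R where "R = (\<lambda>t. l - t) ` R'"
    have cR: "card R = card R'" unfolding R_def by (rule card_image) (auto simp: inj_on_def)
    have R: "finite R" "R \<subseteq> {z2<..l}"
     "\<And>x. x\<in>R \<Longrightarrow> \<exists>p\<in>R. p \<le> x \<and> G p * K p > 0"
    proof -
      show "finite R" unfolding R_def using R'(2) by simp
      show "R \<subseteq> {z2<..l}" unfolding R_def using R'(3) by force
      fix x assume "x \<in> R"
      then obtain x' where x': "x' \<in> R'" "x = l - x'" unfolding R_def by auto
      then obtain p' where "p' \<in> R'" "x' \<le> p'" "G (l - p') * K (l - p') > 0" using R'(5) by blast
      then show "\<exists>p\<in>R. p \<le> x \<and> G p * K p > 0" unfolding R_def using x' by auto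
    qed
    have R4: "\<exists>w. x < w \<and> w < y \<and> K w = 0" if xy: "x \<in> R" "y \<in> R" "x < y" for x y
    proof -
      have "\<exists>w. l - y < w \<and> w < l - x \<and> K (l - w) = 0"
        by (rule R'(4)) (use xy R_def in auto)
      then obtain w where "l - y < w" "w < l - x" "K (l - w) = 0" by blast
      then show ?thesis by (intro exI[of _ "l - w"]) auto
    qed
    obtain B where B: "finite B" "card B + 1 = card Z" "\<And>p. p \<in> B \<Longrightarrow> G p * K p > 0 \<and> z1 < p \<and> p < z2"
      "\<And>x y. x\<in>B \<Longrightarrow> y\<in>B \<Longrightarrow> x < y \<Longrightarrow> (\<exists>z\<in>Z. x < z \<and> z < y)"
    proof -
      have "\<exists>p. x < p \<and> p < y \<and> G p * K p > 0" if "x \<in> Z" "y \<in> Z" "x < y" for x y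
        using sample_between_zeros[OF e fK, of x y] that unfolding Z_def by auto
      then show thesis using that exists_separated_between[of Z "\<lambda>p. G p * K p > 0"] fZ False
        unfolding z1_def z2_def by metis
    qed
    define A where "A = L \<union> B \<union> R"
    have fA: "finite A" unfolding A_def using L B R by auto
    have Lb: "0 \<le> x" "x < z1" if "x \<in> L" for x using L(3) that by auto
    have Bb: "z1 < x" "x < z2" if "x \<in> B" for x using B(3) that by auto
    have Rb: "z2 < x" "x \<le> l" if "x \<in> R" for x using R(2) that by auto
    have d: "L \<inter> B = {}" "(L \<union> B) \<inter> R = {}" using Lb Bb Rb z12 by (auto, fastforce+)
    have cA: "card A = card L + card B + card R" unfolding A_def
      using L(2) B(1) R(1) d by (simp add: card_Un_disjoint)
    have sub: "A \<subseteq> {0..l}"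
    proof
      fix x assume "x \<in> A"
      then show "x \<in> {0..l}" using Lb[of x] Bb[of x] Rb[of x] z1(1,2) z2(1,2) unfolding A_def by auto
    qed
    have szb: "\<exists>w. x < w \<and> w < y \<and> K w = 0"
      if "p \<in> A" "p' \<in> A" "x \<le> p" "p < z" "z < p'" "p' \<le> y" "G p * K p > 0" "G p' * K p' > 0" "G z = 0" for x y p p' z
    proof -
      have "0 \<le> p" "p' \<le> l" using that(1,2) sub by auto
      then have "\<exists>w. p < w \<and> w < p' \<and> K w = 0"
        by (intro source_zero_between[OF e, of p p' z]) (use that in auto)
      then show ?thesis using that by force
    qed
    have "card A \<le> card ZK + 1"
    proof (rule csl[OF fA sub])
      fix x y assume xy: "x \<in> A" "y \<in> A" "x < y"
      \<comment> \<open>The blocks \<open>L\<close>, \<open>B\<close>, \<open>R\<close> lie in this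
        order along the edge, with \<open>z1\<close> and \<open>z2\<close> in between. A mixed pair
        is separated by moving to samples on either side of such a zero of \<open>G\<close>.\<close>
      consider "x \<in> L" "y \<in> L" | "x \<in> L" "y \<in> B" | "x \<in> L" "y \<in> R" | "x \<in> B" "y \<in> B" | "x \<in> B" "y \<in> R" | "x \<in> R" "y \<in> R"
      proof -
        have "\<not> (x \<in> B \<and> y \<in> L)" "\<not> (x \<in> R \<and> y \<in> L)" "\<not> (x \<in> R \<and> y \<in> B)"
          using xy(3) Lb[of y] Bb[of x] Bb[of y] Rb[of x] z12 by auto
        then show thesis using that xy A_def by blast
      qed
      then show "\<exists>w. x < w \<and> w < y \<and> K w = 0"
      proof cases
        case 1 then show ?thesis using L(4) xy by auto
      next
        case 2
        then obtain p where p: "p \<in> L" "x \<le> p" "G p * K p > 0" using L(5) by blast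
        show ?thesis by (rule szb[of p y x z1 y]) (use p 2 Lb[OF p(1)] Bb[of y] B(3)[of y] xy z1(3) A_def in auto)
      next
        case 3
        then obtain p where p: "p \<in> L" "x \<le> p" "G p * K p > 0" using L(5) by blast
        obtain p' where p': "p' \<in> R" "p' \<le> y" "G p' * K p' > 0" using R(3) 3 by blast
        have "z1 < p'" using R(2) p' z12 by auto
        then show ?thesis by (intro szb[of p p' x z1 y]) (use p p' Lb[OF p(1)] xy z1(3) A_def in auto)
      next
        case 4
        then obtain z where "z \<in> Z" "x < z" "z < y" using B(4) xy by blast
        then show ?thesis by (intro szb[of x y x z y]) (use 4 B(3)[of x] B(3)[of y] xy Z_def in auto)
      next
        case 5
        obtain p' where p': "p' \<in> R" "p' \<le> y" "G p' * K p' > 0" using R(3) 5 by blast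
        then have "z2 < p'" using R(2) by auto
        then show ?thesis by (intro szb[of x p' x z2 y]) (use p' 5 B(3)[of x] xy z2(3) A_def in auto)
      next
        case 6 then show ?thesis using R4 xy by auto
      qed
    qed
    then have "int (card Z) - 2 + int (card L) + int (card R') \<le> int (card ZK)" using cA B(2) cR by linarith
    then show ?thesis using L(1) R'(1) unfolding Z_def ZK_def by blast
  next
    case True
    then have nz: "\<And>t. 0 < t \<Longrightarrow> t < l \<Longrightarrow> G t \<noteq> 0" unfolding Z_def by auto
    show ?thesis
    proof (cases "\<exists>p. 0 < p \<and> p < l \<and> G p * K p > 0")
      case True
      then obtain p where p: "0 < p" "p < l" "G p * K p > 0" by auto
      define hl :: int where "hl = (if K 0 * G p < 0 then 2 else 1)"
      define hr :: int where "hr = (if K l * G p < 0 then 2 else 1)"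
      have 1: "half_score (G 0) (K 0) (G1 0) hl"
        unfolding hl_def by (rule half_score_sampled[OF e]) (use p nz in auto)
      have "half_score (G (l - 0)) (K (l - 0)) (- G1 (l - 0)) (if K (l - 0) * G (l - (l - p)) < 0 then 2 else 1)"
        by (rule half_score_sampled[OF r]) (use p nz in auto)
      then have 2: "half_score (G l) (K l) (- G1 l) hr" unfolding hr_def by simp
      \<comment> \<open>The endpoints are markers and not samples: each is separated from
        \<open>p\<close> by the sign change of \<open>K\<close> that earns the second point.\<close>
      define A where "A = (if K 0 * G p < 0 then {0} else {}) \<union> {p} \<union> (if K l * G p < 0 then {l} else {})"
      have cA: "int (card A) = hl + hr - 1" unfolding A_def hl_def hr_def using p by auto
      have w1: "\<exists>w. 0 < w \<and> w < p \<and> K w = 0" if "K 0 * G p < 0"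
        using source_zero_before_sample[OF e p that] .
      have w2: "\<exists>w. p < w \<and> w < l \<and> K w = 0" if kl: "K l * G p < 0"
      proof -
        have "\<exists>w. 0 < w \<and> w < l - p \<and> K (l - w) = 0"
          by (rule source_zero_before_sample[OF r]) (use p kl in auto)
        then obtain w where "0 < w" "w < l - p" "K (l - w) = 0" by blast
        then show ?thesis by (intro exI[of _ "l - w"]) auto
      qed
      have "card A \<le> card ZK + 1"
      proof (rule csl)
        show "finite A" unfolding A_def by auto
        show "A \<subseteq> {0..l}" unfolding A_def using p by auto
        fix x y assume "x \<in> A" "y \<in> A" "x < y"
        then consider "x = 0" "K 0 * G p < 0" "p \<le> y" | "x = p" "y = l" "K l * G p < 0"
          unfolding A_def using p by (fastforce split: if_splits)
        then show "\<exists>w. x < w \<and> w < y \<and> K w = 0"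
          using w1 w2 by cases force+
      qed
      then have "int (card Z) - 2 + hl + hr \<le> int (card ZK)" using cA \<open>Z = {}\<close> by simp
      then show ?thesis using 1 2 unfolding Z_def ZK_def by blast
    next
      case False
      then have u: "\<And>t. 0 < t \<Longrightarrow> t < l \<Longrightarrow> G t * K t \<le> 0" by force
      define h :: "real \<Rightarrow> real \<Rightarrow> int" where "h x y = (if \<bar>x\<bar> < \<bar>y\<bar> then 2 else if \<bar>x\<bar> = \<bar>y\<bar> then 1 else 0)" for x y
      have 1: "half_score (G 0) (K 0) (G1 0) (h (G 0) (G l))"
        unfolding h_def by (rule half_score_unsampled[OF e fK nz u])
      have "half_score (G (l - 0)) (K (l - 0)) (- G1 (l - 0)) (h (G (l - 0)) (G (l - l)))"
        unfolding h_def by (rule half_score_unsampled[OF r fKr]) (use nz u in auto)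
      then have 2: "half_score (G l) (K l) (- G1 l) (h (G l) (G 0))" by simp
      have "int (card Z) - 2 + h (G 0) (G l) + h (G l) (G 0) \<le> int (card ZK)"
        unfolding h_def \<open>Z = {}\<close> by auto
      then show ?thesis using 1 2 unfolding Z_def ZK_def by blast
    qed
  qed
qed

subsection \<open>Zeros on the graph\<close>

lemma half_score_sum_zero:
  assumes "finite H" "\<And>x. x \<in> H \<Longrightarrow> half_score 0 0 (d x) (h x)"
  shows "int (card H) \<le> (\<Sum>x\<in>H. h x)"
proof -
  have "(\<Sum>x\<in>H. 1) \<le> (\<Sum>x\<in>H. h x)" by (rule sum_mono) (use assms in \<open>auto simp: half_score_def\<close>)
  then show ?thesis by simp
qed

lemma exists_nonneg_of_sum_zero:
  fixes d :: "'a \<Rightarrow> real"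
  assumes "finite H" "H \<noteq> {}" "(\<Sum>x\<in>H. d x) = 0"
  shows "\<exists>x\<in>H. c * d x \<ge> 0"
proof (rule ccontr)
  assume "\<not> ?thesis"
  then have "(\<Sum>x\<in>H. c * d x) < (\<Sum>x\<in>H. 0)" using assms by (intro sum_strict_mono) auto
  then show False using assms by (simp add: sum_distrib_left[symmetric])
qed

text \<open>The outgoing derivatives add up to 0, so for every \<open>c\<close> some half-edge has
  \<open>c * d x \<ge> 0\<close>; \<open>c = g\<close> or \<open>c = - k\<close> produces the
  half-edge with the extra score. The two indicator terms account for the vertex itself being a zero
  of the solution or of the source.\<close>

lemma half_score_sum:
  assumes H: "finite H" "H \<noteq> {}" and h: "\<And>x. x \<in> H \<Longrightarrow> half_score g k (d x) (h x)"
    and d: "(\<Sum>x\<in>H. d x) = 0"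
  shows "int (card H) - (\<Sum>x\<in>H. h x) + (if g = 0 then 1 else 0) - (if k = 0 then 1 else 0)
      \<le> (if k = 0 \<and> g \<noteq> 0 \<or> g * k < 0 then int (card H) - 2 else 0)"
proof -
  have h0: "0 \<le> h x" if "x \<in> H" for x using h[OF that] by (simp add: half_score_def)
  consider "g = 0" "k = 0" | "g = 0" "k \<noteq> 0" | "g * k > 0" | "g \<noteq> 0" "g * k < 0" | "g \<noteq> 0" "k = 0"
    by (metis linorder_less_linear mult_eq_0_iff)
  then show ?thesis
  proof cases
    case 1
    then show ?thesis using half_score_sum_zero[of H d h] H h by auto
  next
    case 2
    obtain x where x: "x \<in> H" "- k * d x \<ge> 0" using exists_nonneg_of_sum_zero[OF H d] by blast
    have "(\<Sum>y\<in>H. 1 + (if y = x then 1 else 0)) \<le> (\<Sum>y\<in>H. h y)"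
    proof (rule sum_mono)
      fix y assume "y \<in> H"
      then show "1 + (if y = x then 1 else 0) \<le> h y" using h[of y] x 2
        by (auto simp: half_score_def mult.commute)
    qed
    then have "int (card H) + 1 \<le> (\<Sum>y\<in>H. h y)" using H x by (simp add: sum.distrib)
    then show ?thesis using 2 by auto
  next
    case 3
    have "(\<Sum>x\<in>H. 1) \<le> (\<Sum>x\<in>H. h x)" by (rule sum_mono) (use h 3 in \<open>auto simp: half_score_def\<close>)
    then show ?thesis using 3 by auto
  next
    case 4
    obtain x where x: "x \<in> H" "g * d x \<ge> 0" using exists_nonneg_of_sum_zero[OF H d] by blast
    have "2 \<le> h x" using h[OF x(1)] x 4 by (auto simp: half_score_def)
    moreover have "h x \<le> (\<Sum>y\<in>H. h y)" using x H h0 by (intro member_le_sum) auto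
    ultimately show ?thesis using 4 by auto
  next
    case 5
    obtain x where x: "x \<in> H" "g * d x \<ge> 0" using exists_nonneg_of_sum_zero[OF H d] by blast
    have "1 \<le> h x" using h[OF x(1)] x 5 by (auto simp: half_score_def)
    moreover have "h x \<le> (\<Sum>y\<in>H. h y)" using x H h0 by (intro member_le_sum) auto
    ultimately show ?thesis using 5 by auto
  qed
qed

section \<open>Sums over half-edges and zero counts on the graph\<close>

locale compact_graph =
  fixes V :: "'v set" and E :: "'e set" and src tgt :: "'e \<Rightarrow> 'v" and l :: "'e \<Rightarrow> real"
  assumes metric_graph: "metric_graph V E src tgt l"
begin

abbreviation "dg \<equiv> deg E src tgt"
abbreviation "Vb \<equiv> boundary_vertices V E src tgt"
abbreviation "Vi \<equiv> inner_vertices V E src tgt"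
abbreviation "hsum v \<phi> \<psi> \<equiv> (\<Sum>e\<in>{e\<in>E. src e = v}. \<phi> e) + (\<Sum>e\<in>{e\<in>E. tgt e = v}. \<psi> e)"

lemma graphD: "finite V" "finite E" "E \<noteq> {}" "\<And>e. e \<in> E \<Longrightarrow> src e \<in> V" "\<And>e. e \<in> E \<Longrightarrow> tgt e \<in> V"
  "\<And>e. e \<in> E \<Longrightarrow> 0 < l e"
  "\<And>u w. u \<in> V \<Longrightarrow> w \<in> V \<Longrightarrow> (\<lambda>x y. \<exists>e\<in>E. (src e = x \<and> tgt e = y) \<or> (src e = y \<and> tgt e = x))\<^sup>*\<^sup>* u w"
  using metric_graph unfolding metric_graph_def by auto

lemma finite_Vi: "finite Vi" and finite_Vb: "finite Vb"
  using graphD(1) by (auto simp: inner_vertices_def boundary_vertices_def)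

text \<open>Every edge contributes its start to one vertex and its end to another, or both to the
  same vertex if it is a loop. This double count turns edgewise boundary terms into vertex sums
  wherever Kirchhoff's condition is used.\<close>

lemma sum_hsum: "(\<Sum>v\<in>V. hsum v \<phi> \<psi>) = (\<Sum>e\<in>E. \<phi> e + \<psi> e)" for \<phi> \<psi> :: "'e \<Rightarrow> 'a::comm_monoid_add"
  using sum.group[OF graphD(2,1), of src \<phi>] sum.group[OF graphD(2,1), of tgt \<psi>] graphD(4,5)
  by (simp add: sum.distrib image_subset_iff)

lemma incident_edge:
  assumes v: "v \<in> V"
  shows "\<exists>e\<in>E. src e = v \<or> tgt e = v"
proof -
  obtain e0 where e0: "e0 \<in> E" using graphD(3) by auto
  have "(\<lambda>x y. \<exists>e\<in>E. (src e = x \<and> tgt e = y) \<or> (src e = y \<and> tgt e = x))\<^sup>*\<^sup>* v (src e0)"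
    using graphD(7)[OF v graphD(4)[OF e0]] .
  then show ?thesis
    by (cases rule: converse_rtranclpE) (use e0 in auto)
qed

lemma deg_eq_hsum: "dg v = hsum v (\<lambda>_. 1) (\<lambda>_. 1)"
  by (simp add: deg_def)

lemma deg_pos: assumes "v \<in> V" shows "dg v \<ge> 1"
proof -
  obtain e where e: "e \<in> E" "src e = v \<or> tgt e = v" using incident_edge[OF assms] by auto
  then have "card {e\<in>E. src e = v} > 0 \<or> card {e\<in>E. tgt e = v} > 0"
    using graphD(2) by (auto simp: card_gt_0_iff)
  then show ?thesis unfolding deg_def by linarith
qed

lemma V_split: "V = Vb \<union> Vi" "Vb \<inter> Vi = {}"
  using deg_pos by (force simp: boundary_vertices_def inner_vertices_def)+

lemma handshake: "(\<Sum>v\<in>V. dg v) = 2 * card E"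
  using sum_hsum[of "\<lambda>_. 1::nat" "\<lambda>_. 1"] by (simp add: deg_eq_hsum)

text \<open>The degrees add up to 2 |E|. Removing 1 for each boundary vertex and 2 for each inner
  vertex leaves 2 |E| - 2 |V| + |V_b|, the constant of the theorem.\<close>

lemma sum_deg_excess: "(\<Sum>v\<in>Vi. int (dg v) - 2) = int (card Vb) + 2 * betti V E - 2"
proof -
  have "(\<Sum>v\<in>V. int (dg v)) = (\<Sum>v\<in>Vb. int (dg v)) + (\<Sum>v\<in>Vi. int (dg v))"
    by (subst V_split(1), rule sum.union_disjoint) (use V_split finite_Vi finite_Vb in auto)
  moreover have "(\<Sum>v\<in>Vb. int (dg v)) = int (card Vb)" by (simp add: boundary_vertices_def)
  moreover have "(\<Sum>v\<in>V. int (dg v)) = 2 * int (card E)" using handshake by (metis of_nat_mult of_nat_numeral of_nat_sum)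
  moreover have "int (card V) = int (card Vb) + int (card Vi)"
    using V_split finite_Vi finite_Vb by (metis card_Un_disjoint of_nat_add)
  ultimately show ?thesis by (simp add: betti_def sum_subtractf)
qed

definition zeros_on :: "('e \<Rightarrow> real \<Rightarrow> real) \<Rightarrow> 'e \<Rightarrow> real set" where
  "zeros_on F e = {t. 0 < t \<and> t < l e \<and> F e t = 0}"

lemma zero_edge_points_eq: "zero_edge_points E l F = Sigma E (zeros_on F)"
  by (auto simp: zero_edge_points_def zeros_on_def)

lemma finite_zero_edge_points: "finite (zero_edge_points E l F) \<longleftrightarrow> (\<forall>e\<in>E. finite (zeros_on F e))"
proof
  assume f: "finite (zero_edge_points E l F)"
  show "\<forall>e\<in>E. finite (zeros_on F e)"
  proof
    fix e assume "e \<in> E"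
    then have "zeros_on F e \<subseteq> snd ` zero_edge_points E l F" unfolding zero_edge_points_eq by force
    then show "finite (zeros_on F e)" using f finite_surj by blast
  qed
qed (use graphD(2) in \<open>auto simp: zero_edge_points_eq\<close>)

lemma card_zero_edge_points:
  assumes "\<And>e. e \<in> E \<Longrightarrow> finite (zeros_on F e)"
  shows "card (zero_edge_points E l F) = (\<Sum>e\<in>E. card (zeros_on F e))"
  unfolding zero_edge_points_eq using assms graphD(2) by (simp add: card_SigmaI)

text \<open>Continuity is expressed through a value function on the vertices, which also absorbs the
  Dirichlet condition. On \<open>V\<close> it is determined by \<open>G\<close>, since every vertex
  has an incident edge.\<close>

definition vertex_cont :: "('v \<Rightarrow> real) \<Rightarrow> ('e \<Rightarrow> real \<Rightarrow> real) \<Rightarrow> bool" where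
  "vertex_cont g G \<longleftrightarrow> (\<forall>e\<in>E. G e 0 = g (src e) \<and> G e (l e) = g (tgt e)) \<and> (\<forall>v\<in>Vb. g v = 0)"

definition kirchhoff :: "('e \<Rightarrow> real \<Rightarrow> real) \<Rightarrow> bool" where
  "kirchhoff G1 \<longleftrightarrow> (\<forall>v\<in>Vi. hsum v (\<lambda>e. G1 e 0) (\<lambda>e. - G1 e (l e)) = 0)"

lemma zero_vertices_eq:
  assumes "vertex_cont g G"
  shows "zero_vertices V E src tgt l G = {v\<in>Vi. g v = 0}"
proof -
  have "0 \<in> vertex_vals E src tgt l G v \<longleftrightarrow> g v = 0" if "v \<in> Vi" for v
  proof -
    have "v \<in> V" using that by (simp add: inner_vertices_def)
    then obtain e where e: "e \<in> E" "src e = v \<or> tgt e = v" using incident_edge by blast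
    show ?thesis
    proof
      assume "0 \<in> vertex_vals E src tgt l G v"
      then show "g v = 0" using assms unfolding vertex_vals_def vertex_cont_def by auto
    next
      assume "g v = 0"
      then have "src e = v \<longrightarrow> G e 0 = 0" "tgt e = v \<longrightarrow> G e (l e) = 0" using assms e unfolding vertex_cont_def by auto
      then show "0 \<in> vertex_vals E src tgt l G v" using e unfolding vertex_vals_def by auto
    qed
  qed
  then show ?thesis unfolding zero_vertices_def by auto
qed

definition zero_count :: "('v \<Rightarrow> real) \<Rightarrow> ('e \<Rightarrow> real \<Rightarrow> real) \<Rightarrow> int" where
  "zero_count g G = int (card {v\<in>Vi. g v = 0}) + int (card (zero_edge_points E l G))"

text \<open>The edge inequalities are summed and regrouped by vertices, the loss of 2 per edge
  becoming 1 per half-edge. Inner vertices are handled by \<open>half_score_sum\<close>; at a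
  boundary vertex solution and source both vanish, so each score is at least 1 and nothing is
  lost.\<close>

lemma zero_count_source:
  assumes e: "\<And>e. e \<in> E \<Longrightarrow> edge_eq (l e) (q e) (G e) (G1 e) (K e)"
    and g: "vertex_cont g G" "kirchhoff G1" and k: "vertex_cont k K"
    and fK: "finite (zero_edge_points E l K)"
  shows "finite (zero_edge_points E l G)"
    and "zero_count g G \<le> zero_count k K + (\<Sum>v\<in>{v\<in>Vi. k v = 0 \<or> g v * k v < 0}. int (dg v) - 2)"
proof -
  have fKe: "finite {t. 0 < t \<and> t < l e \<and> K e t = 0}" if "e \<in> E" for e
    using fK that unfolding finite_zero_edge_points zeros_on_def by auto
  have fGe: "finite (zeros_on G e)" if "e \<in> E" for e
    using finite_zeros_of_source[OF e[OF that] fKe[OF that]] unfolding zeros_on_def .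
  then show "finite (zero_edge_points E l G)" using finite_zero_edge_points by auto
  have "\<exists>hl hr. half_score (G e 0) (K e 0) (G1 e 0) hl \<and> half_score (G e (l e)) (K e (l e)) (- G1 e (l e)) hr \<and>
     int (card (zeros_on G e)) - 2 + hl + hr \<le> int (card (zeros_on K e))" if "e \<in> E" for e
    using edge_scores[OF e[OF that] fKe[OF that]] unfolding zeros_on_def .
  then obtain hl hr where h: "\<And>e. e \<in> E \<Longrightarrow> half_score (G e 0) (K e 0) (G1 e 0) (hl e)"
    "\<And>e. e \<in> E \<Longrightarrow> half_score (G e (l e)) (K e (l e)) (- G1 e (l e)) (hr e)"
    "\<And>e. e \<in> E \<Longrightarrow> int (card (zeros_on G e)) - 2 + hl e + hr e \<le> int (card (zeros_on K e))" by metis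
  have "(\<Sum>e\<in>E. int (card (zeros_on G e)) - 2 + hl e + hr e) \<le> (\<Sum>e\<in>E. int (card (zeros_on K e)))"
    using h(3) by (rule sum_mono)
  moreover have "(\<Sum>e\<in>E. int (card (zeros_on G e)) - 2 + hl e + hr e)
      = (\<Sum>e\<in>E. int (card (zeros_on G e))) - (\<Sum>e\<in>E. (1 - hl e) + (1 - hr e))"
    unfolding sum_subtractf[symmetric] by (rule sum.cong) auto
  ultimately have 1: "(\<Sum>e\<in>E. int (card (zeros_on G e))) \<le> (\<Sum>e\<in>E. int (card (zeros_on K e))) + (\<Sum>v\<in>V. hsum v (\<lambda>e. 1 - hl e) (\<lambda>e. 1 - hr e))"
    unfolding sum_hsum by simp
  have 2: "hsum v (\<lambda>e. 1 - hl e) (\<lambda>e. 1 - hr e) \<le>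
     (if v \<in> Vi then (if k v = 0 then 1 else 0) - (if g v = 0 then 1 else 0) + (if k v = 0 \<or> g v * k v < 0 then int (dg v) - 2 else 0) else 0)"
    if v: "v \<in> V" for v
  proof -
    define H where "H = {e\<in>E. src e = v} <+> {e\<in>E. tgt e = v}"
    define sc where "sc = case_sum hl hr"
    define d where "d = case_sum (\<lambda>e. G1 e 0) (\<lambda>e. - G1 e (l e))"
    have fin: "finite {e\<in>E. src e = v}" "finite {e\<in>E. tgt e = v}" using graphD(2) by auto
    have fH: "finite H" using fin by (simp add: H_def)
    have cH: "card H = dg v" unfolding H_def deg_def by (simp add: card_Plus fin)
    have Hne: "H \<noteq> {}" using cH deg_pos[OF v] by auto
    have hs: "half_score (g v) (k v) (d x) (sc x)" if "x \<in> H" for x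
      using that h(1,2) g(1) k unfolding H_def sc_def d_def vertex_cont_def by (fastforce split: sum.splits)
    have s: "(\<Sum>x\<in>H. case_sum \<phi> \<psi> x) = hsum v \<phi> \<psi>" for \<phi> \<psi> :: "'e \<Rightarrow> 'a::comm_monoid_add"
      unfolding H_def by (simp add: sum.Plus fin)
    have eq: "hsum v (\<lambda>e. 1 - hl e) (\<lambda>e. 1 - hr e) = int (card H) - (\<Sum>x\<in>H. sc x)"
      unfolding sc_def s cH deg_def by (simp add: sum_subtractf)
    show ?thesis
    proof (cases "v \<in> Vi")
      case True
      have "(\<Sum>x\<in>H. d x) = 0" unfolding d_def s using g(2) True unfolding kirchhoff_def by blast
      from half_score_sum[OF fH Hne hs this]
      have *: "int (dg v) - (\<Sum>x\<in>H. sc x) + (if g v = 0 then 1 else 0) - (if k v = 0 then 1 else 0)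
        \<le> (if k v = 0 \<and> g v \<noteq> 0 \<or> g v * k v < 0 then int (dg v) - 2 else 0)" unfolding cH .
      have "int (dg v) \<ge> 2" using True by (simp add: inner_vertices_def)
      then show ?thesis unfolding eq using True * cH by (auto split: if_splits)
    next
      case False
      then have "v \<in> Vb" using V_split v by auto
      then have "g v = 0" "k v = 0" using g k unfolding vertex_cont_def by auto
      then have "int (card H) \<le> (\<Sum>x\<in>H. sc x)" using half_score_sum_zero[OF fH, of d sc] hs by auto
      then show ?thesis unfolding eq using False by auto
    qed
  qed
  have "(\<Sum>v\<in>V. hsum v (\<lambda>e. 1 - hl e) (\<lambda>e. 1 - hr e)) \<le>
     (\<Sum>v\<in>V. (if v \<in> Vi then (if k v = 0 then 1 else 0) - (if g v = 0 then 1 else 0) + (if k v = 0 \<or> g v * k v < 0 then int (dg v) - 2 else 0) else 0))"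
    using 2 by (rule sum_mono)
  also have "\<dots> = (\<Sum>v\<in>Vi. (if k v = 0 then 1 else 0) - (if g v = 0 then 1 else 0) + (if k v = 0 \<or> g v * k v < 0 then int (dg v) - 2 else 0))"
    by (subst sum.inter_restrict[OF graphD(1), symmetric]) (rule sum.cong, auto simp: inner_vertices_def)
  also have "\<dots> = int (card {v\<in>Vi. k v = 0}) - int (card {v\<in>Vi. g v = 0}) + (\<Sum>v\<in>{v\<in>Vi. k v = 0 \<or> g v * k v < 0}. int (dg v) - 2)"
    using finite_Vi by (simp add: sum.distrib sum_subtractf sum.inter_filter[symmetric])
  finally have "(\<Sum>v\<in>V. hsum v (\<lambda>e. 1 - hl e) (\<lambda>e. 1 - hr e)) \<le> int (card {v\<in>Vi. k v = 0}) - int (card {v\<in>Vi. g v = 0}) + (\<Sum>v\<in>{v\<in>Vi. k v = 0 \<or> g v * k v < 0}. int (dg v) - 2)" .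
  moreover have "int (card (zero_edge_points E l F)) = (\<Sum>e\<in>E. int (card (zeros_on F e)))" if "\<And>e. e \<in> E \<Longrightarrow> finite (zeros_on F e)" for F
    using card_zero_edge_points[OF that] by simp
  ultimately show "zero_count g G \<le> zero_count k K + (\<Sum>v\<in>{v\<in>Vi. k v = 0 \<or> g v * k v < 0}. int (dg v) - 2)"
    using 1 fGe fKe unfolding zero_count_def by (simp add: zeros_on_def)
qed

end

subsection \<open>Zeros of exponential sums\<close>

text \<open>Induction by Rolle: after division by \<open>exp (\<rho> j * s)\<close> the term of
  index \<open>j\<close> is constant and disappears from the derivative, which is an exponential sum
  with one term fewer and still distinct exponents.\<close>

lemma exp_sum_zeros:
  fixes b \<rho> :: "'i \<Rightarrow> real"
  assumes "finite I" "I \<noteq> {}" "inj_on \<rho> I" "\<And>i. i \<in> I \<Longrightarrow> b i \<noteq> 0"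
  shows "finite {s. (\<Sum>i\<in>I. b i * exp (\<rho> i * s)) = 0} \<and> card {s. (\<Sum>i\<in>I. b i * exp (\<rho> i * s)) = 0} + 1 \<le> card I"
  using assms
proof (induction "card I" arbitrary: I b \<rho>)
  case 0
  then show ?case by simp
next
  case (Suc n)
  obtain j where j: "j \<in> I" using Suc by auto
  show ?case
  proof (cases "I = {j}")
    case True
    then show ?thesis using Suc(6) by auto
  next
    case False
    define J where "J = I - {j}"
    have J: "finite J" "J \<noteq> {}" "card J = n" using Suc j False by (auto simp: J_def)
    define \<sigma> where "\<sigma> i = \<rho> i - \<rho> j" for i
    define f where "f s = (\<Sum>i\<in>I. b i * exp (\<sigma> i * s))" for s
    define f' where "f' s = (\<Sum>i\<in>J. (b i * \<sigma> i) * exp (\<sigma> i * s))" for s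
    have "finite {s. f' s = 0} \<and> card {s. f' s = 0} + 1 \<le> card J"
      unfolding f'_def
    proof (rule Suc(1))
      show "n = card J" "finite J" "J \<noteq> {}" using J by auto
      show "inj_on \<sigma> J" using Suc(5) by (auto simp: inj_on_def \<sigma>_def J_def)
      show "b i * \<sigma> i \<noteq> 0" if "i \<in> J" for i
        using that Suc(5,6) j by (auto simp: \<sigma>_def J_def inj_on_def)
    qed
    then have f': "finite {s. f' s = 0}" "card {s. f' s = 0} + 1 \<le> card J" by auto
    have eq: "{s. (\<Sum>i\<in>I. b i * exp (\<rho> i * s)) = 0} = {s. f s = 0}"
    proof -
      have "(\<Sum>i\<in>I. b i * exp (\<rho> i * s)) = exp (\<rho> j * s) * f s" for s
        unfolding f_def sum_distrib_left \<sigma>_def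
        by (rule sum.cong) (auto simp: exp_diff left_diff_distrib)
      then show ?thesis by auto
    qed
    have d: "(f has_real_derivative f' s) (at s)" for s
    proof -
      have "(f has_real_derivative (\<Sum>i\<in>I. b i * (exp (\<sigma> i * s) * \<sigma> i))) (at s)"
        unfolding f_def by (auto intro!: derivative_eq_intros sum.cong)
      moreover have "(\<Sum>i\<in>I. b i * (exp (\<sigma> i * s) * \<sigma> i)) = f' s"
        unfolding f'_def J_def sum.remove[OF Suc(3) j] by (auto simp: \<sigma>_def algebra_simps intro!: sum.cong)
      ultimately show ?thesis by simp
    qed
    have bd: "card A \<le> card {s. f' s = 0} + 1" if "A \<subseteq> {s. f s = 0}" "finite A" for A
    proof (rule card_le_Suc_between[OF that(2) f'(1)])
      fix x y assume xy: "x \<in> A" "y \<in> A" "x < y"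
      have "continuous_on {x..y} f" using d DERIV_isCont continuous_at_imp_continuous_on by blast
      then obtain z where "x < z" "z < y" "f y - f x = (y - x) * f' z"
        using MVT_interior[OF xy(3), of f f'] d by blast
      moreover have "f x = 0" "f y = 0" using xy that(1) by auto
      ultimately show "\<exists>z\<in>{s. f' s = 0}. x < z \<and> z < y" using xy(3) by (intro bexI[of _ z]) auto
    qed
    have "finite {s. f s = 0}"
      using bd finite_if_finite_subsets_card_bdd[of "{s. f s = 0}" "card {s. f' s = 0} + 1"] by blast
    moreover have "card {s. f s = 0} \<le> card {s. f' s = 0} + 1" using bd[of "{s. f s = 0}"] calculation by auto
    moreover have "card I = card J + 1" using J Suc(2) by simp
    ultimately show ?thesis unfolding eq using f' by auto
  qed
qed

subsection \<open>Stability of simple zeros\<close>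

lemma finite_real_separation:
  fixes Z :: "real set"
  assumes "finite Z"
  shows "\<exists>\<epsilon>>0. \<forall>x\<in>Z. \<forall>y\<in>Z. x \<noteq> y \<longrightarrow> \<epsilon> \<le> \<bar>x - y\<bar>"
proof -
  define S where "S = insert 1 ((\<lambda>(x,y). \<bar>x - y\<bar>) ` {(x,y) \<in> Z \<times> Z. x \<noteq> y})"
  have "finite {(x,y) \<in> Z \<times> Z. x \<noteq> y}" using assms by (auto intro: finite_subset[of _ "Z \<times> Z"])
  then have f: "finite S" unfolding S_def by auto
  have "Min S \<in> S" by (rule Min_in[OF f]) (auto simp: S_def)
  then have "Min S > 0" unfolding S_def by auto
  moreover have "Min S \<le> \<bar>x - y\<bar>" if "x \<in> Z" "y \<in> Z" "x \<noteq> y" for x y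
    by (rule Min_le[OF f]) (use that in \<open>auto simp: S_def image_iff\<close>)
  ultimately show ?thesis by blast
qed

definition simple_zeros :: "real \<Rightarrow> (real \<Rightarrow> real) \<Rightarrow> (real \<Rightarrow> real) \<Rightarrow> bool" where
  "simple_zeros l f f1 \<longleftrightarrow> 0 < l \<and> continuous_on {0..l} f1 \<and>
     (\<forall>t\<in>{0..l}. (f has_real_derivative f1 t) (at t within {0..l}) \<and> (f t = 0 \<longrightarrow> f1 t \<noteq> 0))"

lemma derivative_Icc_continuous:
  assumes "\<And>t. t \<in> {0..l} \<Longrightarrow> (f has_real_derivative f1 t) (at t within {0..l})"
  shows "continuous_on {0..l} f"
  unfolding continuous_on_eq_continuous_within using assms DERIV_continuous by blast

lemma derivative_Icc_interior:
  assumes "\<And>t. t \<in> {0..l} \<Longrightarrow> (f has_real_derivative f1 t) (at t within {0..l})" "0 < t" "t < l"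
  shows "(f has_real_derivative f1 t) (at t)"
  using assms(1)[of t] assms(2,3) at_within_Icc_at[of 0 t l] by (metis atLeastAtMost_iff less_le)

lemma Rolle_Icc:
  assumes "\<And>t. t \<in> {0..l} \<Longrightarrow> (f has_real_derivative f1 t) (at t within {0..l})"
    and "0 \<le> x" "x < y" "y \<le> l" "f x = 0" "f y = 0"
  shows "\<exists>z. x < z \<and> z < y \<and> f1 z = 0"
proof -
  have "continuous_on {x..y} f"
    by (rule continuous_on_subset[OF derivative_Icc_continuous[OF assms(1)]]) (use assms in auto)
  then obtain z where "x < z" "z < y" "f y - f x = (y - x) * f1 z"
    using MVT_interior[of x y f f1] derivative_Icc_interior[OF assms(1)] assms by fastforce
  then show ?thesis using assms by auto
qed

text \<open>\<open>|f| + |f1|\<close> has a positive minimum \<open>2 * \<delta>\<close>, so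
  \<open>|f1|\<close> is at least \<open>2 * \<delta>\<close> at every zero of \<open>f\<close>; by
  uniform continuity more than half of this survives up to a common distance
  \<open>\<epsilon>\<close>.\<close>

lemma simple_zeros_modulus:
  assumes s: "simple_zeros l f f1"
  obtains \<epsilon> \<delta> where "\<epsilon> > 0" "\<delta> > 0"
    "\<And>z x. z \<in> {0..l} \<Longrightarrow> f z = 0 \<Longrightarrow> x \<in> {0..l} \<Longrightarrow> \<bar>x - z\<bar> < \<epsilon> \<Longrightarrow> \<bar>f1 x\<bar> > \<delta>"
proof -
  have l: "0 < l" and c1: "continuous_on {0..l} f1" and c: "continuous_on {0..l} f"
    using s derivative_Icc_continuous unfolding simple_zeros_def by blast+
  have "continuous_on {0..l} (\<lambda>t. \<bar>f t\<bar> + \<bar>f1 t\<bar>)" by (intro continuous_intros c c1)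
  then obtain m where m: "m \<in> {0..l}" "\<And>t. t \<in> {0..l} \<Longrightarrow> \<bar>f m\<bar> + \<bar>f1 m\<bar> \<le> \<bar>f t\<bar> + \<bar>f1 t\<bar>"
    using continuous_attains_inf[of "{0..l}" "\<lambda>t. \<bar>f t\<bar> + \<bar>f1 t\<bar>"] l by auto
  define \<delta> where "\<delta> = (\<bar>f m\<bar> + \<bar>f1 m\<bar>) / 2"
  have "f m = 0 \<longrightarrow> f1 m \<noteq> 0" using s m(1) unfolding simple_zeros_def by blast
  then have \<delta>: "\<delta> > 0" unfolding \<delta>_def by auto
  have "uniformly_continuous_on {0..l} f1" by (rule compact_uniformly_continuous[OF c1]) auto
  then obtain \<epsilon> where \<epsilon>: "\<epsilon> > 0" "\<And>x y. x \<in> {0..l} \<Longrightarrow> y \<in> {0..l} \<Longrightarrow> dist y x < \<epsilon> \<Longrightarrow> dist (f1 y) (f1 x) < \<delta>"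
    unfolding uniformly_continuous_on_def using \<delta> by blast
  show thesis
  proof (rule that[OF \<epsilon>(1) \<delta>])
    fix z x assume a: "z \<in> {0..l}" "f z = 0" "x \<in> {0..l}" "\<bar>x - z\<bar> < \<epsilon>"
    have "2 * \<delta> \<le> \<bar>f1 z\<bar>" using m(2)[OF a(1)] a(2) by (simp add: \<delta>_def)
    moreover have "\<bar>f1 x - f1 z\<bar> < \<delta>" using \<epsilon>(2)[OF a(1,3)] a(4) by (simp add: dist_real_def)
    ultimately show "\<bar>f1 x\<bar> > \<delta>" by linarith
  qed
qed

text \<open>Near an accumulation point there would be two zeros closer than
  \<open>\<epsilon>\<close>, and Rolle would give a zero of \<open>f1\<close> between them.\<close>

lemma simple_zeros_finite:
  assumes s: "simple_zeros l f f1"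
  shows "finite {t\<in>{0..l}. f t = 0}"
proof (rule ccontr)
  assume inf: "infinite {t\<in>{0..l}. f t = 0}"
  obtain \<epsilon> \<delta> where e: "\<epsilon> > 0" "\<delta> > 0"
    "\<And>z x. z \<in> {0..l} \<Longrightarrow> f z = 0 \<Longrightarrow> x \<in> {0..l} \<Longrightarrow> \<bar>x - z\<bar> < \<epsilon> \<Longrightarrow> \<bar>f1 x\<bar> > \<delta>"
    using simple_zeros_modulus[OF s] by blast
  have d: "\<And>t. t \<in> {0..l} \<Longrightarrow> (f has_real_derivative f1 t) (at t within {0..l})" using s by (auto simp: simple_zeros_def)
  have "bounded {t\<in>{0..l}. f t = 0}" by (rule bounded_subset[of "{0..l}"]) auto
  then obtain x where "x islimpt {t\<in>{0..l}. f t = 0}" using inf bounded_infinite_imp_islimpt by blast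
  then have i: "infinite ({t\<in>{0..l}. f t = 0} \<inter> ball x (\<epsilon>/2))" using e(1) islimpt_eq_infinite_ball by (metis half_gt_zero)
  then obtain A where A: "finite A" "card A = 2" "A \<subseteq> {t\<in>{0..l}. f t = 0} \<inter> ball x (\<epsilon>/2)"
    using infinite_arbitrarily_large by blast
  then obtain u v where uv: "u \<in> A" "v \<in> A" "u < v" by (metis card_2_iff' linorder_less_linear)
  have u: "0 \<le> u" "f u = 0" "\<bar>u - x\<bar> < \<epsilon>/2" and v: "v \<le> l" "f v = 0" "\<bar>v - x\<bar> < \<epsilon>/2"
    using subsetD[OF A(3) uv(1)] subsetD[OF A(3) uv(2)] by (auto simp: dist_real_def abs_minus_commute)
  then obtain z where z: "u < z" "z < v" "f1 z = 0" using Rolle_Icc[OF d, of u v] uv by auto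
  have "\<bar>z - u\<bar> < \<epsilon>" using z u v uv by linarith
  then show False using e(3)[of u z] z u v e(2) uv by auto
qed

text \<open>Each zero of \<open>g n\<close> is sent to a nearby zero of \<open>f\<close>. Two with
  the same image would give, by Rolle, a zero of \<open>g1 n\<close> where
  \<open>|f1| > \<delta>\<close>, against uniform convergence of the derivatives. The condition at
  the end points keeps a zero of \<open>f\<close> at a vertex from moving into the edge.\<close>

lemma eventually_card_zeros_le:
  assumes s: "simple_zeros l f f1"
    and g: "\<And>n t. t \<in> {0..l} \<Longrightarrow> (g n has_real_derivative g1 n t) (at t within {0..l})"
    and u: "uniform_limit {0..l} g f sequentially" and u1: "uniform_limit {0..l} g1 f1 sequentially"
    and b: "\<forall>\<^sub>F n in sequentially. \<forall>t\<in>{0,l}. g n t = 0 \<longleftrightarrow> f t = 0"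
  shows "\<forall>\<^sub>F n in sequentially. finite {t. 0 < t \<and> t < l \<and> g n t = 0} \<and>
     card {t. 0 < t \<and> t < l \<and> g n t = 0} \<le> card {t. 0 < t \<and> t < l \<and> f t = 0}"
proof -
  obtain \<epsilon> \<delta> where e: "\<epsilon> > 0" "\<delta> > 0"
    "\<And>z x. z \<in> {0..l} \<Longrightarrow> f z = 0 \<Longrightarrow> x \<in> {0..l} \<Longrightarrow> \<bar>x - z\<bar> < \<epsilon> \<Longrightarrow> \<bar>f1 x\<bar> > \<delta>"
    using simple_zeros_modulus[OF s] by blast
  have l: "0 < l" and c: "continuous_on {0..l} f"
    using s derivative_Icc_continuous unfolding simple_zeros_def by blast+
  define Z where "Z = {t\<in>{0..l}. f t = 0}"
  have fZ: "finite Z" unfolding Z_def by (rule simple_zeros_finite[OF s])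
  \<comment> \<open>Outside the \<open>\<epsilon>\<close>-neighbourhood of its zeros,
    \<open>|f|\<close> is at least some \<open>m > 0\<close>, so a function closer than
    \<open>m\<close> to \<open>f\<close> has no zero there.\<close>
  define A where "A = {0..l} - (\<Union>z\<in>Z. ball z \<epsilon>)"
  have "compact A" unfolding A_def by (intro compact_diff) auto
  have "\<exists>m>0. \<forall>t\<in>A. m \<le> \<bar>f t\<bar>"
  proof (cases "A = {}")
    case False
    have "continuous_on A (\<lambda>t. \<bar>f t\<bar>)"
      by (intro continuous_intros continuous_on_subset[OF c]) (auto simp: A_def)
    then obtain x where x: "x \<in> A" "\<And>t. t \<in> A \<Longrightarrow> \<bar>f x\<bar> \<le> \<bar>f t\<bar>"
      using continuous_attains_inf[OF \<open>compact A\<close> False] by blast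
    have "f x \<noteq> 0" using x(1) e(1) unfolding A_def Z_def by auto
    then show ?thesis using x by (intro exI[of _ "\<bar>f x\<bar>"]) auto
  qed (auto intro: exI[of _ 1])
  then obtain m where m: "m > 0" "\<And>t. t \<in> A \<Longrightarrow> m \<le> \<bar>f t\<bar>" by blast
  have "\<forall>\<^sub>F n in sequentially. \<forall>t\<in>{0..l}. dist (g n t) (f t) < m" using uniform_limitD[OF u m(1)] .
  moreover have "\<forall>\<^sub>F n in sequentially. \<forall>t\<in>{0..l}. dist (g1 n t) (f1 t) < \<delta>" using uniform_limitD[OF u1 e(2)] .
  ultimately show ?thesis using b
  proof eventually_elim
    case (elim n)
    define Zg where "Zg = {t\<in>{0..l}. g n t = 0}"
    have "\<exists>z\<in>Z. \<bar>t - z\<bar> < \<epsilon>" if "t \<in> Zg" for t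
    proof (rule ccontr)
      assume "\<not> ?thesis"
      then have "t \<in> A" using that unfolding A_def Zg_def by (auto simp: dist_real_def abs_minus_commute)
      then have "m \<le> \<bar>f t\<bar>" using m by auto
      moreover have "dist (g n t) (f t) < m" using elim(1) that unfolding Zg_def by blast
      moreover have "g n t = 0" using that unfolding Zg_def by auto
      ultimately show False by (auto simp: dist_real_def)
    qed
    then obtain \<zeta> where \<zeta>: "\<And>t. t \<in> Zg \<Longrightarrow> \<zeta> t \<in> Z \<and> \<bar>t - \<zeta> t\<bar> < \<epsilon>" by metis
    have ne: "\<zeta> x \<noteq> \<zeta> y" if xy: "x \<in> Zg" "y \<in> Zg" "x < y" for x y
    proof
      assume eq: "\<zeta> x = \<zeta> y"
      obtain w where w: "x < w" "w < y" "g1 n w = 0" using Rolle_Icc[OF g, of x y n] xy by (auto simp: Zg_def)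
      have wl: "w \<in> {0..l}" using w xy by (auto simp: Zg_def)
      have "\<bar>w - \<zeta> x\<bar> < \<epsilon>" using \<zeta>[OF xy(1)] \<zeta>[OF xy(2)] eq w by linarith
      then have "\<bar>f1 w\<bar> > \<delta>" using e(3)[of "\<zeta> x" w] \<zeta>[OF xy(1)] wl unfolding Z_def by auto
      moreover have "dist (g1 n w) (f1 w) < \<delta>" using elim(2) wl by auto
      ultimately show False using w(3) by (simp add: dist_real_def)
    qed
    have inj: "inj_on \<zeta> Zg"
    proof (rule inj_onI)
      fix x y assume "x \<in> Zg" "y \<in> Zg" "\<zeta> x = \<zeta> y"
      then show "x = y" using ne[of x y] ne[of y x] by (metis linorder_less_linear)
    qed
    have sub: "\<zeta> ` Zg \<subseteq> Z" using \<zeta> by auto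
    have fg: "finite Zg" using finite_imageD[OF finite_subset[OF sub fZ] inj] .
    have cg: "card Zg \<le> card Z" using card_inj_on_le[OF inj sub fZ] .
    define B where "B = {t\<in>{0,l}. f t = 0}"
    have 1: "Z = {t. 0 < t \<and> t < l \<and> f t = 0} \<union> B" unfolding Z_def B_def using l by (auto simp: less_le)
    have 2: "Zg = {t. 0 < t \<and> t < l \<and> g n t = 0} \<union> B" unfolding Zg_def B_def using l elim(3) by (auto simp: less_le)
    have d: "{t. 0 < t \<and> t < l \<and> f t = 0} \<inter> B = {}" "{t. 0 < t \<and> t < l \<and> g n t = 0} \<inter> B = {}" unfolding B_def by auto
    have "finite {t. 0 < t \<and> t < l \<and> g n t = 0}" using fg 2 by (metis finite_Un)
    moreover have "card {t. 0 < t \<and> t < l \<and> g n t = 0} \<le> card {t. 0 < t \<and> t < l \<and> f t = 0}"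
      using cg fg fZ unfolding 1 2 finite_Un by (simp add: card_Un_disjoint d)
    ultimately show ?case by blast
  qed
qed

text \<open>A simple zero is a sign change between two fixed nearby points, and this persists under
  pointwise convergence. Brackets of radius \<open>\<epsilon> / 2\<close> are disjoint and stay
  inside the edge.\<close>

lemma eventually_card_zeros_ge:
  assumes s: "simple_zeros l f f1"
    and g: "\<And>n. continuous_on {0..l} (g n)" and fin: "\<And>n. finite {t. 0 < t \<and> t < l \<and> g n t = 0}"
    and lim: "\<And>t. t \<in> {0..l} \<Longrightarrow> (\<lambda>n. g n t) \<longlonglongrightarrow> f t"
  shows "\<forall>\<^sub>F n in sequentially. card {t. 0 < t \<and> t < l \<and> f t = 0} \<le> card {t. 0 < t \<and> t < l \<and> g n t = 0}"
proof -
  define Z where "Z = {t. 0 < t \<and> t < l \<and> f t = 0}"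
  have fZ: "finite Z" by (rule finite_subset[OF _ simple_zeros_finite[OF s]]) (auto simp: Z_def)
  have l: "0 < l" using s by (auto simp: simple_zeros_def)
  have d: "\<And>t. t \<in> {0..l} \<Longrightarrow> (f has_real_derivative f1 t) (at t within {0..l})" using s by (auto simp: simple_zeros_def)
  obtain \<epsilon> where e: "\<epsilon> > 0" "\<And>x y. x \<in> Z \<union> {0,l} \<Longrightarrow> y \<in> Z \<union> {0,l} \<Longrightarrow> x \<noteq> y \<Longrightarrow> \<epsilon> \<le> \<bar>x - y\<bar>"
    using finite_real_separation[of "Z \<union> {0,l}"] fZ by (metis finite.emptyI finite.insertI finite_Un)
  have "\<exists>x y. z - \<epsilon>/2 < x \<and> x < z \<and> z < y \<and> y < z + \<epsilon>/2 \<and> f x * f y < 0" if z: "z \<in> Z" for z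
  proof -
    have dz: "(f has_real_derivative f1 z) (at z)" using derivative_Icc_interior[OF d] z by (auto simp: Z_def)
    have fz: "f z = 0" "f1 z \<noteq> 0" using z s by (auto simp: Z_def simple_zeros_def)
    have *: "\<exists>x y. z - \<epsilon>/2 < x \<and> x < z \<and> z < y \<and> y < z + \<epsilon>/2 \<and> h x < 0 \<and> 0 < h y"
      if h: "(h has_real_derivative h1) (at z)" "h1 > 0" "h z = 0" for h h1
    proof -
      obtain a where a: "a > 0" "\<And>t. 0 < t \<Longrightarrow> t < a \<Longrightarrow> h z < h (z + t)" using DERIV_pos_inc_right[OF h(1,2)] by blast
      obtain b where b: "b > 0" "\<And>t. 0 < t \<Longrightarrow> t < b \<Longrightarrow> h (z - t) < h z" using DERIV_pos_inc_left[OF h(1,2)] by blast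
      define t where "t = min (min a b) (\<epsilon>/2) / 2"
      have "0 < t" "t < a" "t < b" "t < \<epsilon>/2" using a(1) b(1) e(1) by (auto simp: t_def min_def)
      then show ?thesis using a(2)[of t] b(2)[of t] h(3) by (intro exI[of _ "z - t"] exI[of _ "z + t"]) auto
    qed
    show ?thesis
    proof (cases "f1 z > 0")
      case True
      then show ?thesis using *[OF dz] fz by (meson mult_neg_pos)
    next
      case False
      then have "- f1 z > 0" using fz by auto
      then obtain x y where "z - \<epsilon>/2 < x \<and> x < z \<and> z < y \<and> y < z + \<epsilon>/2 \<and> - f x < 0 \<and> 0 < - f y"
        using *[OF DERIV_minus[OF dz]] fz by auto
      then show ?thesis by (intro exI[of _ x] exI[of _ y]) (auto simp: mult_pos_neg)
    qed
  qed
  then obtain x y where xy: "\<And>z. z \<in> Z \<Longrightarrow> z - \<epsilon>/2 < x z \<and> x z < z \<and> z < y z \<and> y z < z + \<epsilon>/2 \<and> f (x z) * f (y z) < 0" by metis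
  have in0: "0 < x z \<and> y z < l" if "z \<in> Z" for z
  proof -
    have "\<epsilon> \<le> \<bar>z - 0\<bar>" "\<epsilon> \<le> \<bar>z - l\<bar>" by (rule e(2); use that in \<open>auto simp: Z_def\<close>)+
    then show ?thesis using xy[OF that] that by (auto simp: Z_def)
  qed
  have "\<forall>\<^sub>F n in sequentially. \<forall>z\<in>Z. g n (x z) * g n (y z) < 0"
  proof (subst eventually_ball_finite_distrib[OF fZ], rule ballI)
    fix z assume z: "z \<in> Z"
    have "(\<lambda>n. g n (x z) * g n (y z)) \<longlonglongrightarrow> f (x z) * f (y z)"
      by (intro tendsto_mult lim) (use xy[OF z] in0[OF z] in auto)
    then show "\<forall>\<^sub>F n in sequentially. g n (x z) * g n (y z) < 0" using xy[OF z] order_tendstoD(2) by blast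
  qed
  then show ?thesis
  proof eventually_elim
    case (elim n)
    have "\<exists>w. x z < w \<and> w < y z \<and> g n w = 0" if z: "z \<in> Z" for z
    proof (rule ccontr)
      assume no: "\<not> ?thesis"
      have c: "continuous_on {x z..y z} (g n)" by (rule continuous_on_subset[OF g]) (use in0[OF z] in auto)
      have neg: "g n (x z) * g n (y z) < 0" using elim z by auto
      then have "g n (x z) \<noteq> 0" "g n (y z) \<noteq> 0" by auto
      then have "g n z * g n (x z) > 0" "g n z * g n (y z) > 0"
        using continuous_nonzero_same_sign[OF c, of z "x z"] continuous_nonzero_same_sign[OF c, of z "y z"] no xy[OF z] neg by auto
      then show False using neg by (auto simp: zero_less_mult_iff mult_less_0_iff)
    qed
    then obtain w where w: "\<And>z. z \<in> Z \<Longrightarrow> x z < w z \<and> w z < y z \<and> g n (w z) = 0" by metis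
    have "inj_on w Z"
    proof (rule inj_onI, rule ccontr)
      fix u v assume uv: "u \<in> Z" "v \<in> Z" "w u = w v" "u \<noteq> v"
      have "\<epsilon> \<le> \<bar>u - v\<bar>" using e(2)[of u v] uv by auto
      then show False using w[OF uv(1)] w[OF uv(2)] xy[OF uv(1)] xy[OF uv(2)] uv(3) by linarith
    qed
    moreover have "w ` Z \<subseteq> {t. 0 < t \<and> t < l \<and> g n t = 0}" using w in0 by force
    ultimately have "card Z \<le> card {t. 0 < t \<and> t < l \<and> g n t = 0}" using card_inj_on_le fin by blast
    then show ?case unfolding Z_def .
  qed
qed

subsection \<open>Eigenfunctions\<close>

text \<open>Gronwall's argument for \<open>y = f^2 + f1^2\<close>: the derivative is
  \<open>2 f f1 (1 + q)\<close>, so \<open>|y'| \<le> C * y\<close>. Then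
  \<open>y s * exp (- C * s)\<close> is nonincreasing and \<open>y s * exp (C * s)\<close>
  nondecreasing, which covers both sides of \<open>t0\<close>.\<close>

lemma linear_ode_unique:
  assumes q: "continuous_on {0..l} q"
    and f: "\<And>t. t \<in> {0..l} \<Longrightarrow> (f has_real_derivative f1 t) (at t within {0..l})"
    and f1: "\<And>t. t \<in> {0..l} \<Longrightarrow> (f1 has_real_derivative q t * f t) (at t within {0..l})"
    and t0: "t0 \<in> {0..l}" "f t0 = 0" "f1 t0 = 0" and t: "t \<in> {0..l}"
  shows "f t = 0"
proof -
  have "bounded (q ` {0..l})" by (intro compact_imp_bounded compact_continuous_image q) auto
  then obtain C0 where "\<forall>x\<in>q ` {0..l}. norm x \<le> C0" unfolding bounded_iff by blast
  then have C0: "\<And>s. s \<in> {0..l} \<Longrightarrow> \<bar>q s\<bar> \<le> C0" by auto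
  define C where "C = 1 + C0"
  define y where "y s = (f s)\<^sup>2 + (f1 s)\<^sup>2" for s
  define y' where "y' s = 2 * f s * f1 s + 2 * f1 s * (q s * f s)" for s
  have cf: "continuous_on {0..l} f" "continuous_on {0..l} f1"
    using derivative_Icc_continuous[of l f f1] derivative_Icc_continuous[of l f1 "\<lambda>t. q t * f t"] f f1 by auto
  have y'b: "\<bar>y' s\<bar> \<le> C * y s" if "s \<in> {0..l}" for s
  proof -
    have "y' s = 2 * f s * f1 s * (1 + q s)" unfolding y'_def by (simp add: algebra_simps)
    then have "\<bar>y' s\<bar> = 2 * \<bar>f s\<bar> * \<bar>f1 s\<bar> * \<bar>1 + q s\<bar>" by (simp add: abs_mult)
    also have "\<dots> \<le> 2 * \<bar>f s\<bar> * \<bar>f1 s\<bar> * C"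
      by (rule mult_left_mono) (use C0[OF that] in \<open>auto simp: C_def\<close>)
    also have "\<dots> \<le> y s * C"
    proof (rule mult_right_mono)
      have "0 \<le> (\<bar>f s\<bar> - \<bar>f1 s\<bar>)\<^sup>2" by simp
      then show "2 * \<bar>f s\<bar> * \<bar>f1 s\<bar> \<le> y s" unfolding y_def power2_diff by simp
      show "0 \<le> C" using C0[OF that] by (simp add: C_def)
    qed
    finally show ?thesis by (simp add: mult.commute)
  qed
  have dE: "((\<lambda>s. y s * exp (a * s)) has_real_derivative (y' s + a * y s) * exp (a * s)) (at s)" if "0 < s" "s < l" for s a
  proof -
    note d = derivative_Icc_interior[OF f that] derivative_Icc_interior[OF f1 that]
    have "((\<lambda>s. f s * f s + f1 s * f1 s) has_real_derivative
        (f1 s * f s + f1 s * f s) + (q s * f s * f1 s + q s * f s * f1 s)) (at s)"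
      by (intro DERIV_add DERIV_mult d)
    moreover have "(f1 s * f s + f1 s * f s) + (q s * f s * f1 s + q s * f s * f1 s) = y' s"
      unfolding y'_def by (simp add: algebra_simps)
    moreover have "(\<lambda>s. f s * f s + f1 s * f1 s) = y" unfolding y_def by (simp add: power2_eq_square)
    ultimately have dy: "(y has_real_derivative y' s) (at s)" by simp
    have "((\<lambda>s. exp (a * s)) has_real_derivative exp (a * s) * a) (at s)"
      by (auto intro!: derivative_eq_intros)
    from DERIV_mult[OF dy this] show ?thesis by (simp add: algebra_simps)
  qed
  have cE: "continuous_on {0..l} (\<lambda>s. y s * exp (a * s))" for a
    unfolding y_def by (intro continuous_intros cf)
  have y0: "y t0 = 0" using t0 by (simp add: y_def)
  have "y t \<le> 0"
  proof -
    consider "t = t0" | "t0 < t" | "t < t0" by linarith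
    then show ?thesis
    proof cases
      case 1 then show ?thesis using y0 by simp
    next
      case 2
      obtain z where z: "t0 < z" "z < t" "y t * exp (- C * t) - y t0 * exp (- C * t0) = (t - t0) * ((y' z + - C * y z) * exp (- C * z))"
        using MVT_interior[OF 2, of "\<lambda>s. y s * exp (- C * s)" "\<lambda>z. (y' z + - C * y z) * exp (- C * z)"]
          dE[of _ "-C"] continuous_on_subset[OF cE[of "-C"], of "{t0..t}"] t t0 by auto
      have "y' z + - C * y z \<le> 0" using y'b[of z] z t t0 by auto
      then have "(t - t0) * ((y' z + - C * y z) * exp (- C * z)) \<le> 0"
        using 2 by (simp add: mult_nonneg_nonpos mult_nonpos_nonneg)
      then have "y t * exp (- C * t) \<le> 0" using z(3) y0 by simp
      then show ?thesis by (simp add: mult_le_0_iff)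
    next
      case 3
      obtain z where z: "t < z" "z < t0" "y t0 * exp (C * t0) - y t * exp (C * t) = (t0 - t) * ((y' z + C * y z) * exp (C * z))"
        using MVT_interior[OF 3, of "\<lambda>s. y s * exp (C * s)" "\<lambda>z. (y' z + C * y z) * exp (C * z)"]
          dE[of _ C] continuous_on_subset[OF cE[of "C"], of "{t..t0}"] t t0 by auto
      have "y' z + C * y z \<ge> 0" using y'b[of z] z t t0 by auto
      then have "(t0 - t) * ((y' z + C * y z) * exp (C * z)) \<ge> 0" using 3 by simp
      then have "y t * exp (C * t) \<le> 0" using z(3) y0 by simp
      then show ?thesis by (simp add: mult_le_0_iff)
    qed
  qed
  then have "(f t)\<^sup>2 + (f1 t)\<^sup>2 \<le> 0" unfolding y_def .
  then show ?thesis by (simp add: sum_power2_le_zero_iff)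
qed

context compact_graph
begin

text \<open>Neither end carries another half-edge, so no path can leave the edge, and connectedness
  does the rest. This isolates the interval, the case without inner vertices in which genericity
  gives no information.\<close>

lemma single_edge:
  assumes e: "e \<in> E" "src e \<in> Vb" "tgt e \<in> Vb"
  shows "E = {e}"
proof -
  have fin: "finite {e\<in>E. src e = v}" "finite {e\<in>E. tgt e = v}" for v using graphD(2) by auto
  have inc: "e' = e" if v: "v \<in> Vb" "src e = v \<or> tgt e = v" and e': "e' \<in> E" "src e' = v \<or> tgt e' = v" for v e'
  proof (rule ccontr)
    assume ne: "e' \<noteq> e"
    have d: "card {e\<in>E. src e = v} + card {e\<in>E. tgt e = v} = 1" using v(1) unfolding boundary_vertices_def deg_def by auto
    have "{e\<in>E. src e = v} <+> {e\<in>E. tgt e = v} \<noteq> {}" using e' by auto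
    have c1: "card ({e\<in>E. src e = v} <+> {e\<in>E. tgt e = v}) = 1" using d fin by (simp add: card_Plus)
    obtain x where x: "{e\<in>E. src e = v} <+> {e\<in>E. tgt e = v} = {x}" using c1 card_1_singletonE by blast
    have "\<exists>y\<in>{x}. y = Inl e \<or> y = Inr e" "\<exists>y\<in>{x}. y = Inl e' \<or> y = Inr e'"
      unfolding x[symmetric] using v(2) e e' by auto
    moreover have "Inl e \<in> {x} \<and> Inr e' \<in> {x} \<longrightarrow> False" "Inr e \<in> {x} \<and> Inl e' \<in> {x} \<longrightarrow> False" by auto
    ultimately show False using ne by auto
  qed
  have reach: "w = src e \<or> w = tgt e"
    if "(\<lambda>x y. \<exists>e\<in>E. (src e = x \<and> tgt e = y) \<or> (src e = y \<and> tgt e = x))\<^sup>*\<^sup>* (src e) w" for w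
    using that
  proof induction
    case (step y z)
    then obtain e' where e': "e' \<in> E" "(src e' = y \<and> tgt e' = z) \<or> (src e' = z \<and> tgt e' = y)" by blast
    have "e' = e" using inc[of y e'] step e' e by auto
    then show ?case using e' by auto
  qed simp
  have "e' = e" if e': "e' \<in> E" for e'
  proof -
    have "src e' = src e \<or> src e' = tgt e"
      by (rule reach[OF graphD(7)[OF graphD(4)[OF e(1)] graphD(4)[OF e']]])
    then show ?thesis using inc[of "src e" e'] inc[of "tgt e" e'] e e' by auto
  qed
  then show ?thesis using e(1) by blast
qed

end

locale schroedinger_graph = compact_graph V E src tgt l
  for V :: "'v set" and E :: "'e set" and src tgt :: "'e \<Rightarrow> 'v" and l :: "'e \<Rightarrow> real" +
  fixes W :: "'e \<Rightarrow> real \<Rightarrow> real"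
  assumes W_cont: "\<And>e. e \<in> E \<Longrightarrow> continuous_on {0..l e} (W e)"
begin

definition eig :: "real \<Rightarrow> ('e \<Rightarrow> real \<Rightarrow> real) \<Rightarrow> ('e \<Rightarrow> real \<Rightarrow> real) \<Rightarrow> ('v \<Rightarrow> real) \<Rightarrow> bool" where
  "eig lam f D fv \<longleftrightarrow> (\<forall>e\<in>E. \<forall>t\<in>{0..l e}. (f e has_real_derivative D e t) (at t within {0..l e}) \<and>
      (D e has_real_derivative (W e t - lam) * f e t) (at t within {0..l e})) \<and> vertex_cont fv f \<and> kirchhoff D"

abbreviation "nonzero f \<equiv> (\<exists>e\<in>E. \<exists>t\<in>{0..l e}. f e t \<noteq> 0)"
abbreviation "is_eigenfunction \<equiv> eigenfunction V E src tgt l W"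

lemma eigD:
  assumes "eig lam f D fv" "e \<in> E"
  shows "\<And>t. t \<in> {0..l e} \<Longrightarrow> (f e has_real_derivative D e t) (at t within {0..l e})"
    "\<And>t. t \<in> {0..l e} \<Longrightarrow> (D e has_real_derivative (W e t - lam) * f e t) (at t within {0..l e})"
    "f e 0 = fv (src e)" "f e (l e) = fv (tgt e)"
    "continuous_on {0..l e} (f e)" "continuous_on {0..l e} (D e)"
proof -
  show 1: "\<And>t. t \<in> {0..l e} \<Longrightarrow> (f e has_real_derivative D e t) (at t within {0..l e})"
    "\<And>t. t \<in> {0..l e} \<Longrightarrow> (D e has_real_derivative (W e t - lam) * f e t) (at t within {0..l e})"
    and "f e 0 = fv (src e)" "f e (l e) = fv (tgt e)"
    using assms unfolding eig_def vertex_cont_def by auto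
  show "continuous_on {0..l e} (f e)" "continuous_on {0..l e} (D e)"
    using derivative_Icc_continuous[of "l e" "f e" "D e"] derivative_Icc_continuous[of "l e" "D e" "\<lambda>t. (W e t - lam) * f e t"] 1
    by auto
qed

lemma eigenfunction_iff:
  "is_eigenfunction lam f \<longleftrightarrow> (\<exists>D fv. eig lam f D fv) \<and> nonzero f"
proof
  assume f: "is_eigenfunction lam f"
  then obtain D D2 where D: "\<And>e t. e \<in> E \<Longrightarrow> t \<in> {0..l e} \<Longrightarrow> (f e has_real_derivative D e t) (at t within {0..l e})"
      "\<And>e t. e \<in> E \<Longrightarrow> t \<in> {0..l e} \<Longrightarrow> (D e has_real_derivative D2 e t) (at t within {0..l e})"
      "\<And>e t. e \<in> E \<Longrightarrow> t \<in> {0..l e} \<Longrightarrow> - D2 e t + W e t * f e t = lam * f e t"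
      "\<And>v. v \<in> Vb \<Longrightarrow> vertex_vals E src tgt l f v \<subseteq> {0}"
      "\<And>v. v \<in> Vi \<Longrightarrow> \<exists>c. vertex_vals E src tgt l f v \<subseteq> {c}"
      "\<And>v. v \<in> Vi \<Longrightarrow> (\<Sum>e\<in>{e\<in>E. src e = v}. D e 0) - (\<Sum>e\<in>{e\<in>E. tgt e = v}. D e (l e)) = 0"
      and nz: "nonzero f"
    unfolding eigenfunction_def by blast
  obtain c where c: "\<And>v. v \<in> Vi \<Longrightarrow> vertex_vals E src tgt l f v \<subseteq> {c v}" using D(5) by metis
  define fv where "fv v = (if v \<in> Vb then 0 else c v)" for v
  have sub: "vertex_vals E src tgt l f v \<subseteq> {fv v}" if "v \<in> V" for v
    using D(4) c V_split that by (auto simp: fv_def)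
  have "f e 0 = fv (src e)" "f e (l e) = fv (tgt e)" if "e \<in> E" for e
    using sub[OF graphD(4)[OF that]] sub[OF graphD(5)[OF that]] that unfolding vertex_vals_def by blast+
  then have "vertex_cont fv f" unfolding vertex_cont_def by (auto simp: fv_def)
  moreover have "kirchhoff D" unfolding kirchhoff_def using D(6) by (simp add: sum_negf)
  moreover have "D2 e t = (W e t - lam) * f e t" if "e \<in> E" "t \<in> {0..l e}" for e t
    using D(3)[OF that] by (simp add: algebra_simps)
  ultimately have "eig lam f D fv" unfolding eig_def using D(1,2) by auto
  then show "(\<exists>D fv. eig lam f D fv) \<and> nonzero f" using nz by blast
next
  assume "(\<exists>D fv. eig lam f D fv) \<and> nonzero f"
  then obtain D fv where f: "eig lam f D fv" and nz: "nonzero f" by blast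
  show "is_eigenfunction lam f"
    unfolding eigenfunction_def
  proof (intro conjI nz, rule exI[of _ D], rule exI[of _ "\<lambda>e t. (W e t - lam) * f e t"], intro conjI ballI)
    fix e assume e: "e \<in> E"
    show "continuous_on {0..l e} (\<lambda>t. (W e t - lam) * f e t)"
      by (intro continuous_intros W_cont e eigD(5)[OF f e])
  next
    fix e t assume "e \<in> E" "t \<in> {0..l e}"
    then show "(f e has_real_derivative D e t) (at t within {0..l e})"
      "(D e has_real_derivative (W e t - lam) * f e t) (at t within {0..l e})"
      using eigD[OF f] by auto
    show "- ((W e t - lam) * f e t) + W e t * f e t = lam * f e t" by (simp add: algebra_simps)
  next
    fix v assume "v \<in> Vb"
    then show "vertex_vals E src tgt l f v \<subseteq> {0}" using f unfolding eig_def vertex_cont_def vertex_vals_def by auto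
  next
    fix v assume v: "v \<in> Vi"
    show "\<exists>c. vertex_vals E src tgt l f v \<subseteq> {c}"
      using f unfolding eig_def vertex_cont_def vertex_vals_def by (intro exI[of _ "fv v"]) auto
    show "(\<Sum>e\<in>{e\<in>E. src e = v}. D e 0) - (\<Sum>e\<in>{e\<in>E. tgt e = v}. D e (l e)) = 0"
      using f v unfolding eig_def kirchhoff_def by (simp add: sum_negf)
  qed
qed

lemma eig_sum:
  assumes "\<And>i. i \<in> I \<Longrightarrow> eig lam (f i) (D i) (fv i)"
  shows "eig lam (\<lambda>e t. \<Sum>i\<in>I. c i * f i e t) (\<lambda>e t. \<Sum>i\<in>I. c i * D i e t) (\<lambda>v. \<Sum>i\<in>I. c i * fv i v)"
  unfolding eig_def
proof (intro conjI ballI)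
  fix e t assume et: "e \<in> E" "t \<in> {0..l e}"
  show "((\<lambda>t. \<Sum>i\<in>I. c i * f i e t) has_real_derivative (\<Sum>i\<in>I. c i * D i e t)) (at t within {0..l e})"
    by (intro DERIV_sum DERIV_cmult eigD(1)[OF assms et])
  have "((\<lambda>t. \<Sum>i\<in>I. c i * D i e t) has_real_derivative (\<Sum>i\<in>I. c i * ((W e t - lam) * f i e t))) (at t within {0..l e})"
    by (intro DERIV_sum DERIV_cmult eigD(2)[OF assms et])
  then show "((\<lambda>t. \<Sum>i\<in>I. c i * D i e t) has_real_derivative (W e t - lam) * (\<Sum>i\<in>I. c i * f i e t)) (at t within {0..l e})"
    by (simp add: sum_distrib_left mult.left_commute)
next
  show "vertex_cont (\<lambda>v. \<Sum>i\<in>I. c i * fv i v) (\<lambda>e t. \<Sum>i\<in>I. c i * f i e t)"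
    using assms unfolding eig_def vertex_cont_def by (auto intro!: sum.cong sum.neutral)
  have "hsum v (\<lambda>e. \<Sum>i\<in>I. c i * D i e 0) (\<lambda>e. - (\<Sum>i\<in>I. c i * D i e (l e))) =
      (\<Sum>i\<in>I. c i * hsum v (\<lambda>e. D i e 0) (\<lambda>e. - D i e (l e)))" for v
  proof -
    have "(\<Sum>e\<in>A. \<Sum>i\<in>I. c i * X i e) = (\<Sum>i\<in>I. c i * (\<Sum>e\<in>A. X i e))" for A and X :: "'a \<Rightarrow> 'e \<Rightarrow> real"
      by (subst sum.swap) (simp add: sum_distrib_left)
    then show ?thesis by (simp add: distrib_left right_diff_distrib sum.distrib sum_negf sum_subtractf)
  qed
  then show "kirchhoff (\<lambda>e t. \<Sum>i\<in>I. c i * D i e t)"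
    using assms unfolding eig_def kirchhoff_def by simp
qed

lemma eig_diff:
  assumes "eig lam f D fv" "eig lam g D' gv"
  shows "eig lam (\<lambda>e t. f e t - c * g e t) (\<lambda>e t. D e t - c * D' e t) (\<lambda>v. fv v - c * gv v)"
proof -
  have "eig lam (\<lambda>e t. \<Sum>i\<in>{True,False}. (if i then 1 else - c) * (if i then f else g) e t)
      (\<lambda>e t. \<Sum>i\<in>{True,False}. (if i then 1 else - c) * (if i then D else D') e t)
      (\<lambda>v. \<Sum>i\<in>{True,False}. (if i then 1 else - c) * (if i then fv else gv) v)"
    by (rule eig_sum) (use assms in auto)
  then show ?thesis by simp
qed

lemma eig_zero_on_edge:
  assumes f: "eig lam f D fv" and e: "e \<in> E" and t0: "t0 \<in> {0..l e}" "f e t0 = 0" "D e t0 = 0" and t: "t \<in> {0..l e}"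
  shows "f e t = 0"
  by (rule linear_ode_unique[of "l e" "\<lambda>t. W e t - lam" "f e" "D e" t0])
    (use eigD[OF f e] t0 t W_cont[OF e] in \<open>auto intro!: continuous_intros\<close>)

end

section \<open>Consequences of genericity: simple zeros and simple eigenvalues\<close>

locale generic_graph = schroedinger_graph +
  assumes generic: "W_generic V E src tgt l W"
begin

lemma generic_vertex:
  assumes f: "eig lam f D fv" and nz: "nonzero f" and v: "v \<in> Vi"
  shows "fv v \<noteq> 0"
proof -
  have "is_eigenfunction lam f" using f nz eigenfunction_iff by blast
  then have "0 \<notin> vertex_vals E src tgt l f v" using generic v unfolding W_generic_def by blast
  moreover have "v \<in> V" using v by (simp add: inner_vertices_def)
  then obtain e where e: "e \<in> E" "src e = v \<or> tgt e = v" using incident_edge by blast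
  moreover have "fv v \<in> vertex_vals E src tgt l f v"
    using e eigD(3,4)[OF f e(1)] unfolding vertex_vals_def by force
  ultimately show ?thesis by metis
qed

text \<open>Vanishing on an edge includes vanishing at its two ends, which by genericity must then
  be boundary vertices; so the edge is the whole graph.\<close>

lemma generic_edge:
  assumes f: "eig lam f D fv" and nz: "nonzero f" and e: "e \<in> E"
  shows "\<exists>t\<in>{0..l e}. f e t \<noteq> 0"
proof (rule ccontr)
  assume "\<not> ?thesis"
  then have z: "\<And>t. t \<in> {0..l e} \<Longrightarrow> f e t = 0" by auto
  have l: "l e > 0" using graphD(6)[OF e] .
  have "fv (src e) = 0" "fv (tgt e) = 0" using z[of 0] z[of "l e"] eigD(3,4)[OF f e] l by auto
  then have "src e \<notin> Vi" "tgt e \<notin> Vi" using generic_vertex[OF f nz] by auto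
  then have "src e \<in> Vb" "tgt e \<in> Vb" using V_split graphD(4,5)[OF e] by auto
  then have "E = {e}" using single_edge[OF e] by auto
  then show False using nz z by auto
qed

lemma eig_simple_zeros:
  assumes f: "eig lam f D fv" and nz: "nonzero f" and e: "e \<in> E"
  shows "simple_zeros (l e) (f e) (D e)"
proof -
  have "D e t \<noteq> 0" if "t \<in> {0..l e}" "f e t = 0" for t
    using generic_edge[OF assms] eig_zero_on_edge[OF f e that] by blast
  then show ?thesis
    unfolding simple_zeros_def using eigD(1,6)[OF f e] graphD(6)[OF e] by auto
qed

text \<open>Subtracting the multiple of \<open>f\<close> that cancels \<open>g\<close> at one inner
  vertex leaves zero, by genericity. Without inner vertices the graph is an interval, both functions
  vanish at 0, and uniqueness of the initial value problem gives the ratio of the derivatives there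
  as factor.\<close>

lemma eig_proportional:
  assumes f: "eig lam f D fv" and nz: "nonzero f" and g: "eig lam g D' gv"
  shows "\<exists>c. \<forall>e\<in>E. \<forall>t\<in>{0..l e}. g e t = c * f e t"
proof (cases "Vi = {}")
  case False
  then obtain v where v: "v \<in> Vi" by auto
  define c where "c = gv v / fv v"
  have "\<not> nonzero (\<lambda>e t. g e t - c * f e t)"
    using generic_vertex[OF eig_diff[OF g f, of c] _ v] generic_vertex[OF f nz v] by (auto simp: c_def)
  then show ?thesis by auto
next
  case True
  obtain e where e: "e \<in> E" using graphD(3) by auto
  have b: "src e \<in> Vb" "tgt e \<in> Vb" using V_split True graphD(4,5)[OF e] by auto
  have E: "E = {e}" using single_edge[OF e b] .
  have l: "0 \<in> {0..l e}" using graphD(6)[OF e] by auto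
  have 0: "f e 0 = 0" "g e 0 = 0" using f g b eigD(3)[OF f e] eigD(3)[OF g e] unfolding eig_def vertex_cont_def by auto
  have D: "D e 0 \<noteq> 0" using eig_simple_zeros[OF f nz e] 0 l unfolding simple_zeros_def by auto
  have "g e t - (D' e 0 / D e 0) * f e t = 0" if "t \<in> {0..l e}" for t
    by (rule eig_zero_on_edge[OF eig_diff[OF g f, of "D' e 0 / D e 0"] e l _ _ that]) (use 0 D in auto)
  then show ?thesis using E by (intro exI[of _ "D' e 0 / D e 0"]) auto
qed

text \<open>Two eigenfunctions are dependent, so the supremum is taken over \<open>{0, 1}\<close>.
  The index in \<open>kth_eigenfunction\<close> thereby becomes a plain count of smaller
  eigenvalues.\<close>

lemma multiplicity_one:
  assumes "eigenvalue V E src tgt l W lam"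
  shows "Defs.multiplicity V E src tgt l W lam = 1"
proof -
  obtain f where f: "is_eigenfunction lam f" using assms unfolding eigenvalue_def by auto
  have "n \<le> 1" if "\<forall>i<n. is_eigenfunction lam (fs i)" "lin_indep_on_graph E l n fs" for n fs
  proof (rule ccontr)
    assume n: "\<not> n \<le> 1"
    have "is_eigenfunction lam (fs 0)" "is_eigenfunction lam (fs 1)" using that(1) n by auto
    then obtain D fv D' gv where 0: "eig lam (fs 0) D fv" "nonzero (fs 0)" "eig lam (fs 1) D' gv"
      unfolding eigenfunction_iff by blast
    obtain c where c: "\<And>e t. e \<in> E \<Longrightarrow> t \<in> {0..l e} \<Longrightarrow> fs 1 e t = c * fs 0 e t"
      using eig_proportional[OF 0] by blast
    define a where "a i = (if i = 0 then - c else if i = 1 then 1 else (0::real))" for i :: nat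
    have "(\<Sum>i<n. a i * fs i e t) = 0" if "e \<in> E" "t \<in> {0..l e}" for e t
    proof -
      have "(\<Sum>i<n. a i * fs i e t) = (\<Sum>i\<in>{0,1}. a i * fs i e t)"
        by (rule sum.mono_neutral_right) (use n in \<open>auto simp: a_def\<close>)
      then show ?thesis using c[OF that] by (simp add: a_def)
    qed
    then have "\<forall>i<n. a i = 0" using that(2) unfolding lin_indep_on_graph_def by blast
    then have "a 1 = 0" using n by simp
    then show False by (simp add: a_def)
  qed
  then have sub: "{n. \<exists>fs. (\<forall>i<n. is_eigenfunction lam (fs i)) \<and> lin_indep_on_graph E l n fs} \<subseteq> {0,1}"
    by (auto simp: le_Suc_eq)
  obtain e t where et: "e \<in> E" "t \<in> {0..l e}" "f e t \<noteq> 0" using f unfolding eigenfunction_iff by blast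
  have "lin_indep_on_graph E l 1 (\<lambda>_. f)"
    unfolding lin_indep_on_graph_def using et by (auto dest!: bspec)
  then have "1 \<in> {n. \<exists>fs. (\<forall>i<n. is_eigenfunction lam (fs i)) \<and> lin_indep_on_graph E l n fs}" using f by auto
  moreover have "0 \<in> {n. \<exists>fs. (\<forall>i<n. is_eigenfunction lam (fs i)) \<and> lin_indep_on_graph E l n fs}"
    by (simp add: lin_indep_on_graph_def)
  ultimately have "{n. \<exists>fs. (\<forall>i<n. is_eigenfunction lam (fs i)) \<and> lin_indep_on_graph E l n fs} = {0,1}"
    using sub by blast
  then show ?thesis unfolding Defs.multiplicity_def by (simp add: sup_nat_def Sup_nat_def)
qed

end

subsection \<open>The discrete heat flow\<close>

lemma uniform_limit_combination:
  fixes X :: "nat \<Rightarrow> real \<Rightarrow> real"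
  assumes "\<And>i. i < M \<Longrightarrow> (\<lambda>n. u n i) \<longlonglongrightarrow> w i" "\<And>i. i < M \<Longrightarrow> continuous_on S (X i)" "compact S"
  shows "uniform_limit S (\<lambda>n t. \<Sum>i<M. u n i * X i t) (\<lambda>t. \<Sum>i<M. w i * X i t) sequentially"
  using assms(1,2)
proof (induction M)
  case 0
  then show ?case by (simp add: uniform_limit_const)
next
  case (Suc M)
  have "uniform_limit S (\<lambda>n t. u n M * X M t) (\<lambda>t. w M * X M t) sequentially"
  proof (rule uniform_lim_mult)
    show "uniform_limit S (\<lambda>n t. u n M) (\<lambda>t. w M) sequentially"
      using Suc(2)[of M] by (simp add: uniform_limit_iff tendsto_iff eventually_mono)
    show "uniform_limit S (\<lambda>n. X M) (X M) sequentially" by (simp add: uniform_limit_const)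
    show "bounded ((\<lambda>t. w M) ` S)" by (rule bounded_subset[of "{w M}"]) auto
    show "bounded (X M ` S)" using Suc(3)[of M] assms(3) by (intro compact_imp_bounded compact_continuous_image) auto
  qed
  then show ?case using Suc by (simp add: uniform_limit_add)
qed

locale eigen_combination = generic_graph +
  fixes M :: nat and a lam :: "nat \<Rightarrow> real" and f D :: "nat \<Rightarrow> 'b \<Rightarrow> real \<Rightarrow> real" and fv :: "nat \<Rightarrow> 'a \<Rightarrow> real" and c :: real
  assumes M1: "M \<ge> 1" and a0: "\<And>i. i < M \<Longrightarrow> a i \<noteq> 0"
    and ef: "\<And>i. i < M \<Longrightarrow> eig (lam i) (f i) (D i) (fv i)" and nz: "\<And>i. i < M \<Longrightarrow> nonzero (f i)"
    and lam_mono: "\<And>i j. i < j \<Longrightarrow> j < M \<Longrightarrow> lam i < lam j"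
    and c_lam: "\<And>i. i < M \<Longrightarrow> 0 < lam i + c" and c_W: "\<And>e t. e \<in> E \<Longrightarrow> t \<in> {0..l e} \<Longrightarrow> 0 < W e t + c"
begin

definition lc :: "(nat \<Rightarrow> real) \<Rightarrow> (nat \<Rightarrow> 'b \<Rightarrow> real \<Rightarrow> real) \<Rightarrow> 'b \<Rightarrow> real \<Rightarrow> real" where
  "lc w X e t = (\<Sum>i<M. w i * X i e t)"

definition vc :: "(nat \<Rightarrow> real) \<Rightarrow> 'a \<Rightarrow> real" where
  "vc w v = (\<Sum>i<M. w i * fv i v)"

text \<open>The time \<open>s\<close> is real although the flow advances by steps of 1, because
  zeros of vertex values are located at intermediate times. Negative \<open>s\<close> runs the flow
  backwards.\<close>

definition wt :: "real \<Rightarrow> nat \<Rightarrow> real" where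
  "wt s i = a i * (lam i + c) powr (- s)"

lemma vertex_cont_lc: "vertex_cont (vc w) (lc w f)"
proof -
  have *: "vertex_cont (fv i) (f i)" if "i < M" for i using ef[OF that] unfolding eig_def by blast
  show ?thesis
    unfolding vertex_cont_def
  proof (intro conjI ballI)
    fix e assume e: "e \<in> E"
    show "lc w f e 0 = vc w (src e)" "lc w f e (l e) = vc w (tgt e)"
      unfolding lc_def vc_def using * e unfolding vertex_cont_def by (auto intro!: sum.cong)
  next
    fix v assume "v \<in> Vb"
    then show "vc w v = 0"
      unfolding vc_def using * unfolding vertex_cont_def by (auto intro!: sum.neutral)
  qed
qed

lemma kirchhoff_lc: "kirchhoff (lc w D)"
proof -
  have 1: "(\<Sum>e\<in>A. \<Sum>i<M. w i * X i e) = (\<Sum>i<M. w i * (\<Sum>e\<in>A. X i e))" for A and X :: "nat \<Rightarrow> 'b \<Rightarrow> real"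
    by (subst sum.swap) (simp add: sum_distrib_left)
  have "hsum v (\<lambda>e. lc w D e 0) (\<lambda>e. - lc w D e (l e)) = (\<Sum>i<M. w i * hsum v (\<lambda>e. D i e 0) (\<lambda>e. - D i e (l e)))" for v
    unfolding lc_def by (simp add: 1 distrib_left right_diff_distrib sum.distrib sum_negf sum_subtractf)
  then show ?thesis using ef unfolding eig_def kirchhoff_def by simp
qed

lemma lc_derivative:
  assumes "e \<in> E" "t \<in> {0..l e}"
  shows "(lc w f e has_real_derivative lc w D e t) (at t within {0..l e})"
  unfolding lc_def by (intro DERIV_sum DERIV_cmult eigD(1)[OF ef assms]) auto

text \<open>\<open>H + c\<close> multiplies \<open>f i\<close> by \<open>lam i + c\<close>, which
  lowers the time in its weight by 1: \<open>wt (s + 1) i * (lam i + c) = wt s i\<close>.\<close>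

lemma flow_step:
  assumes e: "e \<in> E"
  shows "edge_eq (l e) (\<lambda>t. W e t + c) (lc (wt (s + 1)) f e) (lc (wt (s + 1)) D e) (lc (wt s) f e)"
  unfolding edge_eq_def
proof (intro conjI ballI)
  show "0 < l e" by (rule graphD(6)[OF e])
  show "continuous_on {0..l e} (lc (wt s) f e)"
    by (rule derivative_Icc_continuous) (rule lc_derivative[OF e])
  fix t assume t: "t \<in> {0..l e}"
  show "0 < W e t + c" by (rule c_W[OF e t])
  show "(lc (wt (s + 1)) f e has_real_derivative lc (wt (s + 1)) D e t) (at t within {0..l e})"
    by (rule lc_derivative[OF e t])
  have "(lc (wt (s + 1)) D e has_real_derivative (\<Sum>i<M. wt (s + 1) i * ((W e t - lam i) * f i e t))) (at t within {0..l e})"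
    unfolding lc_def by (intro DERIV_sum DERIV_cmult eigD(2)[OF ef e t]) auto
  moreover have "(\<Sum>i<M. wt (s + 1) i * ((W e t - lam i) * f i e t)) = (W e t + c) * lc (wt (s + 1)) f e t - lc (wt s) f e t"
  proof -
    have "wt (s + 1) i * (lam i + c) = wt s i" if "i < M" for i
    proof -
      have "(lam i + c) powr (- s) = (lam i + c) powr (- (s + 1)) * (lam i + c) powr 1"
        by (subst powr_add[symmetric]) simp
      then show ?thesis using c_lam[OF that] by (simp add: wt_def)
    qed
    then have "wt (s + 1) i * ((W e t - lam i) * f i e t) = (W e t + c) * (wt (s + 1) i * f i e t) - wt s i * f i e t" if "i < M" for i
    proof -
      have "wt (s + 1) i * ((W e t - lam i) * f i e t) = (W e t + c) * (wt (s + 1) i * f i e t) - (wt (s + 1) i * (lam i + c)) * f i e t"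
        by (simp add: algebra_simps)
      then show ?thesis using \<open>\<And>i. i < M \<Longrightarrow> wt (s + 1) i * (lam i + c) = wt s i\<close>[OF that] by simp
    qed
    then show ?thesis unfolding lc_def by (simp add: sum_distrib_left sum_subtractf)
  qed
  ultimately show "(lc (wt (s + 1)) D e has_real_derivative (W e t + c) * lc (wt (s + 1)) f e t - lc (wt s) f e t) (at t within {0..l e})"
    by simp
qed

text \<open>As a function of time the vertex value is an exponential sum. Genericity keeps its
  coefficients \<open>a i * fv i v\<close> nonzero, and distinct eigenvalues give distinct exponents
  \<open>- ln (lam i + c)\<close>.\<close>

lemma vertex_zeros:
  assumes v: "v \<in> Vi"
  shows "finite {\<tau>. vc (wt \<tau>) v = 0}" "card {\<tau>. vc (wt \<tau>) v = 0} + 1 \<le> M"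
proof -
  have eq: "vc (wt \<tau>) v = (\<Sum>i<M. (a i * fv i v) * exp (- ln (lam i + c) * \<tau>))" for \<tau>

  proof -
    have "(lam i + c) powr - \<tau> = exp (- ln (lam i + c) * \<tau>)" if "i < M" for i
      using c_lam[OF that] by (simp add: powr_def mult.commute)
    then show ?thesis unfolding vc_def wt_def by (intro sum.cong) auto
  qed
  have "inj_on (\<lambda>i. - ln (lam i + c)) {..<M}"
  proof (rule inj_onI)
    fix i j assume ij: "i \<in> {..<M}" "j \<in> {..<M}" "- ln (lam i + c) = - ln (lam j + c)"
    then have "lam i = lam j" using c_lam[of i] c_lam[of j] by simp
    then show "i = j" using lam_mono[of i j] lam_mono[of j i] ij by (metis lessThan_iff less_irrefl linorder_less_linear)
  qed
  moreover have "a i * fv i v \<noteq> 0" if "i \<in> {..<M}" for i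
    using a0[of i] generic_vertex[OF ef nz v, of i] that by auto
  moreover have "{..<M} \<noteq> {}" using M1 by (auto simp: lessThan_empty_iff)
  ultimately have "finite {s. (\<Sum>i<M. (a i * fv i v) * exp (- ln (lam i + c) * s)) = 0} \<and>
      card {s. (\<Sum>i<M. (a i * fv i v) * exp (- ln (lam i + c) * s)) = 0} + 1 \<le> card {..<M}"
    by (intro exp_sum_zeros) auto
  then show "finite {\<tau>. vc (wt \<tau>) v = 0}" "card {\<tau>. vc (wt \<tau>) v = 0} + 1 \<le> M"
    unfolding eq by simp_all
qed

text \<open>A bad vertex of a step forces a zero of its value in the half-open time interval of that step,
  so that zeros at different steps are different.\<close>

lemma flow_zero_count:
  assumes fin: "finite (zero_edge_points E l (lc (wt s) f))"
  shows "finite (zero_edge_points E l (lc (wt (s + real n)) f)) \<and>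
    zero_count (vc (wt (s + real n))) (lc (wt (s + real n)) f) \<le> zero_count (vc (wt s)) (lc (wt s) f) +
      (\<Sum>v\<in>Vi. (int (dg v) - 2) * int (card {\<tau>. s \<le> \<tau> \<and> \<tau> < s + real n \<and> vc (wt \<tau>) v = 0}))"
proof (induction n)
  case 0
  have "card {\<tau>. s \<le> \<tau> \<and> \<tau> < s \<and> vc (wt \<tau>) v = 0} = 0" for v by (rule card_eq_0_iff[THEN iffD2]) auto
  then show ?case using fin by simp
next
  case (Suc n)
  define s' where "s' = s + real n"
  have s1: "s + real (Suc n) = s' + 1" by (simp add: s'_def)
  have f': "finite (zero_edge_points E l (lc (wt s') f))" using Suc unfolding s'_def by auto
  define bad where "bad = {v\<in>Vi. vc (wt s') v = 0 \<or> vc (wt (s' + 1)) v * vc (wt s') v < 0}"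
  note src = zero_count_source[OF flow_step vertex_cont_lc kirchhoff_lc vertex_cont_lc f', folded bad_def]
  define N where "N A v = {\<tau>. \<tau> \<in> A \<and> vc (wt \<tau>) v = 0}" for A v
  have Nf: "finite (N A v)" if "v \<in> Vi" for A v
    unfolding N_def by (rule finite_subset[OF _ vertex_zeros(1)[OF that]]) auto
  have b: "N {s'..<s'+1} v \<noteq> {}" if v: "v \<in> bad" for v
  proof (cases "vc (wt s') v = 0")
    case True
    then show ?thesis unfolding N_def by force
  next
    case False
    then have neg: "vc (wt (s' + 1)) v * vc (wt s') v < 0" using v bad_def by auto
    have cont: "continuous_on {s'..s'+1} (\<lambda>\<tau>. vc (wt \<tau>) v)"
    proof -
      have "lam i + c \<noteq> 0" if "i \<in> {..<M}" for i using c_lam[of i] that by auto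
      then show ?thesis unfolding vc_def wt_def by (intro continuous_intros) auto
    qed
    show ?thesis
    proof (rule ccontr)
      assume "\<not> ?thesis"
      then have no: "\<And>t. s' < t \<Longrightarrow> t < s' + 1 \<Longrightarrow> vc (wt t) v \<noteq> 0" unfolding N_def by auto
      have "vc (wt (s' + 1)) v \<noteq> 0" using neg by auto
      then have "vc (wt (s' + 1/2)) v * vc (wt s') v > 0" "vc (wt (s' + 1/2)) v * vc (wt (s' + 1)) v > 0"
        using continuous_nonzero_same_sign[OF cont no, of "s' + 1/2" s'] continuous_nonzero_same_sign[OF cont no, of "s' + 1/2" "s' + 1"] False by auto
      then show False using neg by (auto simp: zero_less_mult_iff mult_less_0_iff)
    qed
  qed
  have "(\<Sum>v\<in>bad. int (dg v) - 2) = (\<Sum>v\<in>Vi. (int (dg v) - 2) * (if v \<in> bad then 1 else 0))"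
    unfolding bad_def by (simp add: sum.inter_filter[OF finite_Vi] if_distrib cong: if_cong)
  also have "\<dots> \<le> (\<Sum>v\<in>Vi. (int (dg v) - 2) * int (card (N {s'..<s'+1} v)))"
  proof (rule sum_mono, rule mult_left_mono)
    fix v assume v: "v \<in> Vi"
    show "0 \<le> int (dg v) - 2" using v by (simp add: inner_vertices_def)
    show "(if v \<in> bad then 1 else 0) \<le> int (card (N {s'..<s'+1} v))"
      using b[of v] Nf[OF v, of "{s'..<s'+1}"] by (auto simp: Suc_le_eq card_gt_0_iff)
  qed
  finally have 1: "(\<Sum>v\<in>bad. int (dg v) - 2) \<le> (\<Sum>v\<in>Vi. (int (dg v) - 2) * int (card (N {s'..<s'+1} v)))" .
  have 2: "int (card (N {s..<s'+1} v)) = int (card (N {s..<s'} v)) + int (card (N {s'..<s'+1} v))" if "v \<in> Vi" for v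
  proof -
    have "N {s..<s'+1} v = N {s..<s'} v \<union> N {s'..<s'+1} v" unfolding N_def s'_def by auto
    moreover have "N {s..<s'} v \<inter> N {s'..<s'+1} v = {}" unfolding N_def by auto
    ultimately show ?thesis using Nf[OF that] by (simp add: card_Un_disjoint)
  qed
  have 3: "(\<Sum>v\<in>Vi. (int (dg v) - 2) * int (card (N {s..<s'+1} v))) =
     (\<Sum>v\<in>Vi. (int (dg v) - 2) * int (card (N {s..<s'} v))) + (\<Sum>v\<in>Vi. (int (dg v) - 2) * int (card (N {s'..<s'+1} v)))"
    unfolding sum.distrib[symmetric] by (rule sum.cong) (simp_all only: 2 distrib_left)
  have N': "{\<tau>. s \<le> \<tau> \<and> \<tau> < x \<and> vc (wt \<tau>) v = 0} = N {s..<x} v" for x v unfolding N_def by auto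
  show ?case unfolding s1 N' using Suc[folded s'_def, unfolded N'] src 1 3 by linarith
qed

text \<open>A vertex value has at most \<open>M - 1\<close> zeros over all time, so the loss is
  bounded independently of the number \<open>n\<close> of steps, which can then be chosen as large
  as desired.\<close>

lemma flow_bound:
  assumes fin: "finite (zero_edge_points E l (lc (wt s) f))"
  shows "finite (zero_edge_points E l (lc (wt (s + real n)) f))"
    "zero_count (vc (wt (s + real n))) (lc (wt (s + real n)) f) \<le> zero_count (vc (wt s)) (lc (wt s) f) +
      (int M - 1) * (\<Sum>v\<in>Vi. int (dg v) - 2)"
proof -
  have "(\<Sum>v\<in>Vi. (int (dg v) - 2) * int (card {\<tau>. s \<le> \<tau> \<and> \<tau> < s + real n \<and> vc (wt \<tau>) v = 0})) \<le> (\<Sum>v\<in>Vi. (int (dg v) - 2) * (int M - 1))"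
  proof (rule sum_mono, rule mult_left_mono)
    fix v assume v: "v \<in> Vi"
    show "0 \<le> int (dg v) - 2" using v by (simp add: inner_vertices_def)
    have "card {\<tau>. s \<le> \<tau> \<and> \<tau> < s + real n \<and> vc (wt \<tau>) v = 0} \<le> card {\<tau>. vc (wt \<tau>) v = 0}"
      by (rule card_mono[OF vertex_zeros(1)[OF v]]) auto
    then show "int (card {\<tau>. s \<le> \<tau> \<and> \<tau> < s + real n \<and> vc (wt \<tau>) v = 0}) \<le> int M - 1"
      using vertex_zeros(2)[OF v] by linarith
  qed
  also have "\<dots> = (int M - 1) * (\<Sum>v\<in>Vi. int (dg v) - 2)" by (simp add: sum_distrib_left mult.commute)
  finally show "finite (zero_edge_points E l (lc (wt (s + real n)) f))"
    "zero_count (vc (wt (s + real n))) (lc (wt (s + real n)) f) \<le> zero_count (vc (wt s)) (lc (wt s) f) +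
      (int M - 1) * (\<Sum>v\<in>Vi. int (dg v) - 2)"
    using flow_zero_count[OF fin, of n] by auto
qed

lemma zero_count_lc_scale:
  assumes "k \<noteq> 0" "\<And>i. i < M \<Longrightarrow> w i = k * u i"
  shows "zero_edge_points E l (lc w f) = zero_edge_points E l (lc u f)"
    "zero_count (vc w) (lc w f) = zero_count (vc u) (lc u f)"
proof -
  have 1: "lc w f e t = k * lc u f e t" for e t
    unfolding lc_def sum_distrib_left using assms(2) by (intro sum.cong) auto
  have 2: "vc w v = k * vc u v" for v
    unfolding vc_def sum_distrib_left using assms(2) by (intro sum.cong) auto
  show 3: "zero_edge_points E l (lc w f) = zero_edge_points E l (lc u f)"
    unfolding zero_edge_points_def 1 using assms(1) by simp
  show "zero_count (vc w) (lc w f) = zero_count (vc u) (lc u f)"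
    unfolding zero_count_def 3 2 using assms(1) by simp
qed

section \<open>Stability of the zero count when one eigenfunction dominates\<close>

context
  fixes u :: "nat \<Rightarrow> nat \<Rightarrow> real" and top :: nat
  assumes top: "top < M" and u: "\<And>i. i < M \<Longrightarrow> (\<lambda>n. u n i) \<longlonglongrightarrow> (if i = top then 1 else 0)"
begin

lemma sum_top: "(\<Sum>i<M. (if i = top then 1 else 0) * x i) = (x top :: real)"
  using top by (simp add: if_distrib if_distribR cong: if_cong)

lemma lc_uniform_limit:
  assumes "e \<in> E" "\<And>i. i < M \<Longrightarrow> continuous_on {0..l e} (X i e)"
  shows "uniform_limit {0..l e} (\<lambda>n. lc (u n) X e) (X top e) sequentially"
proof -
  have "uniform_limit {0..l e} (\<lambda>n t. \<Sum>i<M. u n i * X i e t) (\<lambda>t. \<Sum>i<M. (if i = top then 1 else 0) * X i e t) sequentially"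
    by (rule uniform_limit_combination) (use u assms in auto)
  then show ?thesis unfolding sum_top lc_def .
qed

lemma vc_lim: "(\<lambda>n. vc (u n) v) \<longlonglongrightarrow> fv top v"
proof -
  have "(\<lambda>n. vc (u n) v) \<longlonglongrightarrow> (\<Sum>i<M. (if i = top then 1 else 0) * fv i v)"
    unfolding vc_def by (intro tendsto_sum tendsto_mult tendsto_const u) auto
  then show ?thesis unfolding sum_top .
qed

text \<open>At a boundary vertex both values are 0, and at an inner vertex the limit is nonzero by
  genericity. This supplies the end point condition of
  \<open>eventually_card_zeros_le\<close>.\<close>

lemma eventually_vc_zero: "\<forall>\<^sub>F n in sequentially. \<forall>v\<in>V. vc (u n) v = 0 \<longleftrightarrow> fv top v = 0"
proof (subst eventually_ball_finite_distrib[OF graphD(1)], rule ballI)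
  fix v assume v: "v \<in> V"
  show "\<forall>\<^sub>F n in sequentially. vc (u n) v = 0 \<longleftrightarrow> fv top v = 0"
  proof (cases "v \<in> Vb")
    case True
    then have "vc (u n) v = 0" "fv top v = 0" for n
      using vertex_cont_lc[of "u n"] ef[OF top] unfolding vertex_cont_def eig_def by auto
    then show ?thesis by simp
  next
    case False
    then have "v \<in> Vi" using v V_split by auto
    then have "fv top v \<noteq> 0" using generic_vertex[OF ef[OF top] nz[OF top]] by auto
    then show ?thesis using tendsto_imp_eventually_ne[OF vc_lim] by auto
  qed
qed

lemma eventually_zero_count_le:
  "\<forall>\<^sub>F n in sequentially. finite (zero_edge_points E l (lc (u n) f)) \<and>
     zero_count (vc (u n)) (lc (u n) f) \<le> int (card (zero_edge_points E l (f top)))"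
proof -
  have "\<forall>\<^sub>F n in sequentially. \<forall>e\<in>E. finite (zeros_on (lc (u n) f) e) \<and>
     card (zeros_on (lc (u n) f) e) \<le> card (zeros_on (f top) e)"
  proof (subst eventually_ball_finite_distrib[OF graphD(2)], rule ballI)
    fix e assume e: "e \<in> E"
    have c: "continuous_on {0..l e} (f i e)" "continuous_on {0..l e} (D i e)" if "i < M" for i
      using eigD[OF ef[OF that] e] by auto
    show "\<forall>\<^sub>F n in sequentially. finite (zeros_on (lc (u n) f) e) \<and>
     card (zeros_on (lc (u n) f) e) \<le> card (zeros_on (f top) e)"
      unfolding zeros_on_def
    proof (rule eventually_card_zeros_le[OF eig_simple_zeros[OF ef[OF top] nz[OF top] e] lc_derivative[OF e]
          lc_uniform_limit[OF e] lc_uniform_limit[OF e]])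
      show "\<forall>\<^sub>F n in sequentially. \<forall>t\<in>{0, l e}. lc (u n) f e t = 0 \<longleftrightarrow> f top e t = 0"
        using eventually_vc_zero
      proof eventually_elim
        case (elim n)
        have "lc (u n) f e 0 = vc (u n) (src e)" "lc (u n) f e (l e) = vc (u n) (tgt e)"
          using vertex_cont_lc[of "u n"] e unfolding vertex_cont_def by auto
        then show ?case using elim eigD(3,4)[OF ef[OF top] e] graphD(4,5)[OF e] by auto
      qed
    qed (use c in auto)
  qed
  then show ?thesis using eventually_vc_zero
  proof eventually_elim
    case (elim n)
    have ne: "{v\<in>Vi. vc (u n) v = 0} = {}"
      using elim(2) generic_vertex[OF ef[OF top] nz[OF top]] V_split by blast
    have fin: "finite (zeros_on (f top) e)" if "e \<in> E" for e
      using simple_zeros_finite[OF eig_simple_zeros[OF ef[OF top] nz[OF top] that]] unfolding zeros_on_def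
      by (rule finite_subset[rotated]) auto
    have "card (zero_edge_points E l (lc (u n) f)) \<le> card (zero_edge_points E l (f top))"
      using elim(1) fin by (subst (1 2) card_zero_edge_points) (auto intro!: sum_mono)
    then show ?case using elim(1) unfolding zero_count_def finite_zero_edge_points ne by simp
  qed
qed

lemma eventually_zero_count_ge:
  assumes fin: "\<And>n. finite (zero_edge_points E l (lc (u n) f))"
  shows "\<forall>\<^sub>F n in sequentially. int (card (zero_edge_points E l (f top))) \<le> zero_count (vc (u n)) (lc (u n) f)"
proof -
  have fe: "finite (zeros_on (lc (u n) f) e)" if "e \<in> E" for e n
    using fin[of n] that unfolding finite_zero_edge_points by auto
  have "\<forall>\<^sub>F n in sequentially. \<forall>e\<in>E. card (zeros_on (f top) e) \<le> card (zeros_on (lc (u n) f) e)"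
  proof (subst eventually_ball_finite_distrib[OF graphD(2)], rule ballI)
    fix e assume e: "e \<in> E"
    show "\<forall>\<^sub>F n in sequentially. card (zeros_on (f top) e) \<le> card (zeros_on (lc (u n) f) e)"
      unfolding zeros_on_def
    proof (rule eventually_card_zeros_ge[OF eig_simple_zeros[OF ef[OF top] nz[OF top] e]])
      show "continuous_on {0..l e} (lc (u n) f e)" for n
        by (rule derivative_Icc_continuous) (rule lc_derivative[OF e])
      show "finite {t. 0 < t \<and> t < l e \<and> lc (u n) f e t = 0}" for n using fe[OF e, of n] unfolding zeros_on_def .
      show "(\<lambda>n. lc (u n) f e t) \<longlonglongrightarrow> f top e t" if "t \<in> {0..l e}" for t
        using tendsto_uniform_limitI[OF lc_uniform_limit[OF e] that] eigD(5)[OF ef e] by auto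
    qed
  qed
  then show ?thesis
  proof eventually_elim
    case (elim n)
    have fin: "finite (zeros_on (f top) e)" if "e \<in> E" for e
      using simple_zeros_finite[OF eig_simple_zeros[OF ef[OF top] nz[OF top] that]] unfolding zeros_on_def
      by (rule finite_subset[rotated]) auto
    have "card (zero_edge_points E l (f top)) \<le> card (zero_edge_points E l (lc (u n) f))"
      using elim fin fe by (subst (1 2) card_zero_edge_points) (auto intro!: sum_mono)
    then show ?case unfolding zero_count_def by auto
  qed
qed

end

lemma ratio_limit:
  assumes "0 < p" "0 < q" "i \<noteq> j \<Longrightarrow> p < q" "i = j \<Longrightarrow> p = q" "i = j \<Longrightarrow> b = 1"
  shows "(\<lambda>n. b * (p / q) ^ n) \<longlonglongrightarrow> (if i = j then 1 else 0 :: real)"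
proof (cases "i = j")
  case False
  then have "(\<lambda>n. (p / q) ^ n) \<longlonglongrightarrow> 0" using assms by (intro LIMSEQ_power_zero) auto
  then show ?thesis using tendsto_mult[OF tendsto_const[of b]] False by fastforce
qed (use assms in auto)

text \<open>The upper bound follows the flow from time \<open>- n\<close> to 0, starting close to
  the highest eigenfunction; the lower bound follows it from 0 to a large time, ending close to the
  lowest. Dividing by the dominant weight changes no zeros and gives the convergent weights
  \<open>u\<close> and \<open>w\<close>.\<close>

theorem zero_count_combination:
  "finite (zero_edge_points E l (lc a f))"
  "zero_count (vc a) (lc a f) \<le> int (card (zero_edge_points E l (f (M - 1)))) + (int M - 1) * (\<Sum>v\<in>Vi. int (dg v) - 2)"
  "int (card (zero_edge_points E l (f 0))) \<le> zero_count (vc a) (lc a f) + (int M - 1) * (\<Sum>v\<in>Vi. int (dg v) - 2)"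
proof -
  have wt0: "lc (wt 0) f = lc a f" "vc (wt 0) = vc a"
    unfolding lc_def vc_def wt_def using c_lam by (force intro!: ext sum.cong)+
  define r where "r i = lam i + c" for i
  have r: "r i > 0" if "i < M" for i using c_lam[OF that] by (simp add: r_def)
  have rmono: "r i < r j" if "i < j" "j < M" for i j using lam_mono[OF that] by (simp add: r_def)
  let ?t = "M - 1"
  have t: "?t < M" using M1 by simp
  define u where "u n i = (a i / a ?t) * (r i / r ?t) ^ n" for n i
  have ulim: "(\<lambda>n. u n i) \<longlonglongrightarrow> (if i = ?t then 1 else 0)" if "i < M" for i
    unfolding u_def by (rule ratio_limit) (use that t r rmono[of i ?t] a0 in auto)
  obtain n where n: "finite (zero_edge_points E l (lc (u n) f))"
    "zero_count (vc (u n)) (lc (u n) f) \<le> int (card (zero_edge_points E l (f ?t)))"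
    using eventually_happens[OF eventually_zero_count_le[OF t ulim]] by auto
  have sc: "wt (- real n) i = (a ?t * r ?t ^ n) * u n i" if "i < M" for i
    using r[OF that] r[OF t] a0[OF t] unfolding wt_def u_def r_def[symmetric]
    by (simp add: powr_realpow power_divide)
  have k: "a ?t * r ?t ^ n \<noteq> 0" using a0[OF t] r[OF t] by simp
  have z: "zero_edge_points E l (lc (wt (- real n)) f) = zero_edge_points E l (lc (u n) f)"
    "zero_count (vc (wt (- real n))) (lc (wt (- real n)) f) = zero_count (vc (u n)) (lc (u n) f)"
    using zero_count_lc_scale[of _ "wt (- real n)" "u n", OF k] sc by blast+
  note fb = flow_bound[of "- real n" n, unfolded add.left_inverse z, OF n(1)]
  show fin: "finite (zero_edge_points E l (lc a f))" using fb(1) by (simp add: wt0)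
  show "zero_count (vc a) (lc a f) \<le> int (card (zero_edge_points E l (f (M - 1)))) + (int M - 1) * (\<Sum>v\<in>Vi. int (dg v) - 2)"
    using fb(2) n(2) by (simp add: wt0)
  define w where "w n i = (a i / a 0) * (r 0 / r i) ^ n" for n i
  have z0: "0 < M" using M1 by simp
  have wlim: "(\<lambda>n. w n i) \<longlonglongrightarrow> (if i = 0 then 1 else 0)" if "i < M" for i
    unfolding w_def by (rule ratio_limit) (use that z0 r rmono[of 0 i] a0 in auto)
  have sc': "wt (real n) i = (a 0 * (1 / r 0 ^ n)) * w n i" if "i < M" for i n
    using r[OF that] r[OF z0] a0[OF z0] unfolding wt_def w_def r_def[symmetric]
    by (simp add: powr_minus powr_realpow power_divide divide_simps)
  have k': "a 0 * (1 / r 0 ^ n) \<noteq> 0" for n using a0[OF z0] r[OF z0] by simp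
  have z': "zero_edge_points E l (lc (wt (real n)) f) = zero_edge_points E l (lc (w n) f)"
    "zero_count (vc (wt (real n))) (lc (wt (real n)) f) = zero_count (vc (w n)) (lc (w n) f)" for n
    using zero_count_lc_scale[of _ "wt (real n)" "w n", OF k'] sc' by blast+
  note fb' = flow_bound[of 0, unfolded wt0, OF fin, simplified]
  obtain m where m: "int (card (zero_edge_points E l (f 0))) \<le> zero_count (vc (w m)) (lc (w m) f)"
    using eventually_happens[OF eventually_zero_count_ge[OF z0 wlim]] fb'(1) z' by auto
  show "int (card (zero_edge_points E l (f 0))) \<le> zero_count (vc a) (lc a f) + (int M - 1) * (\<Sum>v\<in>Vi. int (dg v) - 2)"
    using m fb'(2)[of m] z'(2)[of m] by simp
qed

end

subsection \<open>The quadratic form\<close>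

text \<open>A class closed under products and finite linear combinations, with all members
  integrable, and wide enough for derivatives that jump at finitely many points.\<close>

definition bounded_meas :: "real \<Rightarrow> (real \<Rightarrow> real) \<Rightarrow> bool" where
  "bounded_meas l \<psi> \<longleftrightarrow> \<psi> \<in> borel_measurable (lebesgue_on {0..l}) \<and> (\<exists>B. \<forall>t\<in>{0..l}. \<bar>\<psi> t\<bar> \<le> B)"

lemma bounded_meas_continuous:
  assumes "continuous_on {0..l} f"
  shows "bounded_meas l f"
proof -
  have "bounded (f ` {0..l})" by (intro compact_imp_bounded compact_continuous_image assms) auto
  then obtain B where "\<forall>x\<in>f ` {0..l}. norm x \<le> B" unfolding bounded_iff by blast
  then show ?thesis unfolding bounded_meas_def
    using continuous_imp_measurable_on_sets_lebesgue[OF assms] by auto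
qed

lemma bounded_meas_mult:
  assumes "bounded_meas l f" "bounded_meas l g"
  shows "bounded_meas l (\<lambda>t. f t * g t)"
proof -
  obtain A B where AB: "\<And>t. t \<in> {0..l} \<Longrightarrow> \<bar>f t\<bar> \<le> A" "\<And>t. t \<in> {0..l} \<Longrightarrow> \<bar>g t\<bar> \<le> B"
    using assms unfolding bounded_meas_def by metis
  have "\<bar>f t * g t\<bar> \<le> \<bar>A\<bar> * \<bar>B\<bar>" if "t \<in> {0..l}" for t
    unfolding abs_mult using AB[OF that] by (intro mult_mono) auto
  then have "\<exists>B. \<forall>t\<in>{0..l}. \<bar>f t * g t\<bar> \<le> B" by blast
  moreover have "(\<lambda>t. f t * g t) \<in> borel_measurable (lebesgue_on {0..l})"
    using assms unfolding bounded_meas_def by (intro borel_measurable_times) auto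
  ultimately show ?thesis unfolding bounded_meas_def by blast
qed

lemma bounded_meas_sum:
  assumes "finite I" "\<And>i. i \<in> I \<Longrightarrow> bounded_meas l (f i)"
  shows "bounded_meas l (\<lambda>t. \<Sum>i\<in>I. c i * f i t)"
proof -
  obtain B where B: "\<And>i t. i \<in> I \<Longrightarrow> t \<in> {0..l} \<Longrightarrow> \<bar>f i t\<bar> \<le> B i"
    using assms(2) unfolding bounded_meas_def by metis
  have "\<bar>\<Sum>i\<in>I. c i * f i t\<bar> \<le> (\<Sum>i\<in>I. \<bar>c i\<bar> * B i)" if "t \<in> {0..l}" for t
    by (rule order_trans[OF sum_abs]) (auto intro!: sum_mono mult_left_mono B that simp: abs_mult)
  then have "\<exists>B. \<forall>t\<in>{0..l}. \<bar>\<Sum>i\<in>I. c i * f i t\<bar> \<le> B" by blast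
  moreover have "(\<lambda>t. \<Sum>i\<in>I. c i * f i t) \<in> borel_measurable (lebesgue_on {0..l})"
    using assms unfolding bounded_meas_def by (intro borel_measurable_sum borel_measurable_times) auto
  ultimately show ?thesis unfolding bounded_meas_def by blast
qed

lemma bounded_meas_integrable:
  assumes "bounded_meas l f"
  shows "f integrable_on {0..l}"
proof -
  obtain B where B: "\<And>t. t \<in> {0..l} \<Longrightarrow> \<bar>f t\<bar> \<le> B" using assms unfolding bounded_meas_def by metis
  show ?thesis
    by (rule measurable_bounded_by_integrable_imp_integrable_real[of f "{0..l}" "\<lambda>_. B"])
      (use assms B in \<open>auto simp: bounded_meas_def\<close>)
qed

text \<open>Gaussian elimination: an equation with a nonzero coefficient at \<open>k\<close> is
  solved for \<open>x k\<close> and substituted into the others.\<close>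

lemma homogeneous_system_nontrivial:
  fixes A :: "'j \<Rightarrow> 'i \<Rightarrow> real"
  assumes "finite J" "finite I" "card J < card I"
  shows "\<exists>x. (\<exists>i\<in>I. x i \<noteq> 0) \<and> (\<forall>j\<in>J. (\<Sum>i\<in>I. A j i * x i) = 0)"
  using assms
proof (induction J arbitrary: I A rule: finite_induct)
  case empty
  then have "I \<noteq> {}" by auto
  then show ?case by (intro exI[of _ "\<lambda>_. 1"]) auto
next
  case (insert j J)
  show ?case
  proof (cases "\<exists>k\<in>I. A j k \<noteq> 0")
    case False
    obtain x where "\<exists>i\<in>I. x i \<noteq> 0" "\<forall>j\<in>J. (\<Sum>i\<in>I. A j i * x i) = 0"
      using insert.IH[of I A] insert.prems insert.hyps by auto
    then show ?thesis using False by (intro exI[of _ x]) auto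
  next
    case True
    then obtain k where k: "k \<in> I" "A j k \<noteq> 0" by auto
    define B where "B j' i = A j' i - A j' k * A j i / A j k" for j' i
    have "card J < card (I - {k})" using insert k by (simp add: card_Diff_singleton)
    then obtain y where y: "\<exists>i\<in>I - {k}. y i \<noteq> 0" "\<And>j'. j' \<in> J \<Longrightarrow> (\<Sum>i\<in>I - {k}. B j' i * y i) = 0"
      using insert.IH[of "I - {k}" B] insert.prems by auto
    define x where "x i = (if i = k then - (\<Sum>i\<in>I - {k}. A j i * y i) / A j k else y i)" for i
    have sp: "(\<Sum>i\<in>I. A j' i * x i) = A j' k * x k + (\<Sum>i\<in>I - {k}. A j' i * y i)" for j'
      using insert.prems k by (subst sum.remove[of I k]) (auto simp: x_def intro!: sum.cong)
    have "(\<Sum>i\<in>I. A j i * x i) = 0" unfolding sp using k by (simp add: x_def)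
    moreover have "(\<Sum>i\<in>I. A j' i * x i) = 0" if "j' \<in> J" for j'
    proof -
      have "(\<Sum>i\<in>I - {k}. B j' i * y i) = (\<Sum>i\<in>I - {k}. A j' i * y i) - A j' k / A j k * (\<Sum>i\<in>I - {k}. A j i * y i)"
        unfolding B_def sum_distrib_left sum_subtractf[symmetric] by (rule sum.cong) (auto simp: algebra_simps)
      then show ?thesis unfolding sp using y(2)[OF that] k by (simp add: x_def)
    qed
    ultimately show ?thesis using y(1) by (intro exI[of _ x]) (auto simp: x_def)
  qed
qed

context schroedinger_graph
begin

text \<open>The form domain admits finitely many corners on each edge, so that eigenfunctions
  multiplied by a factor jumping at their zeros belong to it. The derivative \<open>\<psi>\<close>
  is carried along because \<open>\<phi>\<close> fixes it only off a finite set.\<close>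

definition form :: "('e \<Rightarrow> real \<Rightarrow> real) \<Rightarrow> ('e \<Rightarrow> real \<Rightarrow> real) \<Rightarrow> ('v \<Rightarrow> real) \<Rightarrow> bool" where
  "form \<phi> \<psi> p \<longleftrightarrow> (\<forall>e\<in>E. continuous_on {0..l e} (\<phi> e) \<and> bounded_meas (l e) (\<psi> e) \<and>
      (\<exists>S. finite S \<and> (\<forall>t\<in>{0<..<l e} - S. (\<phi> e has_real_derivative \<psi> e t) (at t)))) \<and> vertex_cont p \<phi>"

definition ip :: "('e \<Rightarrow> real \<Rightarrow> real) \<Rightarrow> ('e \<Rightarrow> real \<Rightarrow> real) \<Rightarrow> real" where
  "ip \<phi> \<eta> = (\<Sum>e\<in>E. integral {0..l e} (\<lambda>t. \<phi> e t * \<eta> e t))"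

text \<open>The bilinear form of \<open>H - mu\<close>, with each function given together with its
  derivative.\<close>

definition qf :: "real \<Rightarrow> ('e \<Rightarrow> real \<Rightarrow> real) \<Rightarrow> ('e \<Rightarrow> real \<Rightarrow> real) \<Rightarrow> ('e \<Rightarrow> real \<Rightarrow> real) \<Rightarrow> ('e \<Rightarrow> real \<Rightarrow> real) \<Rightarrow> real" where
  "qf mu \<phi> \<psi> \<eta> \<theta> = (\<Sum>e\<in>E. integral {0..l e} (\<lambda>t. \<psi> e t * \<theta> e t + (W e t - mu) * (\<phi> e t * \<eta> e t)))"

lemma formD:
  assumes "form \<phi> \<psi> p" "e \<in> E"
  shows "continuous_on {0..l e} (\<phi> e)" "bounded_meas (l e) (\<phi> e)" "bounded_meas (l e) (\<psi> e)"
    "\<phi> e 0 = p (src e)" "\<phi> e (l e) = p (tgt e)"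
    "\<exists>S. finite S \<and> (\<forall>t\<in>{0<..<l e} - S. (\<phi> e has_real_derivative \<psi> e t) (at t))"
proof -
  have *: "continuous_on {0..l e} (\<phi> e)" "bounded_meas (l e) (\<psi> e)"
      "\<exists>S. finite S \<and> (\<forall>t\<in>{0<..<l e} - S. (\<phi> e has_real_derivative \<psi> e t) (at t))"
      "\<phi> e 0 = p (src e)" "\<phi> e (l e) = p (tgt e)"
    using assms unfolding form_def vertex_cont_def by blast+
  then show "continuous_on {0..l e} (\<phi> e)" "bounded_meas (l e) (\<phi> e)" "bounded_meas (l e) (\<psi> e)"
    "\<phi> e 0 = p (src e)" "\<phi> e (l e) = p (tgt e)"
    "\<exists>S. finite S \<and> (\<forall>t\<in>{0<..<l e} - S. (\<phi> e has_real_derivative \<psi> e t) (at t))"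
    using bounded_meas_continuous by blast+
qed

lemma form_eig:
  assumes "eig lam f D fv"
  shows "form f D fv"
proof -
  have "\<exists>S. finite S \<and> (\<forall>t\<in>{0<..<l e} - S. (f e has_real_derivative D e t) (at t))" if e: "e \<in> E" for e
    using derivative_Icc_interior[OF eigD(1)[OF assms e]] by (intro exI[of _ "{}"]) auto
  then show ?thesis unfolding form_def using assms bounded_meas_continuous eigD(5,6)[OF assms] unfolding eig_def by auto
qed

lemma form_sum:
  assumes I: "finite I" and f: "\<And>i. i \<in> I \<Longrightarrow> form (\<phi> i) (\<psi> i) (p i)"
  shows "form (\<lambda>e t. \<Sum>i\<in>I. c i * \<phi> i e t) (\<lambda>e t. \<Sum>i\<in>I. c i * \<psi> i e t) (\<lambda>v. \<Sum>i\<in>I. c i * p i v)"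
  unfolding form_def
proof (intro conjI ballI)
  fix e assume e: "e \<in> E"
  show "continuous_on {0..l e} (\<lambda>t. \<Sum>i\<in>I. c i * \<phi> i e t)"
    using formD(1)[OF f e] by (intro continuous_intros) auto
  show "bounded_meas (l e) (\<lambda>t. \<Sum>i\<in>I. c i * \<psi> i e t)" using formD(3)[OF f e] by (intro bounded_meas_sum I) auto
  obtain S where S: "\<And>i. i \<in> I \<Longrightarrow> finite (S i)" "\<And>i t. i \<in> I \<Longrightarrow> t\<in>{0<..<l e} - S i \<Longrightarrow> (\<phi> i e has_real_derivative \<psi> i e t) (at t)"
    using formD(6)[OF f e] by metis
  have "((\<lambda>t. \<Sum>i\<in>I. c i * \<phi> i e t) has_real_derivative (\<Sum>i\<in>I. c i * \<psi> i e t)) (at t)"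
    if "t \<in> {0<..<l e} - (\<Union>i\<in>I. S i)" for t
    by (intro DERIV_sum DERIV_cmult S(2)) (use that in auto)
  then show "\<exists>S. finite S \<and> (\<forall>t\<in>{0<..<l e} - S. ((\<lambda>t. \<Sum>i\<in>I. c i * \<phi> i e t) has_real_derivative (\<Sum>i\<in>I. c i * \<psi> i e t)) (at t))"
    using S(1) I by (intro exI[of _ "\<Union>i\<in>I. S i"]) auto
next
  have *: "vertex_cont (p i) (\<phi> i)" if "i \<in> I" for i using f[OF that] unfolding form_def by blast
  show "vertex_cont (\<lambda>v. \<Sum>i\<in>I. c i * p i v) (\<lambda>e t. \<Sum>i\<in>I. c i * \<phi> i e t)"
    using * unfolding vertex_cont_def by (auto intro!: sum.neutral sum.cong)
qed

lemma form_add: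
  assumes "form \<phi> \<psi> p" "form \<phi>' \<psi>' p'"
  shows "form (\<lambda>e t. \<phi> e t + c * \<phi>' e t) (\<lambda>e t. \<psi> e t + c * \<psi>' e t) (\<lambda>v. p v + c * p' v)"
proof -
  have "form (\<lambda>e t. \<Sum>i\<in>{True,False}. (if i then 1 else c) * (if i then \<phi> else \<phi>') e t)
      (\<lambda>e t. \<Sum>i\<in>{True,False}. (if i then 1 else c) * (if i then \<psi> else \<psi>') e t)
      (\<lambda>v. \<Sum>i\<in>{True,False}. (if i then 1 else c) * (if i then p else p') v)"
    by (rule form_sum) (use assms in auto)
  then show ?thesis by simp
qed

lemma bounded_meas_W: "e \<in> E \<Longrightarrow> bounded_meas (l e) (\<lambda>t. W e t - mu)"
  by (intro bounded_meas_continuous continuous_intros W_cont)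

lemma form_integrable:
  assumes "form \<phi> \<psi> p" "form \<eta> \<theta> p'" "e \<in> E"
  shows "(\<lambda>t. \<phi> e t * \<eta> e t) integrable_on {0..l e}"
    "(\<lambda>t. \<psi> e t * \<theta> e t) integrable_on {0..l e}"
    "(\<lambda>t. (W e t - mu) * (\<phi> e t * \<eta> e t)) integrable_on {0..l e}"
    "(\<lambda>t. \<psi> e t * \<theta> e t + (W e t - mu) * (\<phi> e t * \<eta> e t)) integrable_on {0..l e}"
proof -
  show 1: "(\<lambda>t. \<phi> e t * \<eta> e t) integrable_on {0..l e}"
    "(\<lambda>t. \<psi> e t * \<theta> e t) integrable_on {0..l e}"
    "(\<lambda>t. (W e t - mu) * (\<phi> e t * \<eta> e t)) integrable_on {0..l e}"
    by (intro bounded_meas_integrable bounded_meas_mult bounded_meas_W assms(3)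
        formD(2,3)[OF assms(1,3)] formD(2,3)[OF assms(2,3)])+
  show "(\<lambda>t. \<psi> e t * \<theta> e t + (W e t - mu) * (\<phi> e t * \<eta> e t)) integrable_on {0..l e}"
    by (intro integrable_add 1)
qed

lemma ip_commute: "ip \<phi> \<eta> = ip \<eta> \<phi>"
  unfolding ip_def by (simp add: mult.commute)

lemma qf_commute: "qf mu \<phi> \<psi> \<eta> \<theta> = qf mu \<eta> \<theta> \<phi> \<psi>"
  unfolding qf_def by (simp add: mult.commute)

lemma ip_sum:
  assumes "finite I" "\<And>i. i \<in> I \<Longrightarrow> form (\<phi> i) (\<psi> i) (p i)" "form \<eta> \<theta> p'"
  shows "ip (\<lambda>e t. \<Sum>i\<in>I. c i * \<phi> i e t) \<eta> = (\<Sum>i\<in>I. c i * ip (\<phi> i) \<eta>)"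
proof -
  have "integral {0..l e} (\<lambda>t. (\<Sum>i\<in>I. c i * \<phi> i e t) * \<eta> e t) = (\<Sum>i\<in>I. c i * integral {0..l e} (\<lambda>t. \<phi> i e t * \<eta> e t))"
    if e: "e \<in> E" for e
  proof -
    have "integral {0..l e} (\<lambda>t. \<Sum>i\<in>I. c i * (\<phi> i e t * \<eta> e t)) = (\<Sum>i\<in>I. integral {0..l e} (\<lambda>t. c i * (\<phi> i e t * \<eta> e t)))"
      using assms form_integrable(1)[OF assms(2) assms(3) e] by (intro integral_sum) (auto intro!: integrable_on_mult_right)
    then show ?thesis by (simp add: sum_distrib_right mult.assoc)
  qed
  then have "ip (\<lambda>e t. \<Sum>i\<in>I. c i * \<phi> i e t) \<eta> = (\<Sum>e\<in>E. \<Sum>i\<in>I. c i * integral {0..l e} (\<lambda>t. \<phi> i e t * \<eta> e t))"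
    unfolding ip_def by (rule sum.cong[OF refl])
  also have "\<dots> = (\<Sum>i\<in>I. c i * ip (\<phi> i) \<eta>)"
    unfolding ip_def sum_distrib_left by (rule sum.swap)
  finally show ?thesis .
qed

lemma qf_sum:
  assumes "finite I" "\<And>i. i \<in> I \<Longrightarrow> form (\<phi> i) (\<psi> i) (p i)" "form \<eta> \<theta> p'"
  shows "qf mu (\<lambda>e t. \<Sum>i\<in>I. c i * \<phi> i e t) (\<lambda>e t. \<Sum>i\<in>I. c i * \<psi> i e t) \<eta> \<theta> = (\<Sum>i\<in>I. c i * qf mu (\<phi> i) (\<psi> i) \<eta> \<theta>)"
proof -
  have "integral {0..l e} (\<lambda>t. (\<Sum>i\<in>I. c i * \<psi> i e t) * \<theta> e t + (W e t - mu) * ((\<Sum>i\<in>I. c i * \<phi> i e t) * \<eta> e t))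
     = (\<Sum>i\<in>I. c i * integral {0..l e} (\<lambda>t. \<psi> i e t * \<theta> e t + (W e t - mu) * (\<phi> i e t * \<eta> e t)))"
    if e: "e \<in> E" for e
  proof -
    have "integral {0..l e} (\<lambda>t. \<Sum>i\<in>I. c i * (\<psi> i e t * \<theta> e t + (W e t - mu) * (\<phi> i e t * \<eta> e t)))
      = (\<Sum>i\<in>I. integral {0..l e} (\<lambda>t. c i * (\<psi> i e t * \<theta> e t + (W e t - mu) * (\<phi> i e t * \<eta> e t))))"
      using assms form_integrable(4)[OF assms(2) assms(3) e] by (intro integral_sum) (auto intro!: integrable_on_mult_right)
    moreover have "(\<Sum>i\<in>I. c i * \<psi> i e t) * \<theta> e t + (W e t - mu) * ((\<Sum>i\<in>I. c i * \<phi> i e t) * \<eta> e t)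
       = (\<Sum>i\<in>I. c i * (\<psi> i e t * \<theta> e t + (W e t - mu) * (\<phi> i e t * \<eta> e t)))" for t
      unfolding sum_distrib_right sum_distrib_left sum.distrib[symmetric] by (rule sum.cong) (auto simp: algebra_simps)
    ultimately show ?thesis by simp
  qed
  then have "qf mu (\<lambda>e t. \<Sum>i\<in>I. c i * \<phi> i e t) (\<lambda>e t. \<Sum>i\<in>I. c i * \<psi> i e t) \<eta> \<theta>
     = (\<Sum>e\<in>E. \<Sum>i\<in>I. c i * integral {0..l e} (\<lambda>t. \<psi> i e t * \<theta> e t + (W e t - mu) * (\<phi> i e t * \<eta> e t)))"
    unfolding qf_def by (rule sum.cong[OF refl])
  also have "\<dots> = (\<Sum>i\<in>I. c i * qf mu (\<phi> i) (\<psi> i) \<eta> \<theta>)"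
    unfolding qf_def sum_distrib_left by (rule sum.swap)
  finally show ?thesis .
qed

lemma ip_add:
  assumes "form \<phi> \<psi> p" "form \<phi>' \<psi>' p'" "form \<eta> \<theta> r"
  shows "ip (\<lambda>e t. \<phi> e t + c * \<phi>' e t) \<eta> = ip \<phi> \<eta> + c * ip \<phi>' \<eta>"
proof -
  have "ip (\<lambda>e t. \<Sum>i\<in>{True,False}. (if i then 1 else c) * (if i then \<phi> else \<phi>') e t) \<eta>
     = (\<Sum>i\<in>{True,False}. (if i then 1 else c) * ip (if i then \<phi> else \<phi>') \<eta>)"
    by (rule ip_sum[of _ _ "\<lambda>i. if i then \<psi> else \<psi>'" "\<lambda>i. if i then p else p'"]) (use assms in auto)
  then show ?thesis by simp
qed

lemma qf_add:
  assumes "form \<phi> \<psi> p" "form \<phi>' \<psi>' p'" "form \<eta> \<theta> r"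
  shows "qf mu (\<lambda>e t. \<phi> e t + c * \<phi>' e t) (\<lambda>e t. \<psi> e t + c * \<psi>' e t) \<eta> \<theta> = qf mu \<phi> \<psi> \<eta> \<theta> + c * qf mu \<phi>' \<psi>' \<eta> \<theta>"
proof -
  have "qf mu (\<lambda>e t. \<Sum>i\<in>{True,False}. (if i then 1 else c) * (if i then \<phi> else \<phi>') e t)
      (\<lambda>e t. \<Sum>i\<in>{True,False}. (if i then 1 else c) * (if i then \<psi> else \<psi>') e t) \<eta> \<theta>
     = (\<Sum>i\<in>{True,False}. (if i then 1 else c) * qf mu (if i then \<phi> else \<phi>') (if i then \<psi> else \<psi>') \<eta> \<theta>)"
    by (rule qf_sum[of _ _ "\<lambda>i. if i then \<psi> else \<psi>'" "\<lambda>i. if i then p else p'"]) (use assms in auto)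
  then show ?thesis by simp
qed

lemma qf_shift:
  assumes "form \<phi> \<psi> p" "form \<eta> \<theta> p'"
  shows "qf mu \<phi> \<psi> \<eta> \<theta> = qf nu \<phi> \<psi> \<eta> \<theta> + (nu - mu) * ip \<phi> \<eta>"
proof -
  have "integral {0..l e} (\<lambda>t. \<psi> e t * \<theta> e t + (W e t - mu) * (\<phi> e t * \<eta> e t)) =
     integral {0..l e} (\<lambda>t. \<psi> e t * \<theta> e t + (W e t - nu) * (\<phi> e t * \<eta> e t)) + (nu - mu) * integral {0..l e} (\<lambda>t. \<phi> e t * \<eta> e t)"
    if e: "e \<in> E" for e
  proof -
    have "integral {0..l e} (\<lambda>t. (\<psi> e t * \<theta> e t + (W e t - nu) * (\<phi> e t * \<eta> e t)) + (nu - mu) * (\<phi> e t * \<eta> e t)) =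
      integral {0..l e} (\<lambda>t. \<psi> e t * \<theta> e t + (W e t - nu) * (\<phi> e t * \<eta> e t)) + integral {0..l e} (\<lambda>t. (nu - mu) * (\<phi> e t * \<eta> e t))"
      using form_integrable[OF assms e] by (intro integral_add integrable_on_mult_right) auto
    moreover have "(\<lambda>t. \<psi> e t * \<theta> e t + (W e t - mu) * (\<phi> e t * \<eta> e t)) = (\<lambda>t. (\<psi> e t * \<theta> e t + (W e t - nu) * (\<phi> e t * \<eta> e t)) + (nu - mu) * (\<phi> e t * \<eta> e t))"
      by (auto simp: algebra_simps)
    ultimately show ?thesis by simp
  qed
  then show ?thesis unfolding qf_def ip_def by (simp add: sum.distrib sum_distrib_left)
qed

lemma ip_self_nonneg: "form \<phi> \<psi> p \<Longrightarrow> 0 \<le> ip \<phi> \<phi>"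
  unfolding ip_def by (intro sum_nonneg integral_nonneg form_integrable(1)) auto

lemma ip_self_eq_0:
  assumes f: "form \<phi> \<psi> p" and z: "ip \<phi> \<phi> = 0" and e: "e \<in> E" and t: "t \<in> {0..l e}"
  shows "\<phi> e t = 0"
proof -
  have nn: "0 \<le> integral {0..l e} (\<lambda>t. \<phi> e t * \<phi> e t)" if "e \<in> E" for e
    by (intro integral_nonneg form_integrable(1)[OF f f that]) auto
  have i0: "integral {0..l e} (\<lambda>t. \<phi> e t * \<phi> e t) = 0"
    using z e nn unfolding ip_def by (subst (asm) sum_nonneg_eq_0_iff) (auto simp: graphD(2))
  have "continuous_on {0..l e} (\<lambda>t. \<phi> e t * \<phi> e t)" by (intro continuous_intros formD(1)[OF f e])
  from integral_eq_0_iff[OF this graphD(6)[OF e]] i0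
  have "\<forall>t\<in>{0..l e}. \<phi> e t * \<phi> e t = 0" by simp
  then show ?thesis using t by auto
qed

lemma ip_self_pos:
  assumes "form \<phi> \<psi> p" "nonzero \<phi>"
  shows "0 < ip \<phi> \<phi>"
proof -
  have "ip \<phi> \<phi> \<noteq> 0" using ip_self_eq_0[OF assms(1)] assms(2) by blast
  then show ?thesis using ip_self_nonneg[OF assms(1)] by simp
qed

text \<open>Regrouped by vertices, the terms at an inner vertex are \<open>- p v\<close> times the
  Kirchhoff sum, and those at a boundary vertex contain the factor \<open>p v = 0\<close>.\<close>

lemma boundary_terms:
  assumes "kirchhoff D" "\<And>v. v \<in> Vb \<Longrightarrow> p v = 0"
  shows "(\<Sum>e\<in>E. p (tgt e) * D e (l e) - p (src e) * D e 0) = 0"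
proof -
  have "(\<Sum>e\<in>E. - (p (src e) * D e 0) + p (tgt e) * D e (l e)) = (\<Sum>v\<in>V. hsum v (\<lambda>e. - (p (src e) * D e 0)) (\<lambda>e. p (tgt e) * D e (l e)))"
    by (rule sum_hsum[symmetric])
  also have "\<dots> = (\<Sum>v\<in>V. - p v * hsum v (\<lambda>e. D e 0) (\<lambda>e. - D e (l e)))"
  proof (rule sum.cong[OF refl])
    fix v
    have "(\<Sum>e\<in>{e\<in>E. src e = v}. - (p (src e) * D e 0)) = - p v * (\<Sum>e\<in>{e\<in>E. src e = v}. D e 0)"
      "(\<Sum>e\<in>{e\<in>E. tgt e = v}. p (tgt e) * D e (l e)) = p v * (\<Sum>e\<in>{e\<in>E. tgt e = v}. D e (l e))"
      unfolding sum_distrib_left by (auto intro!: sum.cong)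
    then show "hsum v (\<lambda>e. - (p (src e) * D e 0)) (\<lambda>e. p (tgt e) * D e (l e)) = - p v * hsum v (\<lambda>e. D e 0) (\<lambda>e. - D e (l e))"
      by (simp add: sum_negf algebra_simps)
  qed
  also have "\<dots> = 0"
  proof (rule sum.neutral, rule ballI)
    fix v assume "v \<in> V"
    then show "- p v * hsum v (\<lambda>e. D e 0) (\<lambda>e. - D e (l e)) = 0"
      using V_split assms unfolding kirchhoff_def by fastforce
  qed
  finally show ?thesis by simp
qed

text \<open>By the eigenvalue equation the integrand is the derivative of \<open>\<phi> * D\<close>,
  so each edge leaves only boundary terms, and these cancel at the vertices.\<close>

lemma green:
  assumes f: "form \<phi> \<psi> p" and g: "eig lam g D gv"
  shows "qf lam \<phi> \<psi> g D = 0"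
proof -
  have "integral {0..l e} (\<lambda>t. \<psi> e t * D e t + (W e t - lam) * (\<phi> e t * g e t)) = p (tgt e) * D e (l e) - p (src e) * D e 0"
    if e: "e \<in> E" for e
  proof -
    obtain S where S: "finite S" "\<And>t. t\<in>{0<..<l e} - S \<Longrightarrow> (\<phi> e has_real_derivative \<psi> e t) (at t)"
      using formD(6)[OF f e] by auto
    have "((\<lambda>t. \<psi> e t * D e t + (W e t - lam) * (\<phi> e t * g e t)) has_integral \<phi> e (l e) * D e (l e) - \<phi> e 0 * D e 0) {0..l e}"
    proof (rule fundamental_theorem_of_calculus_interior_strong[OF S(1)])
      show "0 \<le> l e" using graphD(6)[OF e] by simp
      show "continuous_on {0..l e} (\<lambda>t. \<phi> e t * D e t)" by (intro continuous_intros formD(1)[OF f e] eigD(6)[OF g e])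
      fix t assume t: "t \<in> {0<..<l e} - S"
      have "(D e has_real_derivative (W e t - lam) * g e t) (at t)"
        by (rule derivative_Icc_interior[of "l e"]) (use eigD(2)[OF g e] t in auto)
      from DERIV_mult[OF S(2)[OF t] this]
      have "((\<lambda>t. \<phi> e t * D e t) has_real_derivative \<psi> e t * D e t + (W e t - lam) * (\<phi> e t * g e t)) (at t)"
        by (simp add: algebra_simps)
      then show "((\<lambda>t. \<phi> e t * D e t) has_vector_derivative \<psi> e t * D e t + (W e t - lam) * (\<phi> e t * g e t)) (at t)"
        by (simp add: has_real_derivative_iff_has_vector_derivative)
    qed
    then show ?thesis using formD(4,5)[OF f e] by (simp add: integral_unique)
  qed
  then have "qf lam \<phi> \<psi> g D = (\<Sum>e\<in>E. p (tgt e) * D e (l e) - p (src e) * D e 0)"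
    unfolding qf_def by simp
  also have "\<dots> = 0" by (rule boundary_terms) (use f g in \<open>auto simp: form_def eig_def vertex_cont_def\<close>)
  finally show ?thesis .
qed

text \<open>Green's formula makes the form of the pair vanish at both shifts \<open>lam\<close> and
  \<open>mu\<close>, while the two values differ by \<open>(lam - mu) * ip f g\<close>.\<close>

lemma eig_orthogonal:
  assumes f: "eig lam f D fv" and g: "eig mu g D' gv" and ne: "lam \<noteq> mu"
  shows "ip f g = 0"
proof -
  have "qf mu f D g D' = 0" by (rule green[OF form_eig[OF f] g])
  moreover have "qf lam f D g D' = 0" using green[OF form_eig[OF g] f] qf_commute by metis
  moreover have "qf mu f D g D' = qf lam f D g D' + (lam - mu) * ip f g"
    by (rule qf_shift[OF form_eig[OF f] form_eig[OF g]])
  ultimately show ?thesis using ne by simp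
qed

lemma qf_eig:
  assumes f: "form \<phi> \<psi> p" and g: "eig lam g D gv"
  shows "qf mu \<phi> \<psi> g D = (lam - mu) * ip \<phi> g"
  using green[OF f g] qf_shift[OF f form_eig[OF g], of mu lam] by simp

end

subsection \<open>Picone's identity and the lower bound for eigenfunctions\<close>

text \<open>Off the zeros of \<open>f\<close>, the derivative of \<open>\<phi>^2 / f * D\<close> is
  the integrand minus the square of \<open>\<psi> - \<phi> * (D / f)\<close>. At a zero of
  \<open>f\<close> division by zero gives the quotient the value 0, which is also its limit, so the
  fundamental theorem applies across it and at the ends.\<close>

lemma picone_edge:
  assumes f: "simple_zeros l f D" and D: "\<And>t. t \<in> {0..l} \<Longrightarrow> (D has_real_derivative q t * f t) (at t within {0..l})"
    and \<phi>: "\<And>t. t \<in> {0..l} \<Longrightarrow> (\<phi> has_real_derivative \<psi> t) (at t within {0..l})" and \<psi>: "continuous_on {0..l} \<psi>"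
    and q: "continuous_on {0..l} q" and z: "\<And>t. t \<in> {0..l} \<Longrightarrow> f t = 0 \<Longrightarrow> \<phi> t = 0"
  shows "(\<phi> l)\<^sup>2 / f l * D l - (\<phi> 0)\<^sup>2 / f 0 * D 0 \<le> integral {0..l} (\<lambda>t. \<psi> t * \<psi> t + q t * (\<phi> t * \<phi> t))"
proof -
  have l: "0 < l" and df: "\<And>t. t \<in> {0..l} \<Longrightarrow> (f has_real_derivative D t) (at t within {0..l})"
    and D0: "\<And>t. t \<in> {0..l} \<Longrightarrow> f t = 0 \<Longrightarrow> D t \<noteq> 0" and cD: "continuous_on {0..l} D"
    using f unfolding simple_zeros_def by auto
  have cf: "continuous_on {0..l} f" using derivative_Icc_continuous df by blast
  have c\<phi>: "continuous_on {0..l} \<phi>" using derivative_Icc_continuous \<phi> by blast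
  define S where "S = {t\<in>{0..l}. f t = 0}"
  have fS: "finite S" unfolding S_def by (rule simple_zeros_finite[OF f])
  define \<Psi> where "\<Psi> t = (\<phi> t)\<^sup>2 / f t * D t" for t
  define P where "P t = 2 * \<phi> t * \<psi> t * (D t / f t) + q t * (\<phi> t)\<^sup>2 - (\<phi> t)\<^sup>2 * (D t / f t)\<^sup>2" for t
  have "continuous_on {0..l} \<Psi>"
    unfolding continuous_on_eq_continuous_within
  proof
    fix x assume x: "x \<in> {0..l}"
    have cx: "continuous (at x within {0..l}) f" "continuous (at x within {0..l}) D" "continuous (at x within {0..l}) \<phi>"
      using cf cD c\<phi> x by (auto simp: continuous_on_eq_continuous_within)
    show "continuous (at x within {0..l}) \<Psi>"
    proof (cases "f x = 0")
      case False
      then show ?thesis unfolding \<Psi>_def by (intro continuous_intros cx) auto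
    next
      case True
      then have \<phi>x: "\<phi> x = 0" and Dx: "D x \<noteq> 0" using z D0 x by auto
      \<comment> \<open>The numerator \<open>\<phi>^2\<close> vanishes to second order and
        \<open>f\<close> only to first. Writing both through difference quotients leaves a factor
        \<open>y - x\<close> that tends to 0.\<close>
      have 1: "((\<lambda>y. \<phi> y / (y - x)) \<longlongrightarrow> \<psi> x) (at x within {0..l})"
        using \<phi>[OF x] \<phi>x unfolding has_field_derivative_iff by simp
      have 2: "((\<lambda>y. f y / (y - x)) \<longlongrightarrow> D x) (at x within {0..l})"
        using df[OF x] True unfolding has_field_derivative_iff by simp
      have 3: "(D \<longlongrightarrow> D x) (at x within {0..l})" using cx(2) unfolding continuous_within .
      have 4: "((\<lambda>y. y - x) \<longlongrightarrow> x - x) (at x within {0..l})" by (intro tendsto_intros)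
      have "((\<lambda>y. (\<phi> y / (y - x))\<^sup>2 * (y - x) / (f y / (y - x)) * D y) \<longlongrightarrow> (\<psi> x)\<^sup>2 * (x - x) / D x * D x) (at x within {0..l})"
        by (intro tendsto_mult tendsto_divide tendsto_power 1 2 3 4 Dx)
      then have "((\<lambda>y. (\<phi> y / (y - x))\<^sup>2 * (y - x) / (f y / (y - x)) * D y) \<longlongrightarrow> \<Psi> x) (at x within {0..l})"
        using \<phi>x by (simp add: \<Psi>_def)
      then have "(\<Psi> \<longlongrightarrow> \<Psi> x) (at x within {0..l})"
        by (rule Lim_transform_eventually) (auto simp: eventually_at_filter \<Psi>_def power2_eq_square intro!: always_eventually)
      then show ?thesis unfolding continuous_within .
    qed
  qed
  moreover have "(\<Psi> has_vector_derivative P t) (at t)" if t: "t \<in> {0<..<l} - S" for t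
  proof -
    have ft: "f t \<noteq> 0" using t by (auto simp: S_def)
    have t': "0 < t" "t < l" using t by auto
    note d = derivative_Icc_interior[of l, OF df t'] derivative_Icc_interior[of l, OF D t'] derivative_Icc_interior[of l, OF \<phi> t']
    have "((\<lambda>t. (\<phi> t * \<phi> t) / f t * D t) has_real_derivative
        (((\<psi> t * \<phi> t + \<psi> t * \<phi> t) * f t - \<phi> t * \<phi> t * D t) / (f t * f t)) * D t + q t * f t * (\<phi> t * \<phi> t / f t)) (at t)"
      by (intro DERIV_mult DERIV_divide d ft)
    moreover have "(((\<psi> t * \<phi> t + \<psi> t * \<phi> t) * f t - \<phi> t * \<phi> t * D t) / (f t * f t)) * D t + q t * f t * (\<phi> t * \<phi> t / f t) = P t"
      unfolding P_def using ft by (simp add: field_simps power2_eq_square)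
    moreover have "\<Psi> = (\<lambda>t. (\<phi> t * \<phi> t) / f t * D t)" by (auto simp: \<Psi>_def power2_eq_square)
    ultimately show ?thesis by (simp add: has_real_derivative_iff_has_vector_derivative)
  qed
  ultimately have P: "(P has_integral \<Psi> l - \<Psi> 0) {0..l}"
    using l by (intro fundamental_theorem_of_calculus_interior_strong[OF fS]) auto
  have "((\<lambda>t. \<psi> t * \<psi> t + q t * (\<phi> t * \<phi> t)) has_integral integral {0..l} (\<lambda>t. \<psi> t * \<psi> t + q t * (\<phi> t * \<phi> t))) {0..l}"
    by (intro integrable_integral integrable_continuous_real continuous_intros \<psi> c\<phi> q)
  then have "\<Psi> l - \<Psi> 0 \<le> integral {0..l} (\<lambda>t. \<psi> t * \<psi> t + q t * (\<phi> t * \<phi> t))"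
  proof (rule has_integral_le[OF P])
    fix t
    have "0 \<le> (\<psi> t - \<phi> t * (D t / f t))\<^sup>2" by simp
    then show "P t \<le> \<psi> t * \<psi> t + q t * (\<phi> t * \<phi> t)"
      unfolding P_def by (simp only: power2_diff power_mult_distrib) (simp add: power2_eq_square algebra_simps)
  qed
  then show ?thesis unfolding \<Psi>_def .
qed

context generic_graph
begin

text \<open>The boundary terms belong to the vertex function \<open>p^2 / fv\<close> and cancel by
  Kirchhoff. Genericity makes \<open>fv\<close> nonzero at inner vertices, and at boundary vertices
  \<open>p\<close> is zero too.\<close>

lemma picone:
  assumes f: "eig lam f D fv" and nz: "nonzero f"
    and \<phi>: "\<And>e t. e \<in> E \<Longrightarrow> t \<in> {0..l e} \<Longrightarrow> (\<phi> e has_real_derivative \<psi> e t) (at t within {0..l e})"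
    and \<psi>: "\<And>e. e \<in> E \<Longrightarrow> continuous_on {0..l e} (\<psi> e)" and p: "vertex_cont p \<phi>"
    and z: "\<And>e t. (e, t) \<in> zero_edge_points E l f \<Longrightarrow> \<phi> e t = 0"
  shows "0 \<le> qf lam \<phi> \<psi> \<phi> \<psi>"
proof -
  have pv: "p v = 0" if "v \<in> V" "fv v = 0" for v
    using generic_vertex[OF f nz] V_split that p unfolding vertex_cont_def by blast
  have p\<phi>: "\<phi> e 0 = p (src e)" "\<phi> e (l e) = p (tgt e)" if "e \<in> E" for e
    using p that unfolding vertex_cont_def by auto
  have "(p (tgt e))\<^sup>2 / fv (tgt e) * D e (l e) - (p (src e))\<^sup>2 / fv (src e) * D e 0 \<le>
      integral {0..l e} (\<lambda>t. \<psi> e t * \<psi> e t + (W e t - lam) * (\<phi> e t * \<phi> e t))" if e: "e \<in> E" for e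
  proof -
    have "\<phi> e t = 0" if "t \<in> {0..l e}" "f e t = 0" for t
    proof -
      consider "t = 0" | "t = l e" | "0 < t" "t < l e" using \<open>t \<in> {0..l e}\<close> by fastforce
      then show ?thesis
        using pv[OF graphD(4)[OF e]] pv[OF graphD(5)[OF e]] p\<phi>[OF e] eigD(3,4)[OF f e] that z[of e t] e
        by cases (auto simp: zero_edge_points_def)
    qed
    then have "(\<phi> e (l e))\<^sup>2 / f e (l e) * D e (l e) - (\<phi> e 0)\<^sup>2 / f e 0 * D e 0 \<le>
      integral {0..l e} (\<lambda>t. \<psi> e t * \<psi> e t + (W e t - lam) * (\<phi> e t * \<phi> e t))"
      by (intro picone_edge[OF eig_simple_zeros[OF f nz e]] eigD(2)[OF f e] \<phi> \<psi> e continuous_intros W_cont) auto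
    then show ?thesis using p\<phi>[OF e] eigD(3,4)[OF f e] by simp
  qed
  then have "(\<Sum>e\<in>E. (p (tgt e))\<^sup>2 / fv (tgt e) * D e (l e) - (p (src e))\<^sup>2 / fv (src e) * D e 0) \<le> qf lam \<phi> \<psi> \<phi> \<psi>"
    unfolding qf_def by (rule sum_mono)
  moreover have "(\<Sum>e\<in>E. (p (tgt e))\<^sup>2 / fv (tgt e) * D e (l e) - (p (src e))\<^sup>2 / fv (src e) * D e 0) = 0"
    using boundary_terms[of D "\<lambda>v. (p v)\<^sup>2 / fv v"] f p unfolding eig_def vertex_cont_def by auto
  ultimately show ?thesis by simp
qed

lemma finite_zeros_eig:
  assumes "eig lam f D fv" "nonzero f"
  shows "finite (zero_edge_points E l f)"
  unfolding finite_zero_edge_points zeros_on_def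
proof
  fix e assume "e \<in> E"
  from simple_zeros_finite[OF eig_simple_zeros[OF assms this]]
  show "finite {t. 0 < t \<and> t < l e \<and> f e t = 0}" by (rule finite_subset[rotated]) auto
qed

text \<open>By Picone the combination vanishing at the zeros of \<open>f\<close> has nonnegative
  form at level \<open>lam\<close>, whereas orthogonality expands this form with the negative
  factors \<open>mu i - lam\<close>. As the bound is uniform in \<open>I\<close>, it also yields
  finiteness of the set of lower eigenvalues.\<close>

theorem card_eigenvalues_below_le:
  assumes f: "eig lam f D fv" and nz: "nonzero f" and I: "finite I"
    and g: "\<And>i. i \<in> I \<Longrightarrow> eig (mu i) (g i) (D' i) (gv i)" and gnz: "\<And>i. i \<in> I \<Longrightarrow> nonzero (g i)"
    and mu: "\<And>i. i \<in> I \<Longrightarrow> mu i < lam" and inj: "inj_on mu I"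
  shows "card I \<le> card (zero_edge_points E l f)"
proof (rule ccontr)
  assume "\<not> ?thesis"
  then have lt: "card (zero_edge_points E l f) < card I" by simp
  obtain c where c: "\<exists>i\<in>I. c i \<noteq> 0" "\<And>j. j \<in> zero_edge_points E l f \<Longrightarrow> (\<Sum>i\<in>I. (case j of (e, t) \<Rightarrow> g i e t) * c i) = 0"
    using homogeneous_system_nontrivial[OF finite_zeros_eig[OF f nz] I lt, of "\<lambda>j i. case j of (e, t) \<Rightarrow> g i e t"] by blast
  define \<phi> where "\<phi> e t = (\<Sum>i\<in>I. c i * g i e t)" for e t
  define \<psi> where "\<psi> e t = (\<Sum>i\<in>I. c i * D' i e t)" for e t
  define p where "p v = (\<Sum>i\<in>I. c i * gv i v)" for v
  have fm: "form \<phi> \<psi> p" unfolding \<phi>_def \<psi>_def p_def by (rule form_sum[OF I]) (use form_eig[OF g] in auto)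
  have "0 \<le> qf lam \<phi> \<psi> \<phi> \<psi>"
  proof (rule picone[OF f nz])
    show "(\<phi> e has_real_derivative \<psi> e t) (at t within {0..l e})" if "e \<in> E" "t \<in> {0..l e}" for e t
      unfolding \<phi>_def \<psi>_def by (intro DERIV_sum DERIV_cmult eigD(1)[OF g that])
    show "continuous_on {0..l e} (\<psi> e)" if "e \<in> E" for e
      unfolding \<psi>_def by (intro continuous_intros eigD(6)[OF g that])
    show "vertex_cont p \<phi>" using fm unfolding form_def by blast
    show "\<phi> e t = 0" if "(e, t) \<in> zero_edge_points E l f" for e t
      using c(2)[OF that] by (simp add: \<phi>_def mult.commute)
  qed
  moreover have "qf lam \<phi> \<psi> \<phi> \<psi> = (\<Sum>i\<in>I. (c i)\<^sup>2 * ((mu i - lam) * ip (g i) (g i)))"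
  proof -
    have "qf lam \<phi> \<psi> \<phi> \<psi> = (\<Sum>i\<in>I. c i * qf lam (g i) (D' i) \<phi> \<psi>)"
      unfolding \<phi>_def[abs_def] \<psi>_def[abs_def]
      by (rule qf_sum[OF I _ fm[unfolded \<phi>_def[abs_def] \<psi>_def[abs_def]]]) (use form_eig[OF g] in auto)
    also have "\<dots> = (\<Sum>i\<in>I. (c i)\<^sup>2 * ((mu i - lam) * ip (g i) (g i)))"
    proof (rule sum.cong[OF refl])
      fix i assume i: "i \<in> I"
      have "qf lam (g i) (D' i) \<phi> \<psi> = (mu i - lam) * ip \<phi> (g i)"
        using qf_eig[OF fm g[OF i], of lam] qf_commute by metis
      moreover have "ip \<phi> (g i) = (\<Sum>j\<in>I. c j * ip (g j) (g i))"
        unfolding \<phi>_def[abs_def] by (rule ip_sum[OF I _ form_eig[OF g[OF i]]]) (use form_eig[OF g] in auto)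
      moreover have "(\<Sum>j\<in>I. c j * ip (g j) (g i)) = (\<Sum>j\<in>I. if j = i then c i * ip (g i) (g i) else 0)"
      proof (rule sum.cong[OF refl])
        fix j assume j: "j \<in> I"
        have "ip (g j) (g i) = 0" if "j \<noteq> i"
          by (rule eig_orthogonal[OF g[OF j] g[OF i]]) (use inj i j that in \<open>auto simp: inj_on_def\<close>)
        then show "c j * ip (g j) (g i) = (if j = i then c i * ip (g i) (g i) else 0)" by auto
      qed
      ultimately show "c i * qf lam (g i) (D' i) \<phi> \<psi> = (c i)\<^sup>2 * ((mu i - lam) * ip (g i) (g i))"
        using I i by (simp add: power2_eq_square)
    qed
    finally show ?thesis .
  qed
  moreover have "(\<Sum>i\<in>I. (c i)\<^sup>2 * ((mu i - lam) * ip (g i) (g i))) < 0"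
  proof -
    have neg: "(mu i - lam) * ip (g i) (g i) < 0" if "i \<in> I" for i
      by (rule mult_neg_pos) (use mu[OF that] ip_self_pos[OF form_eig[OF g[OF that]] gnz[OF that]] in auto)
    have le: "(c i)\<^sup>2 * ((mu i - lam) * ip (g i) (g i)) \<le> 0" if "i \<in> I" for i
      by (rule mult_nonneg_nonpos[OF _ less_imp_le[OF neg[OF that]]]) simp
    obtain j where j: "j \<in> I" "c j \<noteq> 0" using c(1) by auto
    have "(c j)\<^sup>2 * ((mu j - lam) * ip (g j) (g j)) < 0" by (rule mult_pos_neg[OF _ neg[OF j(1)]]) (use j(2) in simp)
    then have "(\<Sum>i\<in>I. (c i)\<^sup>2 * ((mu i - lam) * ip (g i) (g i))) < (\<Sum>i\<in>I. 0)"
      using sum_strict_mono_ex1[OF I, of "\<lambda>i. (c i)\<^sup>2 * ((mu i - lam) * ip (g i) (g i))" "\<lambda>_. 0"] le j by blast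
    then show ?thesis by simp
  qed
  ultimately show False by simp
qed

end

subsection \<open>Compactness of minimising sequences\<close>

lemma integration_by_parts_Icc:
  assumes l: "0 < l" and \<phi>: "continuous_on {0..l} \<phi>" and S: "finite S" "\<And>t. t \<in> {0<..<l} - S \<Longrightarrow> (\<phi> has_real_derivative \<psi> t) (at t)"
    and \<theta>: "\<And>t. t \<in> {0..l} \<Longrightarrow> (\<theta> has_real_derivative h t) (at t within {0..l})" and h: "continuous_on {0..l} h"
  shows "integral {0..l} (\<lambda>t. \<psi> t * \<theta> t) = \<phi> l * \<theta> l - \<phi> 0 * \<theta> 0 - integral {0..l} (\<lambda>t. \<phi> t * h t)"
proof -
  have c\<theta>: "continuous_on {0..l} \<theta>" using derivative_Icc_continuous \<theta> by blast
  have "((\<lambda>t. \<psi> t * \<theta> t + h t * \<phi> t) has_integral \<phi> l * \<theta> l - \<phi> 0 * \<theta> 0) {0..l}"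
  proof (rule fundamental_theorem_of_calculus_interior_strong[OF S(1)])
    show "0 \<le> l" using l by simp
    show "continuous_on {0..l} (\<lambda>t. \<phi> t * \<theta> t)" by (intro continuous_intros \<phi> c\<theta>)
    fix t assume t: "t \<in> {0<..<l} - S"
    have "(\<theta> has_real_derivative h t) (at t)" by (rule derivative_Icc_interior[of l, OF \<theta>]) (use t in auto)
    from DERIV_mult[OF S(2)[OF t] this]
    show "((\<lambda>t. \<phi> t * \<theta> t) has_vector_derivative \<psi> t * \<theta> t + h t * \<phi> t) (at t)"
      by (simp add: has_real_derivative_iff_has_vector_derivative)
  qed
  moreover have "((\<lambda>t. \<phi> t * h t) has_integral integral {0..l} (\<lambda>t. \<phi> t * h t)) {0..l}"
    by (intro integrable_integral integrable_continuous_real continuous_intros \<phi> h)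
  ultimately have "((\<lambda>t. \<psi> t * \<theta> t + h t * \<phi> t - \<phi> t * h t) has_integral
      \<phi> l * \<theta> l - \<phi> 0 * \<theta> 0 - integral {0..l} (\<lambda>t. \<phi> t * h t)) {0..l}" by (rule has_integral_diff)
  then show ?thesis by (simp add: integral_unique mult.commute)
qed

text \<open>Let \<open>v'' = w\<close> with the end values of \<open>u\<close>. Integrating by
  parts, \<open>v\<close> satisfies the same weak identity, and the test function with
  \<open>\<eta>'' = u - v\<close> makes the integral of \<open>(u - v)^2\<close> zero. All
  derivatives sit on the test function because \<open>u\<close> is only known to be
  continuous.\<close>

lemma weak_solution_regular:
  assumes l: "0 < l" and u: "continuous_on {0..l} u" and w: "continuous_on {0..l} w"
    and weak: "\<And>\<eta> \<theta> h. continuous_on {0..l} h \<Longrightarrow> (\<And>t. t \<in> {0..l} \<Longrightarrow> (\<eta> has_real_derivative \<theta> t) (at t within {0..l})) \<Longrightarrow>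
      (\<And>t. t \<in> {0..l} \<Longrightarrow> (\<theta> has_real_derivative h t) (at t within {0..l})) \<Longrightarrow> \<eta> 0 = 0 \<Longrightarrow> \<eta> l = 0 \<Longrightarrow>
      u l * \<theta> l - u 0 * \<theta> 0 - integral {0..l} (\<lambda>t. u t * h t) + integral {0..l} (\<lambda>t. w t * \<eta> t) = 0"
  shows "\<exists>D. \<forall>t\<in>{0..l}. (u has_real_derivative D t) (at t within {0..l}) \<and> (D has_real_derivative w t) (at t within {0..l})"
proof -
  have prim: "\<exists>P Q. (\<forall>t\<in>{0..l}. (Q has_real_derivative P t) (at t within {0..l}) \<and> (P has_real_derivative g t) (at t within {0..l})) \<and> Q 0 = a \<and> Q l = b"
    if g: "continuous_on {0..l} g" for g and a b :: real
  proof -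
    define P0 where "P0 t = integral {0..t} g" for t
    define Q0 where "Q0 t = integral {0..t} P0" for t
    have P0: "(P0 has_real_derivative g t) (at t within {0..l})" if "t \<in> {0..l}" for t
      unfolding P0_def by (rule integral_has_real_derivative[OF g that])
    have cP0: "continuous_on {0..l} P0" using derivative_Icc_continuous P0 by blast
    have Q0: "(Q0 has_real_derivative P0 t) (at t within {0..l})" if "t \<in> {0..l}" for t
      unfolding Q0_def by (rule integral_has_real_derivative[OF cP0 that])
    define B where "B = (b - a - Q0 l) / l"
    have "((\<lambda>t. Q0 t + (a + B * t)) has_real_derivative P0 t + B) (at t within {0..l})" if "t \<in> {0..l}" for t
      by (intro DERIV_add Q0 that) (auto intro!: derivative_eq_intros)
    moreover have "((\<lambda>t. P0 t + B) has_real_derivative g t) (at t within {0..l})" if "t \<in> {0..l}" for t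
      using DERIV_add[OF P0[OF that] DERIV_const[of B]] by simp
    moreover have "Q0 0 = 0" unfolding Q0_def by simp
    ultimately show ?thesis using l
      by (intro exI[of _ "\<lambda>t. P0 t + B"] exI[of _ "\<lambda>t. Q0 t + (a + B * t)"]) (auto simp: B_def)
  qed
  obtain D v where Dv: "\<And>t. t \<in> {0..l} \<Longrightarrow> (v has_real_derivative D t) (at t within {0..l})"
    "\<And>t. t \<in> {0..l} \<Longrightarrow> (D has_real_derivative w t) (at t within {0..l})" "v 0 = u 0" "v l = u l"
    using prim[OF w, of "u 0" "u l"] by blast
  have cv: "continuous_on {0..l} v" "continuous_on {0..l} D"
    using derivative_Icc_continuous[of l v D] derivative_Icc_continuous[of l D w] Dv by auto
  define h where "h t = u t - v t" for t
  have ch: "continuous_on {0..l} h" unfolding h_def by (intro continuous_intros u cv)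
  obtain \<theta> \<eta> where \<eta>: "\<And>t. t \<in> {0..l} \<Longrightarrow> (\<eta> has_real_derivative \<theta> t) (at t within {0..l})"
    "\<And>t. t \<in> {0..l} \<Longrightarrow> (\<theta> has_real_derivative h t) (at t within {0..l})" "\<eta> 0 = 0" "\<eta> l = 0"
    using prim[OF ch, of 0 0] by blast
  have c\<eta>: "continuous_on {0..l} \<eta>" "continuous_on {0..l} \<theta>"
    using derivative_Icc_continuous[of l \<eta> \<theta>] derivative_Icc_continuous[of l \<theta> h] \<eta> by auto
  have 1: "u l * \<theta> l - u 0 * \<theta> 0 - integral {0..l} (\<lambda>t. u t * h t) + integral {0..l} (\<lambda>t. w t * \<eta> t) = 0"
    by (rule weak[OF ch \<eta>])
  have 2: "integral {0..l} (\<lambda>t. w t * \<eta> t) = D l * \<eta> l - D 0 * \<eta> 0 - integral {0..l} (\<lambda>t. D t * \<theta> t)"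
    by (rule integration_by_parts_Icc[OF l cv(2), of "{}"]) (use derivative_Icc_interior[of l, OF Dv(2)] \<eta>(1) c\<eta>(2) in auto)
  have 3: "integral {0..l} (\<lambda>t. D t * \<theta> t) = v l * \<theta> l - v 0 * \<theta> 0 - integral {0..l} (\<lambda>t. v t * h t)"
    by (rule integration_by_parts_Icc[OF l cv(1), of "{}"]) (use derivative_Icc_interior[of l, OF Dv(1)] \<eta>(2) ch in auto)
  have "integral {0..l} (\<lambda>t. u t * h t - v t * h t) = integral {0..l} (\<lambda>t. u t * h t) - integral {0..l} (\<lambda>t. v t * h t)"
    by (intro integral_diff integrable_continuous_real continuous_intros u cv ch)
  then have "integral {0..l} (\<lambda>t. h t * h t) = 0"
    using 1 2 3 \<eta>(3,4) Dv(3,4) by (simp add: h_def algebra_simps)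
  moreover have "continuous_on {0..l} (\<lambda>t. h t * h t)" by (intro continuous_intros ch)
  ultimately have "\<forall>t\<in>{0..l}. h t * h t = 0"
    using integral_eq_0_iff[of 0 l "\<lambda>t. h t * h t"] l by simp
  then have eq: "\<And>t. t \<in> {0..l} \<Longrightarrow> u t = v t" by (auto simp: h_def)
  have "(u has_real_derivative D t) (at t within {0..l})" if "t \<in> {0..l}" for t
    unfolding has_field_derivative_def
    by (rule has_derivative_transform[OF that eq Dv(1)[OF that, unfolded has_field_derivative_def]])
  then show ?thesis using Dv(2) by blast
qed

lemma integral_uniform_tendsto:
  fixes f :: "nat \<Rightarrow> real \<Rightarrow> real"
  assumes u: "uniform_limit {0..l} f g sequentially" and f: "\<And>n. continuous_on {0..l} (f n)"
  shows "(\<lambda>n. integral {0..l} (f n)) \<longlonglongrightarrow> integral {0..l} g"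
proof -
  obtain I J where I: "\<And>n. (f n has_integral I n) {0..l}" "(g has_integral J) {0..l}" "I \<longlonglongrightarrow> J"
    using uniform_limit_integral[OF u f] by auto
  then show ?thesis by (simp add: integral_unique[OF I(1)] integral_unique[OF I(2)])
qed

lemma integral_mult_tendsto:
  fixes f f' :: "nat \<Rightarrow> real \<Rightarrow> real"
  assumes u: "uniform_limit {0..l} f g sequentially" "uniform_limit {0..l} f' g' sequentially"
    and f: "\<And>n. continuous_on {0..l} (f n)" "\<And>n. continuous_on {0..l} (f' n)"
  shows "(\<lambda>n. integral {0..l} (\<lambda>t. f n t * f' n t)) \<longlonglongrightarrow> integral {0..l} (\<lambda>t. g t * g' t)"
proof (rule integral_uniform_tendsto)
  have "continuous_on {0..l} g" "continuous_on {0..l} g'"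
    using uniform_limit_theorem[OF _ u(1)] uniform_limit_theorem[OF _ u(2)] f by (auto simp: always_eventually)
  then have "bounded (g ` {0..l})" "bounded (g' ` {0..l})"
    by (auto intro!: compact_imp_bounded compact_continuous_image)
  then show "uniform_limit {0..l} (\<lambda>n t. f n t * f' n t) (\<lambda>t. g t * g' t) sequentially"
    by (intro uniform_lim_mult u)
  show "continuous_on {0..l} (\<lambda>t. f n t * f' n t)" for n by (intro continuous_intros f)
qed

text \<open>Cauchy-Schwarz, by integrating \<open>(\<psi> - k)^2 \<ge> 0\<close> with the mean slope
  \<open>k\<close>. It makes \<open>\<phi>\<close> Hoelder continuous of order 1/2 with a constant
  governed by the energy.\<close>

lemma increment_squared_le:
  assumes \<phi>: "continuous_on {0..l} \<phi>" and S: "finite S" "\<And>t. t \<in> {0<..<l} - S \<Longrightarrow> (\<phi> has_real_derivative \<psi> t) (at t)"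
    and \<psi>: "bounded_meas l \<psi>" and st: "0 \<le> s" "s \<le> t" "t \<le> l"
  shows "(\<phi> t - \<phi> s)\<^sup>2 \<le> (t - s) * integral {0..l} (\<lambda>t. \<psi> t * \<psi> t)"
proof (cases "s = t")
  case False
  then have lt: "s < t" using st by simp
  have I: "(\<psi> has_integral \<phi> t - \<phi> s) {s..t}"
  proof (rule fundamental_theorem_of_calculus_interior_strong[OF S(1)])
    show "s \<le> t" by (rule st(2))
    show "continuous_on {s..t} \<phi>" by (rule continuous_on_subset[OF \<phi>]) (use st in auto)
    fix x assume "x \<in> {s<..<t} - S"
    then show "(\<phi> has_vector_derivative \<psi> x) (at x)"
      using S(2)[of x] st by (auto simp: has_real_derivative_iff_has_vector_derivative)
  qed
  have int: "(\<lambda>t. \<psi> t * \<psi> t) integrable_on {0..l}" by (intro bounded_meas_integrable bounded_meas_mult \<psi>)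
  then have int': "(\<lambda>t. \<psi> t * \<psi> t) integrable_on {s..t}"
    by (rule integrable_on_subinterval) (use st in auto)
  define J where "J = integral {s..t} (\<lambda>t. \<psi> t * \<psi> t)"
  have JI: "((\<lambda>t. \<psi> t * \<psi> t) has_integral J) {s..t}" unfolding J_def by (rule integrable_integral[OF int'])
  define k where "k = (\<phi> t - \<phi> s) / (t - s)"
  have "((\<lambda>x. \<psi> x * \<psi> x - (2 * k) * \<psi> x + k\<^sup>2) has_integral J - (2 * k) * (\<phi> t - \<phi> s) + (t - s) * k\<^sup>2) {s..t}"
  proof (intro has_integral_add has_integral_diff JI has_integral_mult_right I)
    show "((\<lambda>x. k\<^sup>2) has_integral (t - s) * k\<^sup>2) {s..t}" using has_integral_const_real[of "k\<^sup>2" s t] lt by simp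
  qed
  then have "0 \<le> J - (2 * k) * (\<phi> t - \<phi> s) + (t - s) * k\<^sup>2"
  proof (rule has_integral_nonneg)
    fix x
    have "0 \<le> (\<psi> x - k)\<^sup>2" by simp
    then show "0 \<le> \<psi> x * \<psi> x - (2 * k) * \<psi> x + k\<^sup>2" by (simp add: power2_diff power2_eq_square algebra_simps)
  qed
  moreover have "(2 * k) * (\<phi> t - \<phi> s) = 2 * ((t - s) * k\<^sup>2)" using lt by (simp add: k_def power2_eq_square)
  ultimately have "(t - s) * k\<^sup>2 \<le> J" by simp
  then have "(t - s) * ((t - s) * k\<^sup>2) \<le> (t - s) * J" using lt by (intro mult_left_mono) auto
  moreover have "(t - s) * ((t - s) * k\<^sup>2) = (\<phi> t - \<phi> s)\<^sup>2" using lt by (simp add: k_def power2_eq_square)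
  moreover have "J \<le> integral {0..l} (\<lambda>t. \<psi> t * \<psi> t)"
    unfolding J_def by (rule integral_subset_le) (use st int int' in auto)
  then have "(t - s) * J \<le> (t - s) * integral {0..l} (\<lambda>t. \<psi> t * \<psi> t)" using lt by (intro mult_left_mono) auto
  ultimately show ?thesis by linarith
qed auto

text \<open>The value at \<open>t\<close> is compared with the value at every \<open>s\<close>
  through the increment estimate, and the comparison is integrated over \<open>s\<close>.\<close>

lemma value_squared_le:
  assumes l: "0 < l" and \<phi>: "continuous_on {0..l} \<phi>" and S: "finite S" "\<And>t. t \<in> {0<..<l} - S \<Longrightarrow> (\<phi> has_real_derivative \<psi> t) (at t)"
    and \<psi>: "bounded_meas l \<psi>" and t: "t \<in> {0..l}"
  shows "l * (\<phi> t)\<^sup>2 \<le> 2 * integral {0..l} (\<lambda>t. \<phi> t * \<phi> t) + 2 * l * (l * integral {0..l} (\<lambda>t. \<psi> t * \<psi> t))"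
proof -
  define J where "J = integral {0..l} (\<lambda>t. \<psi> t * \<psi> t)"
  have J0: "0 \<le> J" unfolding J_def
    by (intro integral_nonneg bounded_meas_integrable bounded_meas_mult \<psi>) auto
  have le: "(\<phi> t)\<^sup>2 \<le> 2 * (\<phi> s * \<phi> s) + 2 * (l * J)" if s: "s \<in> {0..l}" for s
  proof -
    have "(\<phi> t - \<phi> s)\<^sup>2 \<le> \<bar>t - s\<bar> * J"
      using increment_squared_le[OF \<phi> S \<psi>, of s t] increment_squared_le[OF \<phi> S \<psi>, of t s] s t
      unfolding J_def by (cases "s \<le> t") (auto simp: power2_commute)
    also have "\<dots> \<le> l * J" using s t J0 by (intro mult_right_mono) auto
    finally have "(\<phi> t - \<phi> s)\<^sup>2 \<le> l * J" .
    \<comment> \<open>This square is the difference of the two sides of \<open>(\<phi> t)^2 \<le> 2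
      * (\<phi> s)^2 + 2 * (\<phi> t - \<phi> s)^2\<close>.\<close>
    moreover have "0 \<le> (\<phi> t - 2 * \<phi> s)\<^sup>2" by simp
    ultimately show ?thesis by (simp add: power2_eq_square algebra_simps)
  qed
  have "((\<lambda>s. (\<phi> t)\<^sup>2) has_integral l * (\<phi> t)\<^sup>2) {0..l}" using has_integral_const_real[of "(\<phi> t)\<^sup>2" 0 l] l by simp
  moreover have "((\<lambda>s. 2 * (\<phi> s * \<phi> s) + 2 * (l * J)) has_integral 2 * integral {0..l} (\<lambda>t. \<phi> t * \<phi> t) + l * (2 * (l * J))) {0..l}"
  proof (intro has_integral_add has_integral_mult_right integrable_integral integrable_continuous_real continuous_intros \<phi>)
    show "((\<lambda>s. 2 * (l * J)) has_integral l * (2 * (l * J))) {0..l}" using has_integral_const_real[of "2 * (l * J)" 0 l] l by simp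
  qed
  ultimately have "l * (\<phi> t)\<^sup>2 \<le> 2 * integral {0..l} (\<lambda>t. \<phi> t * \<phi> t) + l * (2 * (l * J))"
    using le by (rule has_integral_le)
  then show ?thesis unfolding J_def by (simp add: algebra_simps)
qed

text \<open>Arzela-Ascoli: the energy bound gives equicontinuity through the increment estimate, and
  combined with the norm bound it bounds the values uniformly.\<close>

lemma bounded_energy_subsequence:
  fixes \<phi> \<psi> :: "nat \<Rightarrow> real \<Rightarrow> real"
  assumes l: "0 < l" and \<phi>: "\<And>n. continuous_on {0..l} (\<phi> n)"
    and d: "\<And>n. \<exists>S. finite S \<and> (\<forall>t\<in>{0<..<l} - S. (\<phi> n has_real_derivative \<psi> n t) (at t))"
    and \<psi>: "\<And>n. bounded_meas l (\<psi> n)"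
    and A: "\<And>n. integral {0..l} (\<lambda>t. \<phi> n t * \<phi> n t) \<le> A" and B: "\<And>n. integral {0..l} (\<lambda>t. \<psi> n t * \<psi> n t) \<le> B"
  shows "\<exists>g k. strict_mono (k :: nat \<Rightarrow> nat) \<and> uniform_limit {0..l} (\<lambda>n. \<phi> (k n)) g sequentially"
proof -
  have B0: "0 \<le> B"
    using order_trans[OF _ B[of 0]] integral_nonneg[OF bounded_meas_integrable[OF bounded_meas_mult[OF \<psi>[of 0] \<psi>[of 0]]]] by simp
  have inc: "(\<phi> n t - \<phi> n s)\<^sup>2 \<le> \<bar>t - s\<bar> * B" if st: "s \<in> {0..l}" "t \<in> {0..l}" for n s t
  proof -
    obtain S where S: "finite S" "\<And>t. t\<in>{0<..<l} - S \<Longrightarrow> (\<phi> n has_real_derivative \<psi> n t) (at t)" using d[of n] by blast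
    have "(\<phi> n t - \<phi> n s)\<^sup>2 \<le> \<bar>t - s\<bar> * integral {0..l} (\<lambda>t. \<psi> n t * \<psi> n t)"
    proof (cases "s \<le> t")
      case True
      then show ?thesis using increment_squared_le[OF \<phi> S \<psi>, of s t] st by simp
    next
      case False
      then show ?thesis using increment_squared_le[OF \<phi> S \<psi>, of t s] st by (simp add: power2_commute[of "\<phi> n t"])
    qed
    also have "\<dots> \<le> \<bar>t - s\<bar> * B" by (intro mult_left_mono B) auto
    finally show ?thesis .
  qed
  define C where "C = (2 * A + 2 * l * (l * B)) / l"
  have val: "(\<phi> n t)\<^sup>2 \<le> C" if "t \<in> {0..l}" for n t
  proof -
    obtain S where S: "finite S" "\<And>t. t\<in>{0<..<l} - S \<Longrightarrow> (\<phi> n has_real_derivative \<psi> n t) (at t)" using d[of n] by blast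
    have "l * (\<phi> n t)\<^sup>2 \<le> 2 * integral {0..l} (\<lambda>t. \<phi> n t * \<phi> n t) + 2 * l * (l * integral {0..l} (\<lambda>t. \<psi> n t * \<psi> n t))"
      by (rule value_squared_le[OF l \<phi> S \<psi> that])
    also have "\<dots> \<le> 2 * A + 2 * l * (l * B)" using A B l by (intro add_mono mult_left_mono) auto
    finally show ?thesis unfolding C_def using l by (simp add: field_simps)
  qed
  have bd: "norm (\<phi> n x) \<le> sqrt C" if "x \<in> {0..l}" for n x
    using real_sqrt_le_mono[OF val[OF that, of n]] by simp
  have eq: "\<exists>d. 0 < d \<and> (\<forall>n y. y \<in> {0..l} \<and> norm (x - y) < d \<longrightarrow> norm (\<phi> n x - \<phi> n y) < e)" if x: "x \<in> {0..l}" and e: "0 < e" for x e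
  \<comment> \<open>\<open>B + 1\<close> in place of \<open>B\<close> keeps the radius meaningful
    when the energy bound is 0.\<close>
  proof (intro exI[of _ "e\<^sup>2 / (B + 1)"] conjI allI impI)
    show "0 < e\<^sup>2 / (B + 1)" using e B0 by simp
    fix n y assume y: "y \<in> {0..l} \<and> norm (x - y) < e\<^sup>2 / (B + 1)"
    have "(\<phi> n x - \<phi> n y)\<^sup>2 \<le> \<bar>x - y\<bar> * B" using inc[of y x n] x y by simp
    also have "\<dots> \<le> \<bar>x - y\<bar> * (B + 1)" by (intro mult_left_mono) auto
    also have "\<dots> < e\<^sup>2" using y B0 by (simp add: field_simps)
    finally have "(norm (\<phi> n x - \<phi> n y))\<^sup>2 < e\<^sup>2" by simp
    then show "norm (\<phi> n x - \<phi> n y) < e" using e by (meson less_imp_le power2_less_imp_less)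
  qed
  obtain g k where "strict_mono (k :: nat \<Rightarrow> nat)"
    "\<And>e. 0 < e \<Longrightarrow> \<exists>N. \<forall>n x. n \<ge> N \<and> x \<in> {0..l} \<longrightarrow> norm (\<phi> (k n) x - g x) < e"
    by (rule Arzela_Ascoli[of "{0..l}" \<phi> "sqrt C", OF compact_Icc bd eq]) blast+
  then show ?thesis unfolding uniform_limit_sequentially_iff dist_norm by blast
qed

lemma quadratic_nonneg_discriminant:
  fixes a b c :: real
  assumes "\<And>\<tau>. 0 \<le> a + 2 * b * \<tau> + c * \<tau>\<^sup>2" "0 \<le> c"
  shows "b\<^sup>2 \<le> a * c"
proof (cases "c = 0")
  case True
  have "b = 0"
  proof (rule ccontr)
    assume "b \<noteq> 0"
    then show False using assms(1)[of "- (a + 1) / (2 * b)"] True by simp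
  qed
  then show ?thesis using True by simp
next
  case False
  then have c: "c > 0" using assms by simp
  have "0 \<le> a + 2 * b * (- b / c) + c * (- b / c)\<^sup>2" by (rule assms(1))
  also have "\<dots> = a - b\<^sup>2 / c" using c by (simp add: power2_eq_square)
  finally show ?thesis using c by (simp add: field_simps)
qed

context schroedinger_graph
begin

lemma W_bound: "\<exists>C\<ge>0. \<forall>e\<in>E. \<forall>t\<in>{0..l e}. \<bar>W e t - m\<bar> \<le> C"
proof -
  have "\<exists>B. \<forall>t\<in>{0..l e}. \<bar>W e t - m\<bar> \<le> B" if "e \<in> E" for e
    using bounded_meas_W[OF that, of m] unfolding bounded_meas_def by blast
  then obtain B where B: "\<And>e t. e \<in> E \<Longrightarrow> t \<in> {0..l e} \<Longrightarrow> \<bar>W e t - m\<bar> \<le> B e" by metis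
  have "\<bar>W e t - m\<bar> \<le> (\<Sum>e\<in>E. \<bar>B e\<bar>)" if "e \<in> E" "t \<in> {0..l e}" for e t
  proof -
    have "\<bar>W e t - m\<bar> \<le> \<bar>B e\<bar>" using B[OF that] by linarith
    also have "\<dots> \<le> (\<Sum>e\<in>E. \<bar>B e\<bar>)" by (rule member_le_sum[OF that(1) _ graphD(2)]) auto
    finally show ?thesis .
  qed
  then show ?thesis by (intro exI[of _ "\<Sum>e\<in>E. \<bar>B e\<bar>"]) (auto intro: sum_nonneg)
qed

section \<open>Limits of minimising sequences on an orthogonal complement\<close>

context
  fixes I :: "'i set" and g :: "'i \<Rightarrow> 'e \<Rightarrow> real \<Rightarrow> real" and D' :: "'i \<Rightarrow> 'e \<Rightarrow> real \<Rightarrow> real"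
    and gv :: "'i \<Rightarrow> 'v \<Rightarrow> real" and mu :: "'i \<Rightarrow> real" and m :: real
    and \<phi> \<psi> :: "nat \<Rightarrow> 'e \<Rightarrow> real \<Rightarrow> real" and p :: "nat \<Rightarrow> 'v \<Rightarrow> real"
  assumes I: "finite I" and g: "\<And>i. i \<in> I \<Longrightarrow> eig (mu i) (g i) (D' i) (gv i)" and gnz: "\<And>i. i \<in> I \<Longrightarrow> nonzero (g i)"
    and go: "\<And>i j. i \<in> I \<Longrightarrow> j \<in> I \<Longrightarrow> i \<noteq> j \<Longrightarrow> ip (g i) (g j) = 0"
    and m: "\<And>\<eta> \<theta> s. form \<eta> \<theta> s \<Longrightarrow> (\<And>i. i \<in> I \<Longrightarrow> ip \<eta> (g i) = 0) \<Longrightarrow> 0 \<le> qf m \<eta> \<theta> \<eta> \<theta>"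
    and fm: "\<And>n. form (\<phi> n) (\<psi> n) (p n)" and orth: "\<And>n i. i \<in> I \<Longrightarrow> ip (\<phi> n) (g i) = 0"
    and norm1: "\<And>n. ip (\<phi> n) (\<phi> n) = 1" and min: "(\<lambda>n. qf m (\<phi> n) (\<psi> n) (\<phi> n) (\<psi> n)) \<longlonglongrightarrow> 0"
begin

text \<open>This is Cauchy-Schwarz for the form, which is assumed nonnegative only on the complement
  of the \<open>g i\<close>. Subtracting from \<open>\<eta>\<close> its projection \<open>G\<close>
  onto their span moves it into the complement and leaves its form with \<open>\<phi> n\<close>
  unchanged, since each \<open>g i\<close> is an eigenfunction orthogonal to
  \<open>\<phi> n\<close>.\<close>

lemma minimising_weak:
  assumes \<eta>: "form \<eta> \<theta> s"
  shows "(\<lambda>n. qf m (\<phi> n) (\<psi> n) \<eta> \<theta>) \<longlonglongrightarrow> 0"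
proof -
  define c where "c i = ip \<eta> (g i) / ip (g i) (g i)" for i
  define G where "G e t = (\<Sum>i\<in>I. c i * g i e t)" for e t
  define G1 where "G1 e t = (\<Sum>i\<in>I. c i * D' i e t)" for e t
  define Gv where "Gv v = (\<Sum>i\<in>I. c i * gv i v)" for v
  have fG: "form G G1 Gv" unfolding G_def G1_def Gv_def by (rule form_sum[OF I]) (use form_eig[OF g] in auto)
  define \<eta>' where "\<eta>' e t = \<eta> e t + (-1) * G e t" for e t
  define \<theta>' where "\<theta>' e t = \<theta> e t + (-1) * G1 e t" for e t
  define s' where "s' v = s v + (-1) * Gv v" for v
  have f': "form \<eta>' \<theta>' s'" unfolding \<eta>'_def \<theta>'_def s'_def by (rule form_add[OF \<eta> fG])
  have ipG: "ip G \<zeta> = (\<Sum>i\<in>I. c i * ip (g i) \<zeta>)" if "form \<zeta> \<zeta>' z" for \<zeta> \<zeta>' z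
    unfolding G_def[abs_def] by (rule ip_sum[OF I _ that]) (use form_eig[OF g] in auto)
  have o': "ip \<eta>' (g j) = 0" if j: "j \<in> I" for j
  proof -
    have "(\<Sum>i\<in>I. c i * ip (g i) (g j)) = (\<Sum>i\<in>I. if i = j then ip \<eta> (g j) else 0)"
      using go[OF _ j] ip_self_pos[OF form_eig[OF g[OF j]] gnz[OF j]] by (intro sum.cong) (auto simp: c_def)
    then have "ip G (g j) = ip \<eta> (g j)" using ipG[OF form_eig[OF g[OF j]]] I j by simp
    then show ?thesis unfolding \<eta>'_def[abs_def] using ip_add[OF \<eta> fG form_eig[OF g[OF j]], of "-1"] by simp
  qed
  define q where "q n = qf m (\<phi> n) (\<psi> n) \<eta> \<theta>" for n
  define Q where "Q n = qf m (\<phi> n) (\<psi> n) (\<phi> n) (\<psi> n)" for n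
  define Q' where "Q' = qf m \<eta>' \<theta>' \<eta>' \<theta>'"
  have q: "qf m \<eta>' \<theta>' (\<phi> n) (\<psi> n) = q n" for n
  proof -
    have "qf m G G1 (\<phi> n) (\<psi> n) = (\<Sum>i\<in>I. c i * qf m (g i) (D' i) (\<phi> n) (\<psi> n))"
      unfolding G_def[abs_def] G1_def[abs_def] by (rule qf_sum[OF I _ fm]) (use form_eig[OF g] in auto)
    also have "\<dots> = 0"
    proof (rule sum.neutral, rule ballI)
      fix i assume i: "i \<in> I"
      have "qf m (\<phi> n) (\<psi> n) (g i) (D' i) = 0" using qf_eig[OF fm g[OF i], of m n] orth[OF i] by simp
      then show "c i * qf m (g i) (D' i) (\<phi> n) (\<psi> n) = 0" using qf_commute[of m "g i" "D' i"] by simp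
    qed
    finally show ?thesis unfolding \<eta>'_def[abs_def] \<theta>'_def[abs_def] q_def
      using qf_add[OF \<eta> fG fm, of m "-1" n] qf_commute[of m \<eta> \<theta> "\<phi> n" "\<psi> n"] by simp
  qed
  have Q'0: "0 \<le> Q'" unfolding Q'_def by (rule m[OF f' o'])
  have "(q n)\<^sup>2 \<le> Q n * Q'" for n
  proof (rule quadratic_nonneg_discriminant[OF _ Q'0])
    fix \<tau> :: real
    define \<zeta> where "\<zeta> e t = \<phi> n e t + \<tau> * \<eta>' e t" for e t
    define \<zeta>' where "\<zeta>' e t = \<psi> n e t + \<tau> * \<theta>' e t" for e t
    have fz: "form \<zeta> \<zeta>' (\<lambda>v. p n v + \<tau> * s' v)" unfolding \<zeta>_def \<zeta>'_def by (rule form_add[OF fm f'])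
    have "0 \<le> qf m \<zeta> \<zeta>' \<zeta> \<zeta>'"
    proof (rule m[OF fz])
      fix i assume i: "i \<in> I"
      show "ip \<zeta> (g i) = 0" unfolding \<zeta>_def[abs_def] using ip_add[OF fm f' form_eig[OF g[OF i]], of n \<tau>] orth[OF i] o'[OF i] by simp
    qed
    also have "qf m \<zeta> \<zeta>' \<zeta> \<zeta>' = qf m (\<phi> n) (\<psi> n) \<zeta> \<zeta>' + \<tau> * qf m \<eta>' \<theta>' \<zeta> \<zeta>'"
      unfolding \<zeta>_def[abs_def] \<zeta>'_def[abs_def]
      by (rule qf_add[OF fm f' fz[unfolded \<zeta>_def[abs_def] \<zeta>'_def[abs_def]]])
    also have "qf m (\<phi> n) (\<psi> n) \<zeta> \<zeta>' = Q n + \<tau> * q n"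
    proof -
      have "qf m \<zeta> \<zeta>' (\<phi> n) (\<psi> n) = qf m (\<phi> n) (\<psi> n) (\<phi> n) (\<psi> n) + \<tau> * qf m \<eta>' \<theta>' (\<phi> n) (\<psi> n)"
        unfolding \<zeta>_def[abs_def] \<zeta>'_def[abs_def] by (rule qf_add[OF fm f' fm])
      then show ?thesis unfolding q Q_def by (subst qf_commute)
    qed
    also have "qf m \<eta>' \<theta>' \<zeta> \<zeta>' = q n + \<tau> * Q'"
    proof -
      have "qf m \<zeta> \<zeta>' \<eta>' \<theta>' = qf m (\<phi> n) (\<psi> n) \<eta>' \<theta>' + \<tau> * qf m \<eta>' \<theta>' \<eta>' \<theta>'"
        unfolding \<zeta>_def[abs_def] \<zeta>'_def[abs_def] by (rule qf_add[OF fm f' f'])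
      then show ?thesis unfolding Q'_def q[symmetric] using qf_commute by metis
    qed
    finally show "0 \<le> Q n + 2 * q n * \<tau> + Q' * \<tau>\<^sup>2" by (simp add: power2_eq_square algebra_simps)
  qed
  then have sq: "norm ((q n)\<^sup>2) \<le> Q n * Q'" for n by simp
  have "(\<lambda>n. Q n * Q') \<longlonglongrightarrow> 0 * Q'" unfolding Q_def by (intro tendsto_mult min tendsto_const)
  then have "(\<lambda>n. (q n)\<^sup>2) \<longlonglongrightarrow> 0"
    by (intro Lim_null_comparison[of "\<lambda>n. (q n)\<^sup>2" "\<lambda>n. Q n * Q'"]) (use sq in auto)
  then have "(\<lambda>n. sqrt ((q n)\<^sup>2)) \<longlonglongrightarrow> sqrt 0" by (rule tendsto_real_sqrt)
  then show ?thesis unfolding q_def by (simp add: tendsto_rabs_zero_iff)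
qed

text \<open>The potential term is at most \<open>C\<close> times the squared norm 1 in absolute
  value, so bounded form values bound the energy.\<close>

lemma minimising_energy: "\<exists>K. \<forall>n. \<forall>e\<in>E. integral {0..l e} (\<lambda>t. \<psi> n e t * \<psi> n e t) \<le> K"
proof -
  obtain C where C: "C \<ge> 0" "\<And>e t. e \<in> E \<Longrightarrow> t \<in> {0..l e} \<Longrightarrow> \<bar>W e t - m\<bar> \<le> C" using W_bound by blast
  have "Bseq (\<lambda>n. qf m (\<phi> n) (\<psi> n) (\<phi> n) (\<psi> n))" using min convergent_imp_Bseq convergentI by blast
  then obtain K where K: "\<And>n. \<bar>qf m (\<phi> n) (\<psi> n) (\<phi> n) (\<psi> n)\<bar> \<le> K" unfolding Bseq_def by auto
  have "integral {0..l e} (\<lambda>t. \<psi> n e t * \<psi> n e t) \<le> K + C" if e: "e \<in> E" for n e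
  proof -
    have le: "integral {0..l e} (\<lambda>t. \<psi> n e t * \<psi> n e t) \<le>
        integral {0..l e} (\<lambda>t. \<psi> n e t * \<psi> n e t + (W e t - m) * (\<phi> n e t * \<phi> n e t)) + C * integral {0..l e} (\<lambda>t. \<phi> n e t * \<phi> n e t)"
      if e: "e \<in> E" for e
    proof -
      note i = form_integrable[OF fm fm e, of n n]
      have "integral {0..l e} (\<lambda>t. \<psi> n e t * \<psi> n e t) \<le>
         integral {0..l e} (\<lambda>t. (\<psi> n e t * \<psi> n e t + (W e t - m) * (\<phi> n e t * \<phi> n e t)) + C * (\<phi> n e t * \<phi> n e t))"
      proof (rule integral_le[OF i(2)])
        show "(\<lambda>t. (\<psi> n e t * \<psi> n e t + (W e t - m) * (\<phi> n e t * \<phi> n e t)) + C * (\<phi> n e t * \<phi> n e t)) integrable_on {0..l e}"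
          by (intro integrable_add[OF i(4)] integrable_on_mult_right i(1))
        fix t assume t: "t \<in> {0..l e}"
        have "0 \<le> ((W e t - m) + C) * (\<phi> n e t * \<phi> n e t)" by (rule mult_nonneg_nonneg[OF _ zero_le_square]) (use C(2)[OF e t] in auto)
        then show "\<psi> n e t * \<psi> n e t \<le> (\<psi> n e t * \<psi> n e t + (W e t - m) * (\<phi> n e t * \<phi> n e t)) + C * (\<phi> n e t * \<phi> n e t)"
          by (simp add: algebra_simps)
      qed
      also have "\<dots> = integral {0..l e} (\<lambda>t. \<psi> n e t * \<psi> n e t + (W e t - m) * (\<phi> n e t * \<phi> n e t)) + integral {0..l e} (\<lambda>t. C * (\<phi> n e t * \<phi> n e t))"
        by (intro integral_add i(4) integrable_on_mult_right i(1))
      finally show ?thesis by simp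
    qed
    have "integral {0..l e} (\<lambda>t. \<psi> n e t * \<psi> n e t) \<le> (\<Sum>e\<in>E. integral {0..l e} (\<lambda>t. \<psi> n e t * \<psi> n e t))"
      by (rule member_le_sum[OF e _ graphD(2)]) (auto intro!: integral_nonneg form_integrable(2)[OF fm fm])
    also have "\<dots> \<le> (\<Sum>e\<in>E. integral {0..l e} (\<lambda>t. \<psi> n e t * \<psi> n e t + (W e t - m) * (\<phi> n e t * \<phi> n e t)) + C * integral {0..l e} (\<lambda>t. \<phi> n e t * \<phi> n e t))"
      by (rule sum_mono[OF le])
    also have "\<dots> = qf m (\<phi> n) (\<psi> n) (\<phi> n) (\<psi> n) + C * ip (\<phi> n) (\<phi> n)"
      unfolding qf_def ip_def by (simp add: sum.distrib sum_distrib_left)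
    also have "\<dots> \<le> K + C" using K[of n] norm1[of n] by simp
    finally show ?thesis .
  qed
  then show ?thesis by blast
qed

lemma minimising_subsequence:
  "\<exists>r u. strict_mono (r :: nat \<Rightarrow> nat) \<and> (\<forall>e\<in>E. uniform_limit {0..l e} (\<lambda>n. \<phi> (r n) e) (u e) sequentially)"
proof -
  obtain K where K: "\<And>n e. e \<in> E \<Longrightarrow> integral {0..l e} (\<lambda>t. \<psi> n e t * \<psi> n e t) \<le> K" using minimising_energy by blast
  have N: "integral {0..l e} (\<lambda>t. \<phi> n e t * \<phi> n e t) \<le> 1" if "e \<in> E" for n e
  proof -
    have "integral {0..l e} (\<lambda>t. \<phi> n e t * \<phi> n e t) \<le> ip (\<phi> n) (\<phi> n)" unfolding ip_def
      by (rule member_le_sum[OF that _ graphD(2)]) (auto intro!: integral_nonneg form_integrable(1)[OF fm fm])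
    then show ?thesis by (simp add: norm1)
  qed
  have "\<exists>r u. strict_mono (r :: nat \<Rightarrow> nat) \<and> (\<forall>e\<in>A. uniform_limit {0..l e} (\<lambda>n. \<phi> (r n) e) (u e) sequentially)"
    if "finite A" "A \<subseteq> E" for A
    using that
  proof (induction A rule: finite_induct)
    case empty
    show ?case by (intro exI[of _ id]) (auto simp: strict_mono_def)
  next
    case (insert e A)
    then obtain r u where r: "strict_mono (r :: nat \<Rightarrow> nat)" "\<And>e. e \<in> A \<Longrightarrow> uniform_limit {0..l e} (\<lambda>n. \<phi> (r n) e) (u e) sequentially" by blast
    have e: "e \<in> E" using insert by auto
    have "\<exists>g k. strict_mono (k :: nat \<Rightarrow> nat) \<and> uniform_limit {0..l e} (\<lambda>n. \<phi> (r (k n)) e) g sequentially"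
      by (rule bounded_energy_subsequence[of "l e" "\<lambda>n. \<phi> (r n) e" "\<lambda>n. \<psi> (r n) e" 1 K])
        (use graphD(6)[OF e] formD(1,3,6)[OF fm e] N[OF e] K[OF e] in auto)
    then obtain h k where k: "strict_mono (k :: nat \<Rightarrow> nat)" "uniform_limit {0..l e} (\<lambda>n. \<phi> (r (k n)) e) h sequentially" by blast
    have sub: "uniform_limit {0..l e'} (\<lambda>n. \<phi> (r (k n)) e') (u e') sequentially" if "e' \<in> A" for e'
    proof -
      have "filterlim k sequentially sequentially" using k(1) by (rule filterlim_subseq)
      from filterlim_compose[OF r(2)[OF that] this] show ?thesis by simp
    qed
    have "strict_mono (\<lambda>n. r (k n))" using strict_mono_o[OF r(1) k(1)] by (simp add: o_def)
    then show ?case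
      using k(2) sub insert.hyps by (intro exI[of _ "\<lambda>n. r (k n)"] exI[of _ "u(e := h)"]) auto
  qed
  then show ?thesis using graphD(2) by blast
qed

text \<open>Convergence of the derivatives \<open>\<psi> n\<close> is not at hand, so they are moved
  onto twice differentiable test functions before the limit is taken. Test functions on one edge
  give the equation, hat functions at a vertex give Kirchhoff. The pointwise limit is recorded in
  order to identify \<open>u\<close> when the sequence is constant.\<close>

theorem minimiser_eigenfunction:
  "\<exists>u D uv r. eig m u D uv \<and> ip u u = 1 \<and> (\<forall>i\<in>I. ip u (g i) = 0) \<and> strict_mono (r :: nat \<Rightarrow> nat) \<and>
     (\<forall>e\<in>E. \<forall>t\<in>{0..l e}. (\<lambda>n. \<phi> (r n) e t) \<longlonglongrightarrow> u e t)"
proof -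
  obtain r u where r: "strict_mono (r :: nat \<Rightarrow> nat)"
    and u: "\<And>e. e \<in> E \<Longrightarrow> uniform_limit {0..l e} (\<lambda>n. \<phi> (r n) e) (u e) sequentially"
    using minimising_subsequence by blast
  have ct: "continuous_on {0..l e} (\<phi> n e)" if "e \<in> E" for n e using formD(1)[OF fm that] .
  have cu: "continuous_on {0..l e} (u e)" if "e \<in> E" for e
    by (rule uniform_limit_theorem[OF _ u[OF that]]) (use ct[OF that] in \<open>auto simp: always_eventually\<close>)
  have lim: "(\<lambda>n. \<phi> (r n) e t) \<longlonglongrightarrow> u e t" if "e \<in> E" "t \<in> {0..l e}" for e t
    using tendsto_uniform_limitI[OF u[OF that(1)] that(2)] .
  have lim0: "(\<lambda>n. p (r n) (src e)) \<longlonglongrightarrow> u e 0" "(\<lambda>n. p (r n) (tgt e)) \<longlonglongrightarrow> u e (l e)" if "e \<in> E" for e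
    using lim[OF that, of 0] lim[OF that, of "l e"] formD(4,5)[OF fm that] graphD(6)[OF that] by auto
  \<comment> \<open>Every vertex is an end of some edge, where the values converge, so this limit
    exists.\<close>
  define uv where "uv v = Topological_Spaces.lim (\<lambda>n. p (r n) v)" for v
  have uvc: "vertex_cont uv u"
    unfolding vertex_cont_def
  proof (intro conjI ballI)
    fix e assume "e \<in> E"
    then show "u e 0 = uv (src e)" "u e (l e) = uv (tgt e)" unfolding uv_def using lim0 limI by metis+
  next
    fix v assume "v \<in> Vb"
    then have "p (r n) v = 0" for n using fm[of "r n"] unfolding form_def vertex_cont_def by blast
    then show "uv v = 0" unfolding uv_def by (simp add: limI)
  qed
  have weak: "(\<Sum>e\<in>E. u e (l e) * \<theta> e (l e) - u e 0 * \<theta> e 0 - integral {0..l e} (\<lambda>t. u e t * h e t) +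
        integral {0..l e} (\<lambda>t. (W e t - m) * (u e t * \<eta> e t))) = 0"
    if \<eta>: "\<And>e t. e \<in> E \<Longrightarrow> t \<in> {0..l e} \<Longrightarrow> (\<eta> e has_real_derivative \<theta> e t) (at t within {0..l e})"
      and \<theta>: "\<And>e t. e \<in> E \<Longrightarrow> t \<in> {0..l e} \<Longrightarrow> (\<theta> e has_real_derivative h e t) (at t within {0..l e})"
      and h: "\<And>e. e \<in> E \<Longrightarrow> continuous_on {0..l e} (h e)" and s: "vertex_cont s \<eta>" for \<eta> \<theta> h s
  proof -
    have c: "continuous_on {0..l e} (\<eta> e)" "continuous_on {0..l e} (\<theta> e)" if "e \<in> E" for e
      using derivative_Icc_continuous[of "l e" "\<eta> e" "\<theta> e"] derivative_Icc_continuous[of "l e" "\<theta> e" "h e"] \<eta>[OF that] \<theta>[OF that] by auto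
    have "\<exists>S. finite S \<and> (\<forall>t\<in>{0<..<l e} - S. (\<eta> e has_real_derivative \<theta> e t) (at t))" if "e \<in> E" for e
      using derivative_Icc_interior[OF \<eta>[OF that]] by (intro exI[of _ "{}"]) auto
    then have f\<eta>: "form \<eta> \<theta> s" unfolding form_def using c bounded_meas_continuous s by auto
    have "(\<lambda>n. qf m (\<phi> (r n)) (\<psi> (r n)) \<eta> \<theta>) \<longlonglongrightarrow> 0"
      using LIMSEQ_subseq_LIMSEQ[OF minimising_weak[OF f\<eta>] r] by (simp add: o_def)
    moreover have "(\<lambda>n. qf m (\<phi> (r n)) (\<psi> (r n)) \<eta> \<theta>) \<longlonglongrightarrow>
       (\<Sum>e\<in>E. u e (l e) * \<theta> e (l e) - u e 0 * \<theta> e 0 - integral {0..l e} (\<lambda>t. u e t * h e t) +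
        integral {0..l e} (\<lambda>t. (W e t - m) * (u e t * \<eta> e t)))"
      unfolding qf_def
    proof (rule tendsto_sum)
      fix e assume e: "e \<in> E"
      have eq: "integral {0..l e} (\<lambda>t. \<psi> n e t * \<theta> e t + (W e t - m) * (\<phi> n e t * \<eta> e t)) =
         \<phi> n e (l e) * \<theta> e (l e) - \<phi> n e 0 * \<theta> e 0 - integral {0..l e} (\<lambda>t. \<phi> n e t * h e t)
         + integral {0..l e} (\<lambda>t. \<phi> n e t * ((W e t - m) * \<eta> e t))" for n
      proof -
        obtain S where S: "finite S" "\<And>t. t\<in>{0<..<l e} - S \<Longrightarrow> (\<phi> n e has_real_derivative \<psi> n e t) (at t)"
          using formD(6)[OF fm e, of n] by blast
        have "integral {0..l e} (\<lambda>t. \<psi> n e t * \<theta> e t + (W e t - m) * (\<phi> n e t * \<eta> e t)) =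
          integral {0..l e} (\<lambda>t. \<psi> n e t * \<theta> e t) + integral {0..l e} (\<lambda>t. (W e t - m) * (\<phi> n e t * \<eta> e t))"
          by (rule integral_add[OF form_integrable(2,3)[OF fm f\<eta> e]])
        moreover have "integral {0..l e} (\<lambda>t. \<psi> n e t * \<theta> e t) = \<phi> n e (l e) * \<theta> e (l e) - \<phi> n e 0 * \<theta> e 0 - integral {0..l e} (\<lambda>t. \<phi> n e t * h e t)"
          by (rule integration_by_parts_Icc[OF graphD(6)[OF e] ct[OF e] S \<theta>[OF e] h[OF e]])
        moreover have "(\<lambda>t. (W e t - m) * (\<phi> n e t * \<eta> e t)) = (\<lambda>t. \<phi> n e t * ((W e t - m) * \<eta> e t))" by (auto simp: algebra_simps)
        ultimately show ?thesis by simp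
      qed
      have i: "(\<lambda>n. integral {0..l e} (\<lambda>t. \<phi> (r n) e t * k t)) \<longlonglongrightarrow> integral {0..l e} (\<lambda>t. u e t * k t)"
        if "continuous_on {0..l e} k" for k
        by (rule integral_mult_tendsto[OF u[OF e] uniform_limit_const ct[OF e] that])
      have "integral {0..l e} (\<lambda>t. (W e t - m) * (u e t * \<eta> e t)) = integral {0..l e} (\<lambda>t. u e t * ((W e t - m) * \<eta> e t))"
        by (rule arg_cong[where f = "integral {0..l e}"]) (auto simp: algebra_simps)
      then show "(\<lambda>n. integral {0..l e} (\<lambda>t. \<psi> (r n) e t * \<theta> e t + (W e t - m) * (\<phi> (r n) e t * \<eta> e t))) \<longlonglongrightarrow>
        u e (l e) * \<theta> e (l e) - u e 0 * \<theta> e 0 - integral {0..l e} (\<lambda>t. u e t * h e t) +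
        integral {0..l e} (\<lambda>t. (W e t - m) * (u e t * \<eta> e t))"
        unfolding eq using graphD(6)[OF e]
        by (simp only:) (intro tendsto_add tendsto_diff tendsto_mult tendsto_const lim[OF e] i h[OF e] continuous_intros c[OF e] W_cont[OF e]; simp)
    qed
    ultimately show ?thesis using LIMSEQ_unique by blast
  qed
  have "\<forall>e\<in>E. \<exists>D. \<forall>t\<in>{0..l e}. (u e has_real_derivative D t) (at t within {0..l e}) \<and> (D has_real_derivative (W e t - m) * u e t) (at t within {0..l e})"
  proof
    fix e assume e: "e \<in> E"
    show "\<exists>D. \<forall>t\<in>{0..l e}. (u e has_real_derivative D t) (at t within {0..l e}) \<and> (D has_real_derivative (W e t - m) * u e t) (at t within {0..l e})"
    proof (rule weak_solution_regular[OF graphD(6)[OF e] cu[OF e]])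
      show "continuous_on {0..l e} (\<lambda>t. (W e t - m) * u e t)" by (intro continuous_intros W_cont[OF e] cu[OF e])
      fix \<eta> \<theta> h :: "real \<Rightarrow> real"
      assume h: "continuous_on {0..l e} h" and d: "\<And>t. t \<in> {0..l e} \<Longrightarrow> (\<eta> has_real_derivative \<theta> t) (at t within {0..l e})"
        "\<And>t. t \<in> {0..l e} \<Longrightarrow> (\<theta> has_real_derivative h t) (at t within {0..l e})" and z: "\<eta> 0 = 0" "\<eta> (l e) = 0"
      \<comment> \<open>Extension by zero off the edge \<open>e\<close>; it is continuous on the
        graph because the test function vanishes at both ends.\<close>
      define ex where "ex f e' = (if e' = e then f else (\<lambda>_. 0))" for f :: "real \<Rightarrow> real" and e'
      have vc: "vertex_cont (\<lambda>_. 0) (ex \<eta>)" using z by (auto simp: ex_def vertex_cont_def)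
      have "(\<Sum>e'\<in>E. u e' (l e') * ex \<theta> e' (l e') - u e' 0 * ex \<theta> e' 0 - integral {0..l e'} (\<lambda>t. u e' t * ex h e' t) +
          integral {0..l e'} (\<lambda>t. (W e' t - m) * (u e' t * ex \<eta> e' t))) = 0"
        by (rule weak[OF _ _ _ vc]) (use d h in \<open>auto simp: ex_def\<close>)
      also have "(\<Sum>e'\<in>E. u e' (l e') * ex \<theta> e' (l e') - u e' 0 * ex \<theta> e' 0 - integral {0..l e'} (\<lambda>t. u e' t * ex h e' t) +
          integral {0..l e'} (\<lambda>t. (W e' t - m) * (u e' t * ex \<eta> e' t))) =
         (\<Sum>e'\<in>E. if e' = e then u e (l e) * \<theta> (l e) - u e 0 * \<theta> 0 - integral {0..l e} (\<lambda>t. u e t * h t) +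
          integral {0..l e} (\<lambda>t. (W e t - m) * (u e t * \<eta> t)) else 0)"
        by (rule sum.cong) (auto simp: ex_def)
      finally show "u e (l e) * \<theta> (l e) - u e 0 * \<theta> 0 - integral {0..l e} (\<lambda>t. u e t * h t) + integral {0..l e} (\<lambda>t. (W e t - m) * u e t * \<eta> t) = 0"
        using e graphD(2) by (simp add: mult.assoc)
    qed
  qed
  from bchoice[OF this] obtain D where D: "\<And>e t. e \<in> E \<Longrightarrow> t \<in> {0..l e} \<Longrightarrow> (u e has_real_derivative D e t) (at t within {0..l e})"
    "\<And>e t. e \<in> E \<Longrightarrow> t \<in> {0..l e} \<Longrightarrow> (D e has_real_derivative (W e t - m) * u e t) (at t within {0..l e})" by blast
  have "kirchhoff D"
    unfolding kirchhoff_def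
  proof
    fix v assume v: "v \<in> Vi"
    \<comment> \<open>The hat function is 1 at \<open>v\<close>, 0 at the other vertices and affine
      on each edge, so its second derivative is 0. On a loop at \<open>v\<close> it is the constant
      1.\<close>
    define s where "s w = (if w = v then 1 else 0 :: real)" for w
    define \<eta> where "\<eta> e t = s (src e) + (s (tgt e) - s (src e)) / l e * t" for e t
    define \<theta> where "\<theta> e t = (s (tgt e) - s (src e)) / l e" for e and t :: real
    have \<eta>: "(\<eta> e has_real_derivative \<theta> e t) (at t within {0..l e})" for e t
    proof -
      have "((\<lambda>t. s (src e) + k * t) has_real_derivative k) (at t within {0..l e})" for k
        by (auto intro!: derivative_eq_intros)
      then show ?thesis unfolding \<eta>_def \<theta>_def .
    qed
    have \<theta>: "(\<theta> e has_real_derivative 0) (at t within {0..l e})" for e t unfolding \<theta>_def by (rule DERIV_const)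
    have s: "vertex_cont s \<eta>"
    proof -
      have "v \<notin> Vb" using V_split v by blast
      moreover have "l e \<noteq> 0" if "e \<in> E" for e using graphD(6)[OF that] by simp
      ultimately show ?thesis unfolding vertex_cont_def \<eta>_def by (auto simp: s_def)
    qed
    have 0: "(\<Sum>e\<in>E. u e (l e) * \<theta> e (l e) - u e 0 * \<theta> e 0 - integral {0..l e} (\<lambda>t. u e t * 0) +
        integral {0..l e} (\<lambda>t. (W e t - m) * (u e t * \<eta> e t))) = 0"
      by (rule weak[OF \<eta> \<theta> _ s]) auto
    have "u e (l e) * \<theta> e (l e) - u e 0 * \<theta> e 0 - integral {0..l e} (\<lambda>t. u e t * 0) +
        integral {0..l e} (\<lambda>t. (W e t - m) * (u e t * \<eta> e t)) = s (tgt e) * D e (l e) - s (src e) * D e 0" if e: "e \<in> E" for e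
    proof -
      have cD: "continuous_on {0..l e} (D e)" by (rule derivative_Icc_continuous) (rule D(2)[OF e])
      have c\<theta>: "continuous_on {0..l e} (\<theta> e)" unfolding \<theta>_def by (intro continuous_intros)
      have "integral {0..l e} (\<lambda>t. ((W e t - m) * u e t) * \<eta> e t) = D e (l e) * \<eta> e (l e) - D e 0 * \<eta> e 0 - integral {0..l e} (\<lambda>t. D e t * \<theta> e t)"
        by (rule integration_by_parts_Icc[OF graphD(6)[OF e] cD, of "{}"]) (use derivative_Icc_interior[OF D(2)[OF e]] \<eta> c\<theta> in auto)
      moreover have "integral {0..l e} (\<lambda>t. D e t * \<theta> e t) = u e (l e) * \<theta> e (l e) - u e 0 * \<theta> e 0 - integral {0..l e} (\<lambda>t. u e t * 0)"
        by (rule integration_by_parts_Icc[OF graphD(6)[OF e] cu[OF e], of "{}"]) (use derivative_Icc_interior[OF D(1)[OF e]] \<theta> in auto)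
      moreover have "\<eta> e (l e) = s (tgt e)" "\<eta> e 0 = s (src e)" using s e unfolding vertex_cont_def by auto
      ultimately show ?thesis by (simp add: mult.assoc mult.commute[of "D e _"])
    qed
    then have "0 = (\<Sum>e\<in>E. - (s (src e) * D e 0) + s (tgt e) * D e (l e))" using 0 by simp
    also have "\<dots> = (\<Sum>w\<in>V. hsum w (\<lambda>e. - (s (src e) * D e 0)) (\<lambda>e. s (tgt e) * D e (l e)))" by (rule sum_hsum[symmetric])
    also have "\<dots> = (\<Sum>w\<in>V. if w = v then - hsum v (\<lambda>e. D e 0) (\<lambda>e. - D e (l e)) else 0)"
      by (rule sum.cong) (auto simp: s_def sum_negf)
    also have "\<dots> = - hsum v (\<lambda>e. D e 0) (\<lambda>e. - D e (l e))" using v graphD(1) by (simp add: inner_vertices_def)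
    finally show "hsum v (\<lambda>e. D e 0) (\<lambda>e. - D e (l e)) = 0" by simp
  qed
  then have "eig m u D uv" unfolding eig_def using D uvc by auto
  moreover have "ip u u = 1"
  proof -
    have "(\<lambda>n. ip (\<phi> (r n)) (\<phi> (r n))) \<longlonglongrightarrow> ip u u"
      unfolding ip_def by (intro tendsto_sum integral_mult_tendsto u ct)
    then show ?thesis unfolding norm1 using LIMSEQ_const_iff by metis
  qed
  moreover have "ip u (g i) = 0" if i: "i \<in> I" for i
  proof -
    have "(\<lambda>n. ip (\<phi> (r n)) (g i)) \<longlonglongrightarrow> ip u (g i)"
      unfolding ip_def using eigD(5)[OF g[OF i]]
      by (intro tendsto_sum integral_mult_tendsto u ct uniform_limit_const) auto
    then show ?thesis unfolding orth[OF i] using LIMSEQ_const_iff by metis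
  qed
  ultimately show ?thesis using r lim by blast
qed

end

end

subsection \<open>The upper bound for eigenfunctions\<close>

text \<open>This indexes the piece of an edge that contains \<open>t\<close>. A zero is counted with
  the piece on its left, which is harmless because the function vanishes there.\<close>

definition zeros_before :: "real set \<Rightarrow> real \<Rightarrow> nat" where
  "zeros_before Z t = card {z\<in>Z. z < t}"

lemma zeros_before_locally_constant:
  assumes "finite Z" "t \<notin> Z"
  shows "\<exists>\<delta>>0. \<forall>y. \<bar>y - t\<bar> < \<delta> \<longrightarrow> zeros_before Z y = zeros_before Z t"
proof -
  obtain \<epsilon> where \<epsilon>: "\<epsilon> > 0" "\<And>x y. x \<in> insert t Z \<Longrightarrow> y \<in> insert t Z \<Longrightarrow> x \<noteq> y \<Longrightarrow> \<epsilon> \<le> \<bar>x - y\<bar>"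
    using finite_real_separation[of "insert t Z"] assms(1) by (metis finite_insert)
  have "zeros_before Z y = zeros_before Z t" if y: "\<bar>y - t\<bar> < \<epsilon>" for y
  proof -
    have "z < y \<longleftrightarrow> z < t" if "z \<in> Z" for z
      using \<epsilon>(2)[of z t] that assms(2) y by (cases "z = t") auto
    then show ?thesis unfolding zeros_before_def by (metis (no_types, lifting) Collect_cong)
  qed
  then show ?thesis using \<epsilon>(1) by blast
qed

text \<open>Every piece contains a point off the zeros, so a nonzero factor on any piece makes the
  broken function nonzero.\<close>

lemma zeros_before_surj:
  assumes Z: "finite Z" "Z \<subseteq> {0<..<l}" and l: "0 < l" and j: "j \<le> card Z"
  shows "\<exists>t. 0 < t \<and> t < l \<and> t \<notin> Z \<and> zeros_before Z t = j"
  using j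
proof (induction j)
  case 0
  define b where "b = Min (insert l Z)"
  have b: "b \<in> insert l Z" "\<And>z. z \<in> Z \<Longrightarrow> b \<le> z" unfolding b_def using Z(1) Min_in[of "insert l Z"] by auto
  have "0 < b" "b \<le> l" using b Z(2) l by (auto simp: b_def Z(1))
  moreover have "{z\<in>Z. z < b / 2} = {}" using b(2) calculation by force
  moreover have "b / 2 \<notin> Z" using b(2)[of "b / 2"] calculation by auto
  ultimately have "zeros_before Z (b / 2) = 0" "0 < b / 2" "b / 2 < l" "b / 2 \<notin> Z"
    using l unfolding zeros_before_def by (simp_all only: card.empty) auto
  then show ?case by blast
next
  case (Suc j)
  then obtain t where t: "0 < t" "t < l" "t \<notin> Z" "zeros_before Z t = j" by auto
  define A where "A = {z\<in>Z. t < z}"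
  have fA: "finite A" using Z(1) by (simp add: A_def)
  have "A \<noteq> {}"
  proof
    assume "A = {}"
    have "z < t" if "z \<in> Z" for z
    proof -
      have "\<not> t < z" using \<open>A = {}\<close> that by (auto simp: A_def)
      moreover have "z \<noteq> t" using that t(3) by auto
      ultimately show ?thesis by simp
    qed
    then have "{z\<in>Z. z < t} = Z" by auto
    then show False using t(4) Suc(2) unfolding zeros_before_def by simp
  qed
  define z where "z = Min A"
  have z: "z \<in> Z" "t < z" "\<And>w. w \<in> Z \<Longrightarrow> t < w \<Longrightarrow> z \<le> w"
    using Min_in[OF fA \<open>A \<noteq> {}\<close>] Min_le[OF fA] unfolding z_def by (auto simp: A_def)
  define b where "b = Min (insert l {w\<in>Z. z < w})"
  have b: "z < b" "b \<le> l" "\<And>w. w \<in> Z \<Longrightarrow> z < w \<Longrightarrow> b \<le> w"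
    using Z z(1) unfolding b_def by (auto simp: Min_gr_iff)
  define y where "y = (z + b) / 2"
  have y: "z < y" "y < b" using b(1) by (auto simp: y_def field_simps)
  have "{w\<in>Z. w < y} = insert z {w\<in>Z. w < t}"
  proof (intro equalityI subsetI)
    fix w assume w: "w \<in> {w\<in>Z. w < y}"
    then have "\<not> z < w" using b(3)[of w] y by auto
    moreover have "w \<noteq> t" using w t(3) by auto
    ultimately show "w \<in> insert z {w\<in>Z. w < t}" using z(3)[of w] w by auto
  qed (use z y in auto)
  moreover have "finite {w\<in>Z. w < t}" "z \<notin> {w\<in>Z. w < t}" using Z(1) z by auto
  ultimately have "zeros_before Z y = Suc j" using t(4) unfolding zeros_before_def by simp
  moreover have "y \<notin> Z" using y b(3) by force
  ultimately show ?case using y b(2) z t by (intro exI[of _ y]) auto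
qed

text \<open>The factor is bounded and jumps only at points of \<open>Z\<close>, where
  \<open>f\<close> vanishes.\<close>

lemma continuous_on_piecewise:
  fixes f :: "real \<Rightarrow> real"
  assumes Z: "finite Z" and f: "continuous_on {0..l} f" and z: "\<And>t. t \<in> Z \<Longrightarrow> f t = 0"
  shows "continuous_on {0..l} (\<lambda>t. f t * c (zeros_before Z t))"
  unfolding continuous_on_eq_continuous_within
proof
  fix x assume x: "x \<in> {0..l}"
  have cx: "(f \<longlongrightarrow> f x) (at x within {0..l})" using f x unfolding continuous_on_def by blast
  show "continuous (at x within {0..l}) (\<lambda>t. f t * c (zeros_before Z t))"
    unfolding continuous_within
  proof (cases "x \<in> Z")
    case False
    obtain \<delta> where \<delta>: "\<delta> > 0" "\<And>y. \<bar>y - x\<bar> < \<delta> \<Longrightarrow> zeros_before Z y = zeros_before Z x"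
      using zeros_before_locally_constant[OF Z False] by blast
    have "((\<lambda>t. f t * c (zeros_before Z x)) \<longlongrightarrow> f x * c (zeros_before Z x)) (at x within {0..l})"
      by (intro tendsto_mult cx tendsto_const)
    moreover have "\<forall>\<^sub>F t in at x within {0..l}. f t * c (zeros_before Z x) = f t * c (zeros_before Z t)"
    proof -
      have "f y * c (zeros_before Z x) = f y * c (zeros_before Z y)" if "dist y x < \<delta>" for y
        using \<delta>(2)[of y, symmetric] that by (simp add: dist_real_def)
      then show ?thesis unfolding eventually_at using \<delta>(1) by blast
    qed
    ultimately show "((\<lambda>t. f t * c (zeros_before Z t)) \<longlongrightarrow> f x * c (zeros_before Z x)) (at x within {0..l})"
      by (rule Lim_transform_eventually)
  next
    case True
    define B where "B = (\<Sum>j\<le>card Z. \<bar>c j\<bar>)"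
    have cB: "\<bar>c (zeros_before Z t)\<bar> \<le> B" for t
    proof -
      have "zeros_before Z t \<le> card Z" unfolding zeros_before_def using Z by (intro card_mono) auto
      then show ?thesis unfolding B_def by (intro member_le_sum) auto
    qed
    have "((\<lambda>t. \<bar>f t\<bar> * B) \<longlongrightarrow> 0) (at x within {0..l})"
      using tendsto_mult[OF tendsto_rabs[OF cx] tendsto_const[of B]] z[OF True] by simp
    then have "((\<lambda>t. f t * c (zeros_before Z t)) \<longlongrightarrow> 0) (at x within {0..l})"
      by (rule Lim_null_comparison[rotated]) (auto simp: abs_mult intro!: always_eventually mult_left_mono cB)
    then show "((\<lambda>t. f t * c (zeros_before Z t)) \<longlongrightarrow> f x * c (zeros_before Z x)) (at x within {0..l})"
      using z[OF True] by simp
  qed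
qed

lemma DERIV_piecewise:
  fixes f :: "real \<Rightarrow> real"
  assumes Z: "finite Z" and f: "(f has_real_derivative d) (at t)" and t: "t \<notin> Z"
  shows "((\<lambda>t. f t * c (zeros_before Z t)) has_real_derivative d * c (zeros_before Z t)) (at t)"
proof -
  obtain \<delta> where \<delta>: "\<delta> > 0" "\<And>y. \<bar>y - t\<bar> < \<delta> \<Longrightarrow> zeros_before Z y = zeros_before Z t"
    using zeros_before_locally_constant[OF Z t] by blast
  have "\<forall>\<^sub>F y in nhds t. f y * c (zeros_before Z y) = f y * c (zeros_before Z t)"
  proof -
    have "f y * c (zeros_before Z y) = f y * c (zeros_before Z t)" if "dist y t < \<delta>" for y
      using \<delta>(2)[of y] that by (simp add: dist_real_def)
    then show ?thesis unfolding eventually_nhds_metric using \<delta>(1) by blast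
  qed
  then show ?thesis
    by (subst DERIV_cong_ev[OF refl _ refl, of _ "\<lambda>y. f y * c (zeros_before Z t)"])
      (auto intro!: derivative_eq_intros f)
qed

lemma bounded_meas_piecewise:
  fixes c :: "nat \<Rightarrow> real"
  assumes Z: "finite Z"
  shows "bounded_meas l (\<lambda>t. c (zeros_before Z t))"
proof -
  have "\<bar>c (zeros_before Z t)\<bar> \<le> (\<Sum>j\<le>card Z. \<bar>c j\<bar>)" for t
  proof -
    have "zeros_before Z t \<le> card Z" unfolding zeros_before_def using Z by (intro card_mono) auto
    then show ?thesis by (intro member_le_sum) auto
  qed
  moreover have "continuous_on (- Z) (\<lambda>t. c (zeros_before Z t))"
  proof (rule continuous_at_imp_continuous_on, rule ballI)
    fix t assume "t \<in> - Z"
    then have "((\<lambda>t. 1 * c (zeros_before Z t)) has_real_derivative 0 * c (zeros_before Z t)) (at t)"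
      by (intro DERIV_piecewise Z) auto
    then show "isCont (\<lambda>t. c (zeros_before Z t)) t" using DERIV_isCont by fastforce
  qed
  then have "(\<lambda>t. c (zeros_before Z t)) \<in> borel_measurable borel"
    using Z by (intro borel_measurable_continuous_countable_exceptions[of Z]) (auto intro: countable_finite)
  then have "(\<lambda>t. c (zeros_before Z t)) \<in> borel_measurable lebesgue"
    by (intro measurable_completion) simp
  then have "(\<lambda>t. c (zeros_before Z t)) \<in> borel_measurable (lebesgue_on {0..l})"
    by (rule measurable_restrict_space1)
  ultimately show ?thesis unfolding bounded_meas_def by blast
qed

context schroedinger_graph
begin

lemma form_scale:
  assumes "form \<phi> \<psi> p"
  shows "form (\<lambda>e t. c * \<phi> e t) (\<lambda>e t. c * \<psi> e t) (\<lambda>v. c * p v)"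
proof -
  have "form (\<lambda>e t. \<Sum>i\<in>{()}. c * \<phi> e t) (\<lambda>e t. \<Sum>i\<in>{()}. c * \<psi> e t) (\<lambda>v. \<Sum>i\<in>{()}. c * p v)"
    by (rule form_sum) (use assms in auto)
  then show ?thesis by simp
qed

lemma ip_scale:
  assumes "form \<phi> \<psi> p" "form \<eta> \<theta> s"
  shows "ip (\<lambda>e t. c * \<phi> e t) \<eta> = c * ip \<phi> \<eta>"
proof -
  have "ip (\<lambda>e t. \<Sum>i\<in>{()}. c * \<phi> e t) \<eta> = (\<Sum>i\<in>{()}. c * ip \<phi> \<eta>)"
    by (rule ip_sum[of _ _ "\<lambda>_. \<psi>" "\<lambda>_. p"]) (use assms in auto)
  then show ?thesis by simp
qed

lemma ip_scale2:
  assumes "form \<phi> \<psi> p"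
  shows "ip (\<lambda>e t. c * \<phi> e t) (\<lambda>e t. c * \<phi> e t) = c\<^sup>2 * ip \<phi> \<phi>"
proof -
  have "ip \<phi> (\<lambda>e t. c * \<phi> e t) = c * ip \<phi> \<phi>"
    using ip_scale[OF assms assms, of c] ip_commute[of \<phi> "\<lambda>e t. c * \<phi> e t"] by simp
  then show ?thesis using ip_scale[OF assms form_scale[OF assms, of c], of c] by (simp add: power2_eq_square)
qed

lemma qf_scale2:
  assumes f: "form \<phi> \<psi> p"
  shows "qf mu (\<lambda>e t. c * \<phi> e t) (\<lambda>e t. c * \<psi> e t) (\<lambda>e t. c * \<phi> e t) (\<lambda>e t. c * \<psi> e t) = c\<^sup>2 * qf mu \<phi> \<psi> \<phi> \<psi>"
proof -
  have *: "qf mu (\<lambda>e t. c * \<phi> e t) (\<lambda>e t. c * \<psi> e t) \<eta> \<theta> = c * qf mu \<phi> \<psi> \<eta> \<theta>" if "form \<eta> \<theta> s" for \<eta> \<theta> s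
  proof -
    have "qf mu (\<lambda>e t. \<Sum>i\<in>{()}. c * \<phi> e t) (\<lambda>e t. \<Sum>i\<in>{()}. c * \<psi> e t) \<eta> \<theta> = (\<Sum>i\<in>{()}. c * qf mu \<phi> \<psi> \<eta> \<theta>)"
      by (rule qf_sum[of _ _ _ "\<lambda>_. p"]) (use f that in auto)
    then show ?thesis by simp
  qed
  have "qf mu \<phi> \<psi> (\<lambda>e t. c * \<phi> e t) (\<lambda>e t. c * \<psi> e t) = c * qf mu \<phi> \<psi> \<phi> \<psi>"
    using *[OF f] qf_commute by metis
  then show ?thesis using *[OF form_scale[OF f, of c]] by (simp add: power2_eq_square)
qed

text \<open>Only the potential term can be negative, and \<open>W - mu\<close> is bounded. This
  makes the infimum of the Rayleigh quotient finite.\<close>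

lemma qf_lower_bound: "\<exists>C. \<forall>\<phi> \<psi> p. form \<phi> \<psi> p \<longrightarrow> - C * ip \<phi> \<phi> \<le> qf mu \<phi> \<psi> \<phi> \<psi>"
proof -
  obtain C where C: "\<And>e t. e \<in> E \<Longrightarrow> t \<in> {0..l e} \<Longrightarrow> \<bar>W e t - mu\<bar> \<le> C" using W_bound by blast
  have "- C * ip \<phi> \<phi> \<le> qf mu \<phi> \<psi> \<phi> \<psi>" if f: "form \<phi> \<psi> p" for \<phi> \<psi> p
  proof -
    have "- C * integral {0..l e} (\<lambda>t. \<phi> e t * \<phi> e t) \<le> integral {0..l e} (\<lambda>t. \<psi> e t * \<psi> e t + (W e t - mu) * (\<phi> e t * \<phi> e t))"
      if e: "e \<in> E" for e
    proof -
      have "integral {0..l e} (\<lambda>t. - C * (\<phi> e t * \<phi> e t)) \<le> integral {0..l e} (\<lambda>t. \<psi> e t * \<psi> e t + (W e t - mu) * (\<phi> e t * \<phi> e t))"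
      proof (rule integral_le[OF _ form_integrable(4)[OF f f e]])
        show "(\<lambda>t. - C * (\<phi> e t * \<phi> e t)) integrable_on {0..l e}" by (intro integrable_on_mult_right form_integrable(1)[OF f f e])
        fix t assume t: "t \<in> {0..l e}"
        have "0 \<le> ((W e t - mu) + C) * (\<phi> e t * \<phi> e t)"
          by (rule mult_nonneg_nonneg[OF _ zero_le_square]) (use C[OF e t] in auto)
        moreover have "0 \<le> \<psi> e t * \<psi> e t" by simp
        ultimately show "- C * (\<phi> e t * \<phi> e t) \<le> \<psi> e t * \<psi> e t + (W e t - mu) * (\<phi> e t * \<phi> e t)"
          unfolding distrib_right mult_minus_left by linarith
      qed
      then show ?thesis by simp
    qed
    then show ?thesis unfolding ip_def qf_def sum_distrib_left by (rule sum_mono)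
  qed
  then show ?thesis by blast
qed

end

section \<open>Broken multiples of an eigenfunction and the dimension count\<close>

context generic_graph
begin

text \<open>The space of locally constant multiples of an eigenfunction: a sign pattern \<open>x\<close> gives one factor to
  every piece of an edge between consecutive zeros and one to every vertex.  The factors match at
  the vertices iff the 2|E| equations \<open>x (Inl (e, _)) = x (Inr _)\<close> hold.\<close>

definition step :: "('b \<Rightarrow> real \<Rightarrow> real) \<Rightarrow> ('b \<times> nat + 'a \<Rightarrow> real) \<Rightarrow> 'b \<Rightarrow> real \<Rightarrow> real" where
  "step f x e t = x (Inl (e, zeros_before (zeros_on f e) t))"

lemma zeros_before_ends:
  assumes e: "e \<in> E"
  shows "zeros_before (zeros_on f e) 0 = 0" "zeros_before (zeros_on f e) (l e) = card (zeros_on f e)"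
proof -
  have "{z \<in> zeros_on f e. z < 0} = {}" "{z \<in> zeros_on f e. z < l e} = zeros_on f e" unfolding zeros_on_def by auto
  then show "zeros_before (zeros_on f e) 0 = 0" "zeros_before (zeros_on f e) (l e) = card (zeros_on f e)"
    unfolding zeros_before_def by (simp_all only: card.empty)
qed

context
  fixes lam f D fv and x :: "'b \<times> nat + 'a \<Rightarrow> real"
  assumes f: "eig lam f D fv" and nz: "nonzero f"
    and x: "\<And>e. e \<in> E \<Longrightarrow> x (Inl (e, 0)) = x (Inr (src e))"
      "\<And>e. e \<in> E \<Longrightarrow> x (Inl (e, card (zeros_on f e))) = x (Inr (tgt e))"
begin

lemma finite_zeros_on: "e \<in> E \<Longrightarrow> finite (zeros_on f e)"
  using finite_zeros_eig[OF f nz] unfolding finite_zero_edge_points by blast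

lemma zeros_on_zero: "t \<in> zeros_on f e \<Longrightarrow> f e t = 0"
  by (simp add: zeros_on_def)

lemma bounded_meas_step:
  assumes "e \<in> E"
  shows "bounded_meas (l e) (step f x e)"
  using bounded_meas_piecewise[OF finite_zeros_on[OF assms], of "l e" "\<lambda>j. x (Inl (e, j))"]
  unfolding step_def[abs_def] .

lemma form_step:
  "form (\<lambda>e t. f e t * step f x e t) (\<lambda>e t. D e t * step f x e t) (\<lambda>v. fv v * x (Inr v))"
  unfolding form_def
proof (intro conjI ballI)
  fix e assume e: "e \<in> E"
  show "continuous_on {0..l e} (\<lambda>t. f e t * step f x e t)"
    unfolding step_def
    by (rule continuous_on_piecewise[OF finite_zeros_on[OF e] eigD(5)[OF f e], of "\<lambda>j. x (Inl (e, j))"]) (rule zeros_on_zero)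
  show "bounded_meas (l e) (\<lambda>t. D e t * step f x e t)"
    by (intro bounded_meas_mult bounded_meas_step e bounded_meas_continuous eigD(6)[OF f e])
  have "((\<lambda>t. f e t * step f x e t) has_real_derivative D e t * step f x e t) (at t)"
    if t: "t \<in> {0<..<l e} - zeros_on f e" for t
    unfolding step_def
    by (rule DERIV_piecewise[OF finite_zeros_on[OF e], of _ _ _ "\<lambda>j. x (Inl (e, j))"])
      (use t derivative_Icc_interior[OF eigD(1)[OF f e]] in auto)
  then show "\<exists>S. finite S \<and> (\<forall>t\<in>{0<..<l e} - S. ((\<lambda>t. f e t * step f x e t) has_real_derivative D e t * step f x e t) (at t))"
    using finite_zeros_on[OF e] by blast
next
  show "vertex_cont (\<lambda>v. fv v * x (Inr v)) (\<lambda>e t. f e t * step f x e t)"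
    unfolding vertex_cont_def step_def
  proof (intro conjI ballI)
    fix e assume e: "e \<in> E"
    show "f e 0 * x (Inl (e, zeros_before (zeros_on f e) 0)) = fv (src e) * x (Inr (src e))"
      "f e (l e) * x (Inl (e, zeros_before (zeros_on f e) (l e))) = fv (tgt e) * x (Inr (tgt e))"
      unfolding zeros_before_ends[OF e] x[OF e] eigD(3,4)[OF f e] by simp_all
  next
    fix v assume "v \<in> Vb"
    then show "fv v * x (Inr v) = 0" using f unfolding eig_def vertex_cont_def by auto
  qed
qed

text \<open>\<open>f * D * step^2\<close> is continuous, since the jumps sit at zeros of
  \<open>f\<close>, and it is an antiderivative of the integrand. The boundary terms belong to the
  vertex function \<open>x^2 * fv\<close> and cancel, so breaking \<open>f\<close> at its zeros
  costs nothing at level \<open>lam\<close>.\<close>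

lemma qf_step:
  "qf lam (\<lambda>e t. f e t * step f x e t) (\<lambda>e t. D e t * step f x e t) (\<lambda>e t. f e t * step f x e t) (\<lambda>e t. D e t * step f x e t) = 0"
proof -
  have "integral {0..l e} (\<lambda>t. (D e t * step f x e t) * (D e t * step f x e t) + (W e t - lam) * ((f e t * step f x e t) * (f e t * step f x e t)))
     = (x (Inr (tgt e)))\<^sup>2 * fv (tgt e) * D e (l e) - (x (Inr (src e)))\<^sup>2 * fv (src e) * D e 0" if e: "e \<in> E" for e
  proof -
    have "((\<lambda>t. (D e t * step f x e t) * (D e t * step f x e t) + (W e t - lam) * ((f e t * step f x e t) * (f e t * step f x e t)))
       has_integral (f e (l e) * D e (l e)) * (step f x e (l e))\<^sup>2 - (f e 0 * D e 0) * (step f x e 0)\<^sup>2) {0..l e}"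
    proof (rule fundamental_theorem_of_calculus_interior_strong[OF finite_zeros_on[OF e]])
      show "0 \<le> l e" using graphD(6)[OF e] by simp
      show "continuous_on {0..l e} (\<lambda>t. (f e t * D e t) * (step f x e t)\<^sup>2)"
        unfolding step_def
        by (rule continuous_on_piecewise[OF finite_zeros_on[OF e], of "l e" "\<lambda>t. f e t * D e t" "\<lambda>j. (x (Inl (e, j)))\<^sup>2"])
          (auto intro!: continuous_intros eigD(5,6)[OF f e] simp: zeros_on_zero)
      fix t assume t: "t \<in> {0<..<l e} - zeros_on f e"
      then have t': "0 < t" "t < l e" by auto
      have "((\<lambda>t. f e t * D e t) has_real_derivative D e t * D e t + (W e t - lam) * f e t * f e t) (at t)"
        by (intro DERIV_mult derivative_Icc_interior[OF eigD(1)[OF f e] t'] derivative_Icc_interior[OF eigD(2)[OF f e] t'])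
      from DERIV_piecewise[OF finite_zeros_on[OF e] this, of "\<lambda>j. (x (Inl (e, j)))\<^sup>2"] t
      have "((\<lambda>t. (f e t * D e t) * (step f x e t)\<^sup>2) has_real_derivative (D e t * D e t + (W e t - lam) * f e t * f e t) * (step f x e t)\<^sup>2) (at t)"
        unfolding step_def by auto
      moreover have "(D e t * D e t + (W e t - lam) * f e t * f e t) * (step f x e t)\<^sup>2 =
         (D e t * step f x e t) * (D e t * step f x e t) + (W e t - lam) * ((f e t * step f x e t) * (f e t * step f x e t))"
        by (simp add: power2_eq_square algebra_simps)
      ultimately show "((\<lambda>t. (f e t * D e t) * (step f x e t)\<^sup>2) has_vector_derivative
         (D e t * step f x e t) * (D e t * step f x e t) + (W e t - lam) * ((f e t * step f x e t) * (f e t * step f x e t))) (at t)"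
        by (simp add: has_real_derivative_iff_has_vector_derivative)
    qed
    moreover have "step f x e 0 = x (Inr (src e))" "step f x e (l e) = x (Inr (tgt e))"
      unfolding step_def zeros_before_ends[OF e] x[OF e] by simp_all
    ultimately show ?thesis using eigD(3,4)[OF f e] by (simp add: integral_unique mult_ac)
  qed
  then have "qf lam (\<lambda>e t. f e t * step f x e t) (\<lambda>e t. D e t * step f x e t) (\<lambda>e t. f e t * step f x e t) (\<lambda>e t. D e t * step f x e t)
     = (\<Sum>e\<in>E. (x (Inr (tgt e)))\<^sup>2 * fv (tgt e) * D e (l e) - (x (Inr (src e)))\<^sup>2 * fv (src e) * D e 0)"
    unfolding qf_def by (rule sum.cong[OF refl])
  also have "\<dots> = 0"
    using boundary_terms[of D "\<lambda>v. (x (Inr v))\<^sup>2 * fv v"] f unfolding eig_def vertex_cont_def by auto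
  finally show ?thesis .
qed

text \<open>This displays orthogonality to \<open>g\<close> as one linear equation in the factors
  \<open>x\<close>, as the dimension count requires.\<close>

lemma ip_step:
  assumes g: "form g g' s"
  shows "ip (\<lambda>e t. f e t * step f x e t) g =
    (\<Sum>e\<in>E. \<Sum>j\<le>card (zeros_on f e). integral {0..l e} (\<lambda>t. f e t * (if zeros_before (zeros_on f e) t = j then 1 else 0) * g e t) * x (Inl (e, j)))"
  unfolding ip_def
proof (rule sum.cong[OF refl])
  fix e assume e: "e \<in> E"
  define n where "n = card (zeros_on f e)"
  define b where "b j t = (if zeros_before (zeros_on f e) t = j then 1 else 0 :: real)" for j t
  have zb: "zeros_before (zeros_on f e) t \<le> n" for t
    unfolding zeros_before_def n_def using finite_zeros_on[OF e] by (intro card_mono) auto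
  have bm: "bounded_meas (l e) (b j)" for j
    using bounded_meas_piecewise[OF finite_zeros_on[OF e], of "l e" "\<lambda>i. if i = j then 1 else 0"]
    unfolding b_def[abs_def] .
  have int: "(\<lambda>t. f e t * b j t * g e t) integrable_on {0..l e}" for j
    by (intro bounded_meas_integrable bounded_meas_mult bm formD(2)[OF form_eig[OF f] e] formD(2)[OF g e])
  have st: "step f x e t = (\<Sum>j\<le>n. b j t * x (Inl (e, j)))" for t
  proof -
    have "(\<Sum>j\<le>n. b j t * x (Inl (e, j))) = (\<Sum>j\<le>n. if zeros_before (zeros_on f e) t = j then x (Inl (e, j)) else 0)"
      by (rule sum.cong) (auto simp: b_def)
    then show ?thesis using zb[of t] by (simp add: step_def)
  qed
  have "integral {0..l e} (\<lambda>t. f e t * step f x e t * g e t) = integral {0..l e} (\<lambda>t. \<Sum>j\<le>n. (f e t * b j t * g e t) * x (Inl (e, j)))"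
    unfolding st sum_distrib_left sum_distrib_right by (rule arg_cong[where f = "integral {0..l e}"]) (auto simp: mult_ac)
  also have "\<dots> = (\<Sum>j\<le>n. integral {0..l e} (\<lambda>t. (f e t * b j t * g e t) * x (Inl (e, j))))"
    by (rule integral_sum) (auto intro!: integrable_on_mult_left int)
  also have "\<dots> = (\<Sum>j\<le>n. integral {0..l e} (\<lambda>t. f e t * b j t * g e t) * x (Inl (e, j)))"
    by simp
  finally show "integral {0..l e} (\<lambda>t. f e t * step f x e t * g e t) =
    (\<Sum>j\<le>card (zeros_on f e). integral {0..l e} (\<lambda>t. f e t * (if zeros_before (zeros_on f e) t = j then 1 else 0) * g e t) * x (Inl (e, j)))"
    unfolding b_def n_def .
qed

lemma nonzero_step:
  assumes "u \<in> Sigma E (\<lambda>e. {..card (zeros_on f e)}) <+> V" "x u \<noteq> 0"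
  shows "nonzero (\<lambda>e t. f e t * step f x e t)"
proof -
  have "\<exists>e j. e \<in> E \<and> j \<le> card (zeros_on f e) \<and> x (Inl (e, j)) \<noteq> 0"
  proof (cases u)
    case (Inl p)
    then show ?thesis using assms by (cases p) auto
  next
    case (Inr v)
    then have "v \<in> V" using assms by auto
    then obtain e where "e \<in> E" "src e = v \<or> tgt e = v" using incident_edge by blast
    then show ?thesis using x[of e] assms(2) Inr by (metis le_refl zero_le)
  qed
  then obtain e j where e: "e \<in> E" and j: "j \<le> card (zeros_on f e)" "x (Inl (e, j)) \<noteq> 0" by blast
  have "zeros_on f e \<subseteq> {0<..<l e}" by (auto simp: zeros_on_def)
  then obtain t where t: "0 < t" "t < l e" "t \<notin> zeros_on f e" "zeros_before (zeros_on f e) t = j"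
    using zeros_before_surj[OF finite_zeros_on[OF e] _ graphD(6)[OF e] j(1)] by blast
  have "f e t * step f x e t \<noteq> 0" using t j unfolding step_def by (auto simp: zeros_on_def)
  then show ?thesis using e t by (intro bexI[of _ e] bexI[of _ t]) auto
qed

end

text \<open>The unknowns are the factors of the pieces and of the vertices: the number of zeros plus
  |E| plus |V|. The equations are 2 |E| for matching, \<open>card I\<close> for orthogonality and 1
  for vanishing on the first piece of \<open>e0\<close>. The unknowns outnumber the equations
  exactly when there are more than \<open>card I + \<beta>\<close> zeros.\<close>

theorem card_zeros_le:
  fixes I :: "'i set"
  assumes f: "eig lam f D fv" and nz: "nonzero f" and I: "finite I"
    and g: "\<And>i. i \<in> I \<Longrightarrow> eig (mu i) (g i) (D' i) (gv i)" and gnz: "\<And>i. i \<in> I \<Longrightarrow> nonzero (g i)"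
    and inj: "inj_on mu I" and all: "\<And>nu. eigenvalue V E src tgt l W nu \<Longrightarrow> nu < lam \<Longrightarrow> nu \<in> mu ` I"
  shows "int (card (zero_edge_points E l f)) \<le> int (card I) + betti V E"
proof (rule ccontr)
  assume neg: "\<not> ?thesis"
  have fz: "finite (zeros_on f e)" if "e \<in> E" for e
    using finite_zeros_eig[OF f nz] that unfolding finite_zero_edge_points by blast
  obtain e0 where e0: "e0 \<in> E" using graphD(3) by auto
  define U where "U = Sigma E (\<lambda>e. {..card (zeros_on f e)}) <+> V"
  define J where "J = ((E <+> E) <+> I) <+> {()}"
  have fU: "finite U" unfolding U_def using graphD(1,2) by auto
  have fJ: "finite J" unfolding J_def using graphD(2) I by auto
  have "card U = (\<Sum>e\<in>E. Suc (card (zeros_on f e))) + card V"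
    unfolding U_def using graphD(1,2) by (simp add: card_Plus card_SigmaI)
  then have cU: "card U = card (zero_edge_points E l f) + card E + card V"
    using card_zero_edge_points[OF fz] by (simp add: sum_Suc)
  have cJ: "card J = 2 * card E + card I + 1"
    unfolding J_def using graphD(2) I by (simp add: card_Plus)
  have lt: "card J < card U" using neg cU cJ unfolding betti_def by linarith
  define co where "co i e j = integral {0..l e} (\<lambda>t. f e t * (if zeros_before (zeros_on f e) t = j then 1 else 0) * g i e t)" for i e j
  define A :: "(('b + 'b) + 'i) + unit \<Rightarrow> ('b \<times> nat) + 'a \<Rightarrow> real" where
    "A j u = (case j of
        Inl (Inl (Inl e)) \<Rightarrow> (if u = Inl (e, 0) then 1 else 0) - (if u = Inr (src e) then 1 else 0)
      | Inl (Inl (Inr e)) \<Rightarrow> (if u = Inl (e, card (zeros_on f e)) then 1 else 0) - (if u = Inr (tgt e) then 1 else 0)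
      | Inl (Inr i) \<Rightarrow> (case u of Inl (e, j) \<Rightarrow> co i e j | Inr v \<Rightarrow> 0)
      | Inr _ \<Rightarrow> (if u = Inl (e0, 0) then 1 else 0))" for j u
  obtain x where x: "\<exists>u\<in>U. x u \<noteq> 0" "\<And>j. j \<in> J \<Longrightarrow> (\<Sum>u\<in>U. A j u * x u) = 0"
    using homogeneous_system_nontrivial[OF fJ fU lt, of A] by blast
  have delta: "(\<Sum>u\<in>U. (if u = w then 1 else 0) * x u) = x w" if "w \<in> U" for w
    using fU that by (simp add: if_distrib if_distribR cong: if_cong)
  have inU: "Inl (e, 0) \<in> U" "Inl (e, card (zeros_on f e)) \<in> U" "Inr (src e) \<in> U" "Inr (tgt e) \<in> U" if "e \<in> E" for e
    using that graphD(4,5) by (auto simp: U_def)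
  have x1: "x (Inl (e, 0)) = x (Inr (src e))" if e: "e \<in> E" for e
  proof -
    have "(\<Sum>u\<in>U. A (Inl (Inl (Inl e))) u * x u) = 0" by (rule x(2)) (use e in \<open>auto simp: J_def\<close>)
    then show ?thesis unfolding A_def by (simp add: left_diff_distrib sum_subtractf delta inU e)
  qed
  have x2: "x (Inl (e, card (zeros_on f e))) = x (Inr (tgt e))" if e: "e \<in> E" for e
  proof -
    have "(\<Sum>u\<in>U. A (Inl (Inl (Inr e))) u * x u) = 0" by (rule x(2)) (use e in \<open>auto simp: J_def\<close>)
    then show ?thesis unfolding A_def by (simp add: left_diff_distrib sum_subtractf delta inU e)
  qed
  have x0: "x (Inl (e0, 0)) = 0"
  proof -
    have "(\<Sum>u\<in>U. A (Inr ()) u * x u) = 0" by (rule x(2)) (auto simp: J_def)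
    then show ?thesis unfolding A_def by (simp add: delta inU e0)
  qed
  define \<phi>0 where "\<phi>0 e t = f e t * step f x e t" for e t
  define \<psi>0 where "\<psi>0 e t = D e t * step f x e t" for e t
  define p0 where "p0 v = fv v * x (Inr v)" for v
  have f0: "form \<phi>0 \<psi>0 p0" unfolding \<phi>0_def \<psi>0_def p0_def by (rule form_step[OF f nz x1 x2])
  have q0: "qf lam \<phi>0 \<psi>0 \<phi>0 \<psi>0 = 0" unfolding \<phi>0_def \<psi>0_def by (rule qf_step[OF f nz x1 x2])
  have n0: "nonzero \<phi>0" unfolding \<phi>0_def using nonzero_step[OF f nz x1 x2] x(1) unfolding U_def by blast
  have o0: "ip \<phi>0 (g i) = 0" if i: "i \<in> I" for i
  proof -
    have "(\<Sum>u\<in>U. A (Inl (Inr i)) u * x u) = 0" by (rule x(2)) (use i in \<open>auto simp: J_def\<close>)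
    moreover have "(\<Sum>u\<in>U. A (Inl (Inr i)) u * x u) = (\<Sum>(e, j)\<in>Sigma E (\<lambda>e. {..card (zeros_on f e)}). co i e j * x (Inl (e, j)))"
      unfolding U_def A_def using graphD(1,2) by (simp add: sum.Plus case_prod_unfold)
    moreover have "\<dots> = (\<Sum>e\<in>E. \<Sum>j\<le>card (zeros_on f e). co i e j * x (Inl (e, j)))"
      using graphD(2) by (subst sum.Sigma) auto
    moreover have "\<dots> = ip \<phi>0 (g i)" unfolding \<phi>0_def co_def by (rule ip_step[OF f nz x1 x2 form_eig[OF g[OF i]], symmetric])
    ultimately show ?thesis by simp
  qed
  define k where "k = 1 / sqrt (ip \<phi>0 \<phi>0)"
  have P: "0 < ip \<phi>0 \<phi>0" by (rule ip_self_pos[OF f0 n0])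
  have k2: "k\<^sup>2 * ip \<phi>0 \<phi>0 = 1" and k0: "k \<noteq> 0" unfolding k_def using P by (auto simp: power_divide)
  define \<phi>1 where "\<phi>1 e t = k * \<phi>0 e t" for e t
  define \<psi>1 where "\<psi>1 e t = k * \<psi>0 e t" for e t
  have f1: "form \<phi>1 \<psi>1 (\<lambda>v. k * p0 v)" unfolding \<phi>1_def \<psi>1_def by (rule form_scale[OF f0])
  have q1: "qf lam \<phi>1 \<psi>1 \<phi>1 \<psi>1 = 0" unfolding \<phi>1_def[abs_def] \<psi>1_def[abs_def] using qf_scale2[OF f0] q0 by simp
  have i1: "ip \<phi>1 \<phi>1 = 1" unfolding \<phi>1_def[abs_def] using ip_scale2[OF f0] k2 by simp
  have o1: "ip \<phi>1 (g i) = 0" if "i \<in> I" for i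
    unfolding \<phi>1_def[abs_def] using ip_scale[OF f0 form_eig[OF g[OF that]]] o0[OF that] by simp
  have go: "ip (g i) (g j) = 0" if "i \<in> I" "j \<in> I" "i \<noteq> j" for i j
    by (rule eig_orthogonal[OF g[OF that(1)] g[OF that(2)]]) (use inj that in \<open>auto simp: inj_on_def\<close>)
  \<comment> \<open>These are the Rayleigh quotients on the complement of the \<open>g i\<close>.
    The compactness result is used twice: first at level \<open>m = Inf R\<close> to show
    \<open>lam \<le> m\<close>, then at level \<open>lam\<close> for the broken function
    itself.\<close>
  define R where "R = {qf 0 \<phi> \<psi> \<phi> \<psi> | \<phi> \<psi> p. form \<phi> \<psi> p \<and> (\<forall>i\<in>I. ip \<phi> (g i) = 0) \<and> ip \<phi> \<phi> = 1}"
  obtain C where C: "\<And>\<phi> \<psi> p. form \<phi> \<psi> p \<Longrightarrow> - C * ip \<phi> \<phi> \<le> qf 0 \<phi> \<psi> \<phi> \<psi>" using qf_lower_bound[of 0] by blast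
  have Rb: "bdd_below R"
  proof (rule bdd_belowI[of _ "- C"])
    fix y assume "y \<in> R"
    then obtain \<phi> \<psi> p where "form \<phi> \<psi> p" "ip \<phi> \<phi> = 1" "y = qf 0 \<phi> \<psi> \<phi> \<psi>" unfolding R_def by blast
    then show "- C \<le> y" using C[of \<phi> \<psi> p] by simp
  qed
  have Rne: "R \<noteq> {}" unfolding R_def using f1 o1 i1 by blast
  define m where "m = Inf R"
  have min: "0 \<le> qf m \<phi> \<psi> \<phi> \<psi>" if fm: "form \<phi> \<psi> p" and o: "\<And>i. i \<in> I \<Longrightarrow> ip \<phi> (g i) = 0" for \<phi> \<psi> p
  proof (cases "ip \<phi> \<phi> = 0")
    case True
    then show ?thesis using C[OF fm] qf_shift[OF fm fm, of m 0] by simp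
  next
    case False
    then have pos: "0 < ip \<phi> \<phi>" using ip_self_nonneg[OF fm] by simp
    define c where "c = 1 / sqrt (ip \<phi> \<phi>)"
    have c2: "c\<^sup>2 * ip \<phi> \<phi> = 1" and c0: "0 < c\<^sup>2" unfolding c_def using pos by (auto simp: power_divide)
    have "qf 0 (\<lambda>e t. c * \<phi> e t) (\<lambda>e t. c * \<psi> e t) (\<lambda>e t. c * \<phi> e t) (\<lambda>e t. c * \<psi> e t) \<in> R"
      unfolding R_def using form_scale[OF fm, of c] ip_scale2[OF fm, of c] c2 ip_scale[OF fm form_eig[OF g]] o by fastforce
    then have "m \<le> c\<^sup>2 * qf 0 \<phi> \<psi> \<phi> \<psi>" unfolding m_def qf_scale2[OF fm] using Rb by (rule cInf_lower)
    then have "0 \<le> c\<^sup>2 * qf 0 \<phi> \<psi> \<phi> \<psi> - m * (c\<^sup>2 * ip \<phi> \<phi>)" unfolding c2 by simp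
    also have "\<dots> = c\<^sup>2 * qf m \<phi> \<psi> \<phi> \<psi>" unfolding qf_shift[OF fm fm, of m 0] by (simp add: algebra_simps)
    finally show ?thesis using c0 by (simp add: zero_le_mult_iff)
  qed
  have "\<exists>\<phi> \<psi> p. form \<phi> \<psi> p \<and> (\<forall>i\<in>I. ip \<phi> (g i) = 0) \<and> ip \<phi> \<phi> = 1 \<and> qf 0 \<phi> \<psi> \<phi> \<psi> < m + 1 / real (Suc n)" for n
  proof -
    have "Inf R < m + 1 / real (Suc n)" unfolding m_def by simp
    then obtain y where "y \<in> R" "y < m + 1 / real (Suc n)" using cInf_lessD[OF Rne] by blast
    then show ?thesis unfolding R_def by blast
  qed
  then obtain \<phi> \<psi> p where seq: "\<And>n. form (\<phi> n) (\<psi> n) (p n)" "\<And>n i. i \<in> I \<Longrightarrow> ip (\<phi> n) (g i) = 0"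
    "\<And>n. ip (\<phi> n) (\<phi> n) = 1" "\<And>n. qf 0 (\<phi> n) (\<psi> n) (\<phi> n) (\<psi> n) < m + 1 / real (Suc n)" by metis
  have lim: "(\<lambda>n. qf m (\<phi> n) (\<psi> n) (\<phi> n) (\<psi> n)) \<longlonglongrightarrow> 0"
  proof (rule real_tendsto_sandwich)
    show "\<forall>\<^sub>F n in sequentially. 0 \<le> qf m (\<phi> n) (\<psi> n) (\<phi> n) (\<psi> n)" using min[OF seq(1,2)] by simp
    show "\<forall>\<^sub>F n in sequentially. qf m (\<phi> n) (\<psi> n) (\<phi> n) (\<psi> n) \<le> 1 / real (Suc n)"
    proof (intro always_eventually allI)
      fix n show "qf m (\<phi> n) (\<psi> n) (\<phi> n) (\<psi> n) \<le> 1 / real (Suc n)"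
        using seq(4)[of n] qf_shift[OF seq(1)[of n] seq(1)[of n], of m 0] seq(3)[of n] by simp
    qed
    show "(\<lambda>n. 1 / real (Suc n)) \<longlonglongrightarrow> 0" using LIMSEQ_inverse_real_of_nat by (simp add: inverse_eq_divide)
  qed simp
  have "\<exists>u D uv r. eig m u D uv \<and> ip u u = 1 \<and> (\<forall>i\<in>I. ip u (g i) = 0) \<and> strict_mono (r :: nat \<Rightarrow> nat) \<and>
     (\<forall>e\<in>E. \<forall>t\<in>{0..l e}. (\<lambda>n. \<phi> (r n) e t) \<longlonglongrightarrow> u e t)"
    by (rule minimiser_eigenfunction[where I = I and mu = mu and g = g and D' = D' and gv = gv and m = m
          and \<phi> = \<phi> and \<psi> = \<psi> and p = p]) (fact I g gnz go min seq lim)+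
  then obtain u Du uv where u: "eig m u Du uv" "ip u u = 1" "\<And>i. i \<in> I \<Longrightarrow> ip u (g i) = 0" by blast
  have unz: "nonzero u"
  proof (rule ccontr)
    assume "\<not> nonzero u"
    then have "ip u u = (\<Sum>e\<in>E. integral {0..l e} (\<lambda>t. 0))" unfolding ip_def by (intro sum.cong refl integral_cong) auto
    then show False using u(2) by simp
  qed
  \<comment> \<open>Otherwise \<open>m\<close> would be an eigenvalue listed in \<open>I\<close>,
    and as it is simple its eigenfunction \<open>u\<close> would be parallel to the
    \<open>g i\<close> to which it is orthogonal.\<close>
  have "lam \<le> m"
  proof (rule ccontr)
    assume "\<not> lam \<le> m"
    then have "m \<in> mu ` I" using u(1) unz all[of m] eigenfunction_iff unfolding eigenvalue_def by force
    then obtain i where i: "i \<in> I" "mu i = m" by auto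
    obtain c where c: "\<And>e t. e \<in> E \<Longrightarrow> t \<in> {0..l e} \<Longrightarrow> g i e t = c * u e t"
      using eig_proportional[OF u(1) unz] g[OF i(1)] i(2) by blast
    have "ip u (g i) = (\<Sum>e\<in>E. integral {0..l e} (\<lambda>t. c * (u e t * u e t)))"
      unfolding ip_def by (intro sum.cong refl integral_cong) (auto simp: c)
    also have "\<dots> = c * ip u u" unfolding ip_def by (simp add: sum_distrib_left)
    finally have "c = 0" using u(2,3) i by simp
    then show False using c gnz[OF i(1)] by auto
  qed
  have min': "0 \<le> qf lam \<phi> \<psi> \<phi> \<psi>" if fm: "form \<phi> \<psi> p" and o: "\<And>i. i \<in> I \<Longrightarrow> ip \<phi> (g i) = 0" for \<phi> \<psi> p
  proof -
    have "0 \<le> (m - lam) * ip \<phi> \<phi>" using \<open>lam \<le> m\<close> ip_self_nonneg[OF fm] by simp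
    then show ?thesis using min[OF fm o] qf_shift[OF fm fm, of lam m] by simp
  qed
  \<comment> \<open>The broken function has form value 0 at level \<open>lam\<close>, the least
    value possible there. So its constant sequence is minimising, and the limit eigenfunction is the
    broken function.\<close>
  have lim1: "(\<lambda>n::nat. qf lam \<phi>1 \<psi>1 \<phi>1 \<psi>1) \<longlonglongrightarrow> 0" using q1 by simp
  have "\<exists>u D uv r. eig lam u D uv \<and> ip u u = 1 \<and> (\<forall>i\<in>I. ip u (g i) = 0) \<and> strict_mono (r :: nat \<Rightarrow> nat) \<and>
     (\<forall>e\<in>E. \<forall>t\<in>{0..l e}. (\<lambda>n. \<phi>1 e t) \<longlonglongrightarrow> u e t)"
    by (rule minimiser_eigenfunction[where I = I and mu = mu and g = g and D' = D' and gv = gv and m = lam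
          and \<phi> = "\<lambda>_. \<phi>1" and \<psi> = "\<lambda>_. \<psi>1" and p = "\<lambda>_ v. k * p0 v"]) (fact I g gnz go min' f1 o1 i1 lim1)+
  then obtain w Dw wv where w: "eig lam w Dw wv" "ip w w = 1" "\<And>e t. e \<in> E \<Longrightarrow> t \<in> {0..l e} \<Longrightarrow> (\<lambda>n::nat. \<phi>1 e t) \<longlonglongrightarrow> w e t" by blast
  have w1: "w e t = \<phi>1 e t" if "e \<in> E" "t \<in> {0..l e}" for e t using w(3)[OF that] LIMSEQ_const_iff by metis
  have wnz: "nonzero w" using n0 w1 k0 unfolding \<phi>1_def by auto
  obtain \<delta> where \<delta>: "\<delta> > 0" "\<And>y. \<bar>y - 0\<bar> < \<delta> \<Longrightarrow> zeros_before (zeros_on f e0) y = zeros_before (zeros_on f e0) 0"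
    using zeros_before_locally_constant[OF fz[OF e0], of 0] by (auto simp: zeros_on_def)
  \<comment> \<open>The factor on the first piece of \<open>e0\<close> is 0, so an eigenfunction
    would vanish on an interval although its zeros on an edge are finite in number.\<close>
  have "{0<..<min \<delta> (l e0)} \<subseteq> {t\<in>{0..l e0}. w e0 t = 0}"
  proof
    fix t assume t: "t \<in> {0<..<min \<delta> (l e0)}"
    then have "zeros_before (zeros_on f e0) t = 0" using \<delta>(2)[of t] zeros_before_ends(1)[OF e0] by simp
    then have "\<phi>1 e0 t = 0" unfolding \<phi>1_def \<phi>0_def step_def using x0 by simp
    then show "t \<in> {t\<in>{0..l e0}. w e0 t = 0}" using w1[OF e0, of t] t by auto
  qed
  then have "finite {0<..<min \<delta> (l e0)}"
    using simple_zeros_finite[OF eig_simple_zeros[OF w(1) wnz e0]] finite_subset by blast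
  then show False using \<delta>(1) graphD(6)[OF e0] by (simp add: infinite_Ioo)
qed

end

section \<open>Indices of eigenfunctions and assembly of the bounds\<close>

context generic_graph
begin

text \<open>The lower bound is applied to arbitrary finite subsets of \<open>S\<close> and so proves
  \<open>S\<close> finite; only then can the whole of \<open>S\<close> serve as index set in the
  upper bound.\<close>

lemma eigenvalues_below:
  assumes f: "eig lam f D fv" and nz: "nonzero f"
  defines "S \<equiv> {mu. eigenvalue V E src tgt l W mu \<and> mu < lam}"
  shows "finite S" "card S \<le> card (zero_edge_points E l f)" "int (card (zero_edge_points E l f)) \<le> int (card S) + betti V E"
proof -
  have "\<forall>mu\<in>S. \<exists>g D' gv. eig mu g D' gv \<and> nonzero g"
    unfolding S_def eigenvalue_def eigenfunction_iff by blast
  then obtain g D' gv where g: "\<And>mu. mu \<in> S \<Longrightarrow> eig mu (g mu) (D' mu) (gv mu)" "\<And>mu. mu \<in> S \<Longrightarrow> nonzero (g mu)" by metis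
  have bd: "card A \<le> card (zero_edge_points E l f)" if "finite A" "A \<subseteq> S" for A
    by (rule card_eigenvalues_below_le[OF f nz that(1), of "\<lambda>mu. mu" g D' gv]) (use g that in \<open>auto simp: S_def\<close>)
  show fS: "finite S" using bd finite_if_finite_subsets_card_bdd[of S] by blast
  show "card S \<le> card (zero_edge_points E l f)" using bd[OF fS] by blast
  show "int (card (zero_edge_points E l f)) \<le> int (card S) + betti V E"
    by (rule card_zeros_le[OF f nz fS, of "\<lambda>mu. mu" g D' gv]) (use g in \<open>auto simp: S_def\<close>)
qed

text \<open>All multiplicities are 1, so the two inequalities for \<open>k\<close> leave a single
  value.\<close>

lemma kth_eigenfunctionE:
  assumes "kth_eigenfunction V E src tgt l W k f"
  obtains lam D fv where "eig lam f D fv" "nonzero f" "k = card {mu. eigenvalue V E src tgt l W mu \<and> mu < lam} + 1"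
proof -
  obtain lam where lam: "is_eigenfunction lam f"
    and k: "(\<Sum>mu\<in>{mu. eigenvalue V E src tgt l W mu \<and> mu < lam}. Defs.multiplicity V E src tgt l W mu) < k"
      "k \<le> (\<Sum>mu\<in>{mu. eigenvalue V E src tgt l W mu \<and> mu < lam}. Defs.multiplicity V E src tgt l W mu) + Defs.multiplicity V E src tgt l W lam"
    using assms unfolding kth_eigenfunction_def Let_def by blast
  have "(\<Sum>mu\<in>{mu. eigenvalue V E src tgt l W mu \<and> mu < lam}. Defs.multiplicity V E src tgt l W mu)
      = card {mu. eigenvalue V E src tgt l W mu \<and> mu < lam}"
    using multiplicity_one by simp
  moreover have "Defs.multiplicity V E src tgt l W lam = 1"
    by (rule multiplicity_one) (use lam in \<open>auto simp: eigenvalue_def\<close>)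
  ultimately show thesis using that lam k unfolding eigenfunction_iff by auto
qed

end

theorem theorem1:
  fixes V :: "'v set" and E :: "'e set" and src tgt :: "'e \<Rightarrow> 'v" and l :: "'e \<Rightarrow> real"
    and W :: "'e \<Rightarrow> real \<Rightarrow> real"
    and M :: nat and k :: "nat \<Rightarrow> nat" and a :: "nat \<Rightarrow> real"
    and fs :: "nat \<Rightarrow> 'e \<Rightarrow> real \<Rightarrow> real"
  assumes graph: "metric_graph V E src tgt l"
    and pot: "C1_potential V E src tgt l W"
    and gen: "W_generic V E src tgt l W"
    and M_pos: "M \<ge> 1"
    and k_pos: "k 0 \<ge> 1"
    and k_mono: "\<And>i j. i < j \<Longrightarrow> j < M \<Longrightarrow> k i < k j"
    and eig: "\<And>i. i < M \<Longrightarrow> kth_eigenfunction V E src tgt l W (k i) (fs i)"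
    and a_nz: "\<And>i. i < M \<Longrightarrow> a i \<noteq> 0"
  shows "let F = (\<lambda>e t. \<Sum>i<M. a i * fs i e t);
             \<beta> = betti V E;
             B = int (card (boundary_vertices V E src tgt)) + 2 * \<beta> - 2;
             N = int (card (zero_vertices V E src tgt l F)) + int (card (zero_edge_points E l F))
         in finite (zero_vertices V E src tgt l F) \<and> finite (zero_edge_points E l F) \<and>
            int (k 0) - 1 - (int M - 1) * B \<le> N \<and>
            N \<le> int (k (M - 1)) - 1 + \<beta> + (int M - 1) * B"
proof -
  interpret G: generic_graph V E src tgt l W
  proof
    show "metric_graph V E src tgt l" by (rule graph)
    show "W_generic V E src tgt l W" by (rule gen)
    fix e assume "e \<in> E"
    then obtain W' where "\<forall>t\<in>{0..l e}. (W e has_real_derivative W' t) (at t within {0..l e})"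
      using pot unfolding C1_potential_def by blast
    then show "continuous_on {0..l e} (W e)" by (intro derivative_Icc_continuous) blast
  qed
  define S where "S lam = {mu. eigenvalue V E src tgt l W mu \<and> mu < lam}" for lam
  have "\<forall>i\<in>{..<M}. \<exists>lam D fv. G.eig lam (fs i) D fv \<and> (\<exists>e\<in>E. \<exists>t\<in>{0..l e}. fs i e t \<noteq> 0) \<and> k i = card (S lam) + 1"
  proof
    fix i assume "i \<in> {..<M}"
    then have "kth_eigenfunction V E src tgt l W (k i) (fs i)" using eig by simp
    then show "\<exists>lam D fv. G.eig lam (fs i) D fv \<and> (\<exists>e\<in>E. \<exists>t\<in>{0..l e}. fs i e t \<noteq> 0) \<and> k i = card (S lam) + 1"
      unfolding S_def by (rule G.kth_eigenfunctionE) blast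
  qed
  from bchoice[OF this] obtain lam where
    "\<forall>i\<in>{..<M}. \<exists>D fv. G.eig (lam i) (fs i) D fv \<and> (\<exists>e\<in>E. \<exists>t\<in>{0..l e}. fs i e t \<noteq> 0) \<and> k i = card (S (lam i)) + 1" by blast
  from bchoice[OF this] obtain D where
    "\<forall>i\<in>{..<M}. \<exists>fv. G.eig (lam i) (fs i) (D i) fv \<and> (\<exists>e\<in>E. \<exists>t\<in>{0..l e}. fs i e t \<noteq> 0) \<and> k i = card (S (lam i)) + 1" by blast
  from bchoice[OF this] obtain fv where
    *: "\<forall>i\<in>{..<M}. G.eig (lam i) (fs i) (D i) (fv i) \<and> (\<exists>e\<in>E. \<exists>t\<in>{0..l e}. fs i e t \<noteq> 0) \<and> k i = card (S (lam i)) + 1" by blast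
  have ef: "G.eig (lam i) (fs i) (D i) (fv i)" and nz: "\<exists>e\<in>E. \<exists>t\<in>{0..l e}. fs i e t \<noteq> 0"
    and k: "k i = card (S (lam i)) + 1" if "i < M" for i using * that by blast+
  note S = G.eigenvalues_below[OF ef nz, folded S_def]
  \<comment> \<open>An index is one more than the number of smaller eigenvalues, so it cannot
    increase unless the eigenvalue does.\<close>
  have mono: "lam i < lam j" if "i < j" "j < M" for i j
  proof (rule ccontr)
    assume "\<not> lam i < lam j"
    then have "S (lam j) \<subseteq> S (lam i)" unfolding S_def by auto
    then have "card (S (lam j)) \<le> card (S (lam i))" using S(1)[of i] that by (intro card_mono) auto
    then show False using k_mono[OF that] k[of i] k[of j] that by simp
  qed
  obtain C where C: "\<And>e t. e \<in> E \<Longrightarrow> t \<in> {0..l e} \<Longrightarrow> \<bar>W e t - 0\<bar> \<le> C" using G.W_bound[of 0] by blast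
  \<comment> \<open>One shift serves two purposes: \<open>W + c > 0\<close> for the maximum
    principle and \<open>lam i + c > 0\<close> for the real powers in the weights.\<close>
  define c where "c = \<bar>C\<bar> + 1 + (\<Sum>i<M. \<bar>lam i\<bar>)"
  have s0: "0 \<le> (\<Sum>i<M. \<bar>lam i\<bar>)" by (rule sum_nonneg) simp
  interpret F: eigen_combination V E src tgt l W M a lam fs D fv c
  proof
    show "0 < lam i + c" if "i < M" for i
    proof -
      have "\<bar>lam i\<bar> \<le> (\<Sum>i<M. \<bar>lam i\<bar>)" by (rule member_le_sum) (use that in auto)
      then show ?thesis unfolding c_def by linarith
    qed
    show "0 < W e t + c" if "e \<in> E" "t \<in> {0..l e}" for e t
      using C[OF that] s0 unfolding c_def by linarith
  qed (use M_pos a_nz ef nz mono in auto)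
  have F: "(\<lambda>e t. \<Sum>i<M. a i * fs i e t) = F.lc a fs" by (intro ext) (simp add: F.lc_def)
  note zv = G.zero_vertices_eq[OF F.vertex_cont_lc[of a]]
  note Z = F.zero_count_combination[unfolded G.zero_count_def, folded zv, unfolded G.sum_deg_excess]
  have "finite (zero_vertices V E src tgt l (F.lc a fs))" unfolding zv using G.finite_Vi by simp
  then show ?thesis
    unfolding Let_def F using Z k[of 0] k[of "M - 1"] S(2)[of 0] S(3)[of "M - 1"] M_pos by auto
qed

end
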